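(* Let $E=(E^0,E^1,r,s)$ be a directed graph, let $\beta>0$, and let $c:E^1\to(0,\infty)$ be a function for which there is a constant $k>0$ with $c(e)>k$ for all $e\in E^1$; extend $c$ multiplicatively to $E^*$. Consider states $\omega$ on the core $C^*(E)^\gamma$ satisfying $$\omega(s_{\mu}s_{\nu}^* )=[\mu=\nu]\,c(\mu)^{-\beta}\,\omega(p_{s(\mu)})\quad\text{for all }\mu,\nu\in E^*\text{ with }|\mu|=|\nu|,\ s(\mu)=s(\nu).\qquad(\ast)$$ If $\omega$ is a state on $C^*(E)^\gamma$ satisfying $(\ast)$, then its restriction $\tau$ to $C_0(E^0)$ satisfies: (K1) $\mathcal F_{c,\beta}(\tau)(a)=\tau(a)$ for all $a\in\overline{\mathrm{span}}\{p_v:0<|r^{-1}(v)|<\infty\}$; (K2) $\mathcal F_{c,\beta}(\tau)(a)\le\tau(a)$ for all $a\in C_0(E^0)^+$. Conversely, if $\tau$ is a tracial state on $C_0(E^0)$ satisfying (K1) and (K2), then there is a unique state $\omega$ on $C^*(E)^\gamma$ which satisfies $(\ast)$ and whose restriction to $C_0(E^0)$ is $\tau$. This correspondence preserves convex combinations.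
   Context: A directed graph $E=(E^0,E^1,r,s)$ consists of nonempty sets $E^0$ (vertices), $E^1$ (edges) and functions $r,s:E^1\to E^0$ (range, source); no countability or finiteness is assumed. A path of length $n\ge1$ is a sequence $\mu=\mu_1\cdots\mu_n$ of edges with $r(\mu_{i+1})=s(\mu_i)$ for $1\le i\le n-1$; $|\mu|=n$, $s(\mu)=s(\mu_n)$, $r(\mu)=r(\mu_1)$. Vertices are paths of length $0$, with $s(v)=v=r(v)$. $E^n$ is the set of paths of length $n$ and $E^*=\bigcup_{n\ge0}E^n$. $C^*(E)$ is the universal C*-algebra generated by mutually orthogonal projections $\{p_v\}_{v\in E^0}$ and partial isometries $\{s_e\}_{e\in E^1}$ with mutually orthogonal ranges such that (1) $s_e^*s_e=p_{s(e)}$; (2) $s_es_e^*\le p_{r(e)}$ for every $e\in E^1$; (3) $p_v=\sum_{e\in r^{-1}(v)}s_es_e^*$ whenever $0<|r^{-1}(v)|<\infty$. For $\mu=\mu_1\cdots\mu_n$, $s_\mu=s_{\mu_1}\cdots s_{\mu_n}$, and $s_v=p_v$ for $v\in E^0$. The gauge action $\gamma$ of $\mathbb T$ on $C^*(E)$ is given by $\gamma_z(s_e)=zs_e$, $\gamma_z(p_v)=p_v$; the core $C^*(E)^\gamma$ is its fixed-point algebra and equals $\overline{\mathrm{span}}\{s_\mu s_\nu^*:s(\mu)=s(\nu),|\mu|=|\nu|\}$. $C_0(E^0)$ ($E^0$ discrete) is identified with $\overline{\mathrm{span}}\{p_v\}_{v\in E^0}\subseteq C^*(E)^\gamma$, the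 characteristic function of $\{v\}$ corresponding to $p_v$; for a tracial state $\tau$ on $C_0(E^0)$, write $\tau_v=\tau(p_v)$. The function $c$ is extended to $E^*$ by $c(v)=1$ for $v\in E^0$ and $c(\mu)=c(\mu_1)\cdots c(\mu_n)$ for $\mu=\mu_1\cdots\mu_n\in E^n$. $[P]$ equals $1$ if $P$ is true and $0$ otherwise. Definition of $\mathcal F_{c,\beta}(\tau)$. Let $X$ be the Hilbert $C_0(E^0)$-module completing $C_c(E^1)$ with $\langle\xi,\eta\rangle(v)=\sum_{e\in s^{-1}(v)}\overline{\xi(e)}\eta(e)$ and $(\xi a)(e)=\xi(e)a(s(e))$, and let $i_X:C_0(E^0)\to\mathcal L(X)$ be $i_X(a)(\xi)(e)=a(r(e))\xi(e)$; the bounded function $c^{-\beta}$ acts on $X$ by pointwise multiplication. With $\chi_e$ the characteristic function of $\{e\}$ and $\mathrm{Tr}_\tau(T)=\lim_{\lambda}\sum_{e\in\lambda}\tau(\langle\chi_e,T\chi_e\rangle)$ (limit over finite subsets $\lambda\subseteq E^1$), put $\mathcal F_{c,\beta}(\tau)(a)=\mathrm{Tr}_\tau(i_X(a)c^{-\beta})$. Explicitly, $$\mathcal F_{c,\beta}(\tau)(a)=\lim_{\lambda}\sum_{e\in\lambda}a(r(e))\,c(e)^{-\beta}\,\tau_{s(e)},$$ which takes values in $[0,\infty]$ for $a\in C_0(E^0)^+$, and is given by the same (convergent) formula for those $a$ with $\mathcal F_{c,\beta}(\tau)(|a|)<\infty$. In particular $\mathcal F_{c,\beta}(\tau)(p_v)=\lim_{D}\sum_{e\in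 D}c(e)^{-\beta}\tau_{s(e)}$ over finite $D\subseteq r^{-1}(v)$, which is $0$ if $r^{-1}(v)=\emptyset$. Condition (K1) includes the assertion that the left-hand side is finite. *)

theory Defs
  imports "HOL-Analysis.Analysis" "HOL-Algebra.Ring" "HOL-Library.Poly_Mapping"
    "HOL-Library.Nonpos_Ints"
begin

section \<open>C*-algebras with explicit carriers\<close>

text \<open>C*-algebras are not assumed to be unital: the field \<open>one\<close> inherited from the record
  \<^typ>\<open>'a ring\<close> of HOL-Algebra is never used.\<close>

record 'a cstar = "'a ring" +
  cscale :: "complex \<Rightarrow> 'a \<Rightarrow> 'a"  (infixr \<open>\<cdot>\<index>\<close> 75)
  adj :: "'a \<Rightarrow> 'a"
  cnorm :: "'a \<Rightarrow> real"

definition cstar_algebra :: "('a, 'm) cstar_scheme \<Rightarrow> bool" where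
  "cstar_algebra A \<longleftrightarrow>
     abelian_group A \<and>
     (\<forall>a\<in>carrier A. \<forall>b\<in>carrier A. a \<otimes>\<^bsub>A\<^esub> b \<in> carrier A) \<and>
     (\<forall>z. \<forall>a\<in>carrier A. z \<cdot>\<^bsub>A\<^esub> a \<in> carrier A) \<and>
     (\<forall>a\<in>carrier A. adj A a \<in> carrier A) \<and>
     (\<forall>a\<in>carrier A. \<forall>b\<in>carrier A. \<forall>d\<in>carrier A.
        (a \<otimes>\<^bsub>A\<^esub> b) \<otimes>\<^bsub>A\<^esub> d = a \<otimes>\<^bsub>A\<^esub> (b \<otimes>\<^bsub>A\<^esub> d) \<and>
        (a \<oplus>\<^bsub>A\<^esub> b) \<otimes>\<^bsub>A\<^esub> d = a \<otimes>\<^bsub>A\<^esub> d \<oplus>\<^bsub>A\<^esub> b \<otimes>\<^bsub>A\<^esub> d \<and>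
        d \<otimes>\<^bsub>A\<^esub> (a \<oplus>\<^bsub>A\<^esub> b) = d \<otimes>\<^bsub>A\<^esub> a \<oplus>\<^bsub>A\<^esub> d \<otimes>\<^bsub>A\<^esub> b) \<and>
     (\<forall>z w. \<forall>a\<in>carrier A. \<forall>b\<in>carrier A.
        z \<cdot>\<^bsub>A\<^esub> (a \<oplus>\<^bsub>A\<^esub> b) = z \<cdot>\<^bsub>A\<^esub> a \<oplus>\<^bsub>A\<^esub> z \<cdot>\<^bsub>A\<^esub> b \<and>
        (z + w) \<cdot>\<^bsub>A\<^esub> a = z \<cdot>\<^bsub>A\<^esub> a \<oplus>\<^bsub>A\<^esub> w \<cdot>\<^bsub>A\<^esub> a \<and>
        (z * w) \<cdot>\<^bsub>A\<^esub> a = z \<cdot>\<^bsub>A\<^esub> (w \<cdot>\<^bsub>A\<^esub> a) \<and>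
        1 \<cdot>\<^bsub>A\<^esub> a = a \<and>
        z \<cdot>\<^bsub>A\<^esub> (a \<otimes>\<^bsub>A\<^esub> b) = (z \<cdot>\<^bsub>A\<^esub> a) \<otimes>\<^bsub>A\<^esub> b \<and>
        z \<cdot>\<^bsub>A\<^esub> (a \<otimes>\<^bsub>A\<^esub> b) = a \<otimes>\<^bsub>A\<^esub> (z \<cdot>\<^bsub>A\<^esub> b)) \<and>
     (\<forall>z. \<forall>a\<in>carrier A. \<forall>b\<in>carrier A.
        adj A (adj A a) = a \<and>
        adj A (a \<oplus>\<^bsub>A\<^esub> b) = adj A a \<oplus>\<^bsub>A\<^esub> adj A b \<and>
        adj A (z \<cdot>\<^bsub>A\<^esub> a) = cnj z \<cdot>\<^bsub>A\<^esub> adj A a \<and>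
        adj A (a \<otimes>\<^bsub>A\<^esub> b) = adj A b \<otimes>\<^bsub>A\<^esub> adj A a) \<and>
     (\<forall>z. \<forall>a\<in>carrier A. \<forall>b\<in>carrier A.
        0 \<le> cnorm A a \<and>
        (cnorm A a = 0 \<longleftrightarrow> a = \<zero>\<^bsub>A\<^esub>) \<and>
        cnorm A (a \<oplus>\<^bsub>A\<^esub> b) \<le> cnorm A a + cnorm A b \<and>
        cnorm A (z \<cdot>\<^bsub>A\<^esub> a) = cmod z * cnorm A a \<and>
        cnorm A (a \<otimes>\<^bsub>A\<^esub> b) \<le> cnorm A a * cnorm A b \<and>
        cnorm A (adj A a \<otimes>\<^bsub>A\<^esub> a) = (cnorm A a)\<^sup>2) \<and>
     (\<forall>X. (\<forall>n. X n \<in> carrier A) \<and>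
        (\<forall>\<epsilon>>0. \<exists>N. \<forall>m\<ge>N. \<forall>n\<ge>N. cnorm A (X m \<ominus>\<^bsub>A\<^esub> X n) < \<epsilon>) \<longrightarrow>
        (\<exists>a\<in>carrier A. (\<lambda>n. cnorm A (X n \<ominus>\<^bsub>A\<^esub> a)) \<longlonglongrightarrow> 0))"

text \<open>A *-homomorphism of C*-algebras is automatically norm-decreasing; the last clause is
  included only so that this need not be rederived.\<close>

definition star_hom :: "('a, 'm) cstar_scheme \<Rightarrow> ('b, 'n) cstar_scheme \<Rightarrow> ('a \<Rightarrow> 'b) \<Rightarrow> bool" where
  "star_hom A B \<phi> \<longleftrightarrow>
     (\<forall>a\<in>carrier A. \<phi> a \<in> carrier B) \<and>
     (\<forall>a\<in>carrier A. \<forall>b\<in>carrier A. \<phi> (a \<oplus>\<^bsub>A\<^esub> b) = \<phi> a \<oplus>\<^bsub>B\<^esub> \<phi> b) \<and>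
     (\<forall>z. \<forall>a\<in>carrier A. \<phi> (z \<cdot>\<^bsub>A\<^esub> a) = z \<cdot>\<^bsub>B\<^esub> \<phi> a) \<and>
     (\<forall>a\<in>carrier A. \<forall>b\<in>carrier A. \<phi> (a \<otimes>\<^bsub>A\<^esub> b) = \<phi> a \<otimes>\<^bsub>B\<^esub> \<phi> b) \<and>
     (\<forall>a\<in>carrier A. \<phi> (adj A a) = adj B (\<phi> a)) \<and>
     (\<forall>a\<in>carrier A. cnorm B (\<phi> a) \<le> cnorm A a)"

definition cspan :: "('a, 'm) cstar_scheme \<Rightarrow> 'a set \<Rightarrow> 'a set" where
  "cspan A X = {\<Oplus>\<^bsub>A\<^esub>x\<in>D. z x \<cdot>\<^bsub>A\<^esub> x | D z. finite D \<and> D \<subseteq> X}"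

definition closed_cspan :: "('a, 'm) cstar_scheme \<Rightarrow> 'a set \<Rightarrow> 'a set" where
  "closed_cspan A X =
     {a \<in> carrier A. \<forall>\<epsilon>>0. \<exists>b\<in>cspan A X. cnorm A (a \<ominus>\<^bsub>A\<^esub> b) < \<epsilon>}"

text \<open>States are the positive linear functionals of norm \<open>1\<close>.  Functionals are total functions,
  of which only the values on the carrier matter.\<close>

definition state :: "('a, 'm) cstar_scheme \<Rightarrow> ('a \<Rightarrow> complex) \<Rightarrow> bool" where
  "state A \<omega> \<longleftrightarrow>
     (\<forall>a\<in>carrier A. \<forall>b\<in>carrier A. \<omega> (a \<oplus>\<^bsub>A\<^esub> b) = \<omega> a + \<omega> b) \<and>
     (\<forall>z. \<forall>a\<in>carrier A. \<omega> (z \<cdot>\<^bsub>A\<^esub> a) = z * \<omega> a) \<and>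
     (\<forall>a\<in>carrier A. \<omega> (adj A a \<otimes>\<^bsub>A\<^esub> a) \<in> \<real>\<^sub>\<ge>\<^sub>0) \<and>
     bdd_above {cmod (\<omega> a) | a. a \<in> carrier A \<and> cnorm A a \<le> 1} \<and>
     Sup {cmod (\<omega> a) | a. a \<in> carrier A \<and> cnorm A a \<le> 1} = 1"

definition tracial_state :: "('a, 'm) cstar_scheme \<Rightarrow> ('a \<Rightarrow> complex) \<Rightarrow> bool" where
  "tracial_state A \<tau> \<longleftrightarrow> state A \<tau> \<and>
     (\<forall>a\<in>carrier A. \<forall>b\<in>carrier A. \<tau> (a \<otimes>\<^bsub>A\<^esub> b) = \<tau> (b \<otimes>\<^bsub>A\<^esub> a))"


section \<open>The free *-algebra and its C*-completions\<close>

datatype 'g letter = Gen 'g | Adj 'g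

primrec flip_letter :: "'g letter \<Rightarrow> 'g letter" where
  "flip_letter (Gen g) = Adj g"
| "flip_letter (Adj g) = Gen g"

text \<open>Words in the generators and their adjoints, added by concatenation.\<close>

datatype 'g monomial = Letters (letters: "'g letter list")

instantiation monomial :: (type) monoid_add
begin

definition "0 = Letters []"
definition "u + v = Letters (letters u @ letters v)"

instance
  by standard (simp_all add: zero_monomial_def plus_monomial_def)

end

definition adj_mono :: "'g monomial \<Rightarrow> 'g monomial" where
  "adj_mono w = Letters (rev (map flip_letter (letters w)))"

text \<open>Noncommutative *-polynomials: the product provided by \<open>Poly_Mapping\<close> is the convolution
  product for concatenation of words.  The free (non-unital) *-algebra consists of those
  without constant term.\<close>

type_synonym 'g star_poly = "'g monomial \<Rightarrow>\<^sub>0 complex"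

definition free_star_algebra :: "'g star_poly set" where
  "free_star_algebra = {x. Poly_Mapping.lookup x 0 = 0}"

definition gen_poly :: "'g \<Rightarrow> 'g star_poly" where
  "gen_poly g = Poly_Mapping.single (Letters [Gen g]) 1"

definition scale_poly :: "complex \<Rightarrow> 'g star_poly \<Rightarrow> 'g star_poly" where
  "scale_poly z x = Poly_Mapping.single 0 z * x"

definition adj_poly :: "'g star_poly \<Rightarrow> 'g star_poly" where
  "adj_poly x = Poly_Mapping.map cnj (Poly_Mapping.map_key adj_mono x)"

definition cstar_seminorm :: "('g star_poly \<Rightarrow> real) \<Rightarrow> bool" where
  "cstar_seminorm q \<longleftrightarrow>
     (\<forall>x\<in>free_star_algebra. \<forall>y\<in>free_star_algebra.
        q (x + y) \<le> q x + q y \<and> q (x * y) \<le> q x * q y) \<and>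
     (\<forall>z. \<forall>x\<in>free_star_algebra. q (scale_poly z x) = cmod z * q x) \<and>
     (\<forall>x\<in>free_star_algebra. q (adj_poly x * x) = (q x)\<^sup>2)"

text \<open>The Hausdorff completion of the free *-algebra in a C*-seminorm \<open>q\<close>, by classes of Cauchy
  sequences.\<close>

definition cauchy_seqs :: "('g star_poly \<Rightarrow> real) \<Rightarrow> (nat \<Rightarrow> 'g star_poly) set" where
  "cauchy_seqs q = {X. (\<forall>n. X n \<in> free_star_algebra) \<and>
     (\<forall>\<epsilon>>0. \<exists>N. \<forall>m\<ge>N. \<forall>n\<ge>N. q (X m - X n) < \<epsilon>)}"

definition cauchy_class :: "('g star_poly \<Rightarrow> real) \<Rightarrow> (nat \<Rightarrow> 'g star_poly) \<Rightarrow> (nat \<Rightarrow> 'g star_poly) set" where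
  "cauchy_class q X = {Y \<in> cauchy_seqs q. (\<lambda>n. q (X n - Y n)) \<longlonglongrightarrow> 0}"

definition cauchy_rep :: "(nat \<Rightarrow> 'g star_poly) set \<Rightarrow> nat \<Rightarrow> 'g star_poly" where
  "cauchy_rep a = (SOME X. X \<in> a)"

definition completion :: "('g star_poly \<Rightarrow> real) \<Rightarrow> (nat \<Rightarrow> 'g star_poly) set cstar" where
  "completion q =
     \<lparr>carrier = cauchy_class q ` cauchy_seqs q,
      mult = (\<lambda>a b. cauchy_class q (\<lambda>n. cauchy_rep a n * cauchy_rep b n)),
      one = undefined,
      zero = cauchy_class q (\<lambda>n. 0),
      add = (\<lambda>a b. cauchy_class q (\<lambda>n. cauchy_rep a n + cauchy_rep b n)),
      cscale = (\<lambda>z a. cauchy_class q (\<lambda>n. scale_poly z (cauchy_rep a n))),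
      adj = (\<lambda>a. cauchy_class q (\<lambda>n. adj_poly (cauchy_rep a n))),
      cnorm = (\<lambda>a. lim (\<lambda>n. q (cauchy_rep a n)))\<rparr>"

definition completion_gen :: "('g star_poly \<Rightarrow> real) \<Rightarrow> 'g \<Rightarrow> (nat \<Rightarrow> 'g star_poly) set" where
  "completion_gen q g = cauchy_class q (\<lambda>n. gen_poly g)"


subsection \<open>The completion is a C*-algebra\<close>

lemma adj_mono_invol [simp]: "adj_mono (adj_mono w) = w"
proof -
  have "flip_letter \<circ> flip_letter = (id :: 'a letter \<Rightarrow> _)"
    by (rule ext, rename_tac l, case_tac l) simp_all
  thus ?thesis by (simp add: adj_mono_def rev_map)
qed

lemma inj_adj_mono [simp]: "inj adj_mono"
  by (metis adj_mono_invol injI)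

lemma adj_mono_plus: "adj_mono (u + v) = adj_mono v + adj_mono u"
  by (simp add: adj_mono_def plus_monomial_def)

lemma adj_mono_0 [simp]: "adj_mono 0 = 0"
  by (simp add: adj_mono_def zero_monomial_def)

lemma lookup_adj_poly [simp]:
  "Poly_Mapping.lookup (adj_poly x) w = cnj (Poly_Mapping.lookup x (adj_mono w))"
  unfolding adj_poly_def
  by (simp add: map.rep_eq map_key.rep_eq when_def)

lemma adj_poly_invol [simp]: "adj_poly (adj_poly x) = x"
  by (rule poly_mapping_eqI) simp

lemma adj_poly_add: "adj_poly (x + y) = adj_poly x + adj_poly y"
  by (rule poly_mapping_eqI) (simp add: lookup_add)

lemma adj_poly_diff: "adj_poly (x - y) = adj_poly x - adj_poly y"
  by (rule poly_mapping_eqI) (simp add: lookup_minus)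

lemma adj_poly_0 [simp]: "adj_poly 0 = 0"
  by (rule poly_mapping_eqI) simp

lemma adj_poly_single [simp]:
  "adj_poly (Poly_Mapping.single w z) = Poly_Mapping.single (adj_mono w) (cnj z)"
  by (rule poly_mapping_eqI) (auto simp: lookup_single when_def)

lemma star_poly_induct:
  fixes x :: "'g star_poly"
  assumes "P 0" "\<And>w z. P (Poly_Mapping.single w z)" "\<And>x y. P x \<Longrightarrow> P y \<Longrightarrow> P (x + y)"
  shows "P x"
proof (induction x rule: update_induct)
  case const thus ?case using assms(1) .
next
  case (update f a b)
  have "Poly_Mapping.update a b f = f + Poly_Mapping.single a b"
    using update(1) by (intro poly_mapping_eqI) (auto simp: lookup_update lookup_add lookup_single when_def in_keys_iff)
  thus ?case using assms(3)[OF update.IH assms(2)[of a b]] by simp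
qed

lemma adj_poly_mult: "adj_poly (x * y) = adj_poly y * adj_poly x"
proof (induction x rule: star_poly_induct)
  case (2 w z)
  show ?case
  proof (induction y rule: star_poly_induct)
    case (2 w' z')
    show ?case by (simp add: mult_single adj_mono_plus mult.commute)
  qed (simp_all add: adj_poly_add ring_distribs)
qed (simp_all add: adj_poly_add ring_distribs)

lemma scale_poly_left: "scale_poly z (x * y) = scale_poly z x * y"
  by (simp add: scale_poly_def mult.assoc)

lemma scale_poly_alt: "scale_poly z x = Poly_Mapping.map ((*) z) x"
  by (simp add: scale_poly_def mult_map_scale_conv_mult)

lemma lookup_scale [simp]: "Poly_Mapping.lookup (scale_poly z x) w = z * Poly_Mapping.lookup x w"
  by (simp add: scale_poly_alt map.rep_eq when_def)

lemma scale_poly_right: "scale_poly z (x * y) = x * scale_poly z y"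
proof (induction x rule: star_poly_induct)
  case (2 w c)
  show ?case
    by (simp add: scale_poly_def mult_single flip: mult.assoc) (simp add: mult.commute)
qed (simp_all add: scale_poly_def ring_distribs)

lemma adj_scale: "adj_poly (scale_poly z x) = scale_poly (cnj z) (adj_poly x)"
  by (rule poly_mapping_eqI) simp

lemma monomial_add_0_iff: "(u + v = (0 :: 'g monomial)) \<longleftrightarrow> u = 0 \<and> v = 0"
  by (cases u; cases v) (simp add: zero_monomial_def plus_monomial_def)

lemma lookup_mult_0: "Poly_Mapping.lookup (x * y :: 'g star_poly) 0 = Poly_Mapping.lookup x 0 * Poly_Mapping.lookup y 0"
proof (induction x rule: star_poly_induct)
  case (2 w z)
  show ?case
  proof (induction y rule: star_poly_induct)
    case (2 w' z')
    show ?case by (auto simp: mult_single lookup_single when_def monomial_add_0_iff)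
  qed (simp_all add: lookup_add ring_distribs)
qed (simp_all add: lookup_add ring_distribs)

lemma F0_closed [simp, intro]:
  "0 \<in> free_star_algebra"
  "x \<in> free_star_algebra \<Longrightarrow> y \<in> free_star_algebra \<Longrightarrow> x + y \<in> free_star_algebra"
  "x \<in> free_star_algebra \<Longrightarrow> y \<in> free_star_algebra \<Longrightarrow> x - y \<in> free_star_algebra"
  "x \<in> free_star_algebra \<Longrightarrow> - x \<in> free_star_algebra"
  "x \<in> free_star_algebra \<Longrightarrow> y \<in> free_star_algebra \<Longrightarrow> x * y \<in> free_star_algebra"
  "x \<in> free_star_algebra \<Longrightarrow> scale_poly z x \<in> free_star_algebra"
  "x \<in> free_star_algebra \<Longrightarrow> adj_poly x \<in> free_star_algebra"
  "gen_poly g \<in> free_star_algebra"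
  by (auto simp: free_star_algebra_def lookup_add lookup_minus lookup_mult_0 gen_poly_def lookup_single when_def)
    (simp add: zero_monomial_def)

locale free_cstar_seminorm = fixes q :: "'g star_poly \<Rightarrow> real" assumes q: "cstar_seminorm q"
begin

abbreviation "A \<equiv> completion q"
abbreviation "C \<equiv> cauchy_seqs q"
abbreviation "cl \<equiv> cauchy_class q"

lemma q_add: "x \<in> free_star_algebra \<Longrightarrow> y \<in> free_star_algebra \<Longrightarrow> q (x + y) \<le> q x + q y"
  and q_mult: "x \<in> free_star_algebra \<Longrightarrow> y \<in> free_star_algebra \<Longrightarrow> q (x * y) \<le> q x * q y"
  and q_scale: "x \<in> free_star_algebra \<Longrightarrow> q (scale_poly z x) = cmod z * q x"
  and q_cstar: "x \<in> free_star_algebra \<Longrightarrow> q (adj_poly x * x) = (q x)\<^sup>2"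
  using q by (auto simp: cstar_seminorm_def)

lemma q_0 [simp]: "q 0 = 0"
proof -
  have "scale_poly 0 0 = (0 :: 'g star_poly)" by (rule poly_mapping_eqI) simp
  thus ?thesis using q_scale[of 0 0] by simp
qed

lemma q_minus: "x \<in> free_star_algebra \<Longrightarrow> q (- x) = q x"
proof -
  assume x: "x \<in> free_star_algebra"
  have "scale_poly (-1) x = - x" by (rule poly_mapping_eqI) simp
  thus ?thesis using q_scale[of x "-1"] x by simp
qed

lemma q_nonneg: "x \<in> free_star_algebra \<Longrightarrow> 0 \<le> q x"
  using q_add[of x "-x"] q_minus[of x] by auto

lemma q_diff_commute: "x \<in> free_star_algebra \<Longrightarrow> y \<in> free_star_algebra \<Longrightarrow> q (x - y) = q (y - x)"
  using q_minus[of "x - y"] by auto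

lemma q_tri: "x \<in> free_star_algebra \<Longrightarrow> y \<in> free_star_algebra \<Longrightarrow> z \<in> free_star_algebra \<Longrightarrow> q (x - z) \<le> q (x - y) + q (y - z)"
  using q_add[of "x - y" "y - z"] by auto

lemma q_abs: "x \<in> free_star_algebra \<Longrightarrow> y \<in> free_star_algebra \<Longrightarrow> \<bar>q x - q y\<bar> \<le> q (x - y)"
  using q_add[of "x - y" y] q_add[of "y - x" x] q_diff_commute[of x y] by auto

lemma q_adj: assumes "x \<in> free_star_algebra" shows "q (adj_poly x) = q x"
proof -
  have *: "q x \<le> q (adj_poly x)" if "x \<in> free_star_algebra" for x
    using q_cstar[of x] q_mult[of "adj_poly x" x] q_nonneg[of x] q_nonneg[of "adj_poly x"] that
    by (cases "q x = 0") (auto simp: power2_eq_square)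
  from *[of x] *[of "adj_poly x"] assms show ?thesis by auto
qed

lemma C_F0: "X \<in> C \<Longrightarrow> X n \<in> free_star_algebra" by (auto simp: cauchy_seqs_def)

lemma CI: "(\<And>n. X n \<in> free_star_algebra) \<Longrightarrow> (\<And>\<epsilon>. \<epsilon> > 0 \<Longrightarrow> \<exists>N. \<forall>m\<ge>N. \<forall>n\<ge>N. q (X m - X n) < \<epsilon>) \<Longrightarrow> X \<in> C"
  by (auto simp: cauchy_seqs_def)

lemma CD: "X \<in> C \<Longrightarrow> \<epsilon> > 0 \<Longrightarrow> \<exists>N. \<forall>m\<ge>N. \<forall>n\<ge>N. q (X m - X n) < \<epsilon>"
  by (auto simp: cauchy_seqs_def)

lemma C_const [simp]: "x \<in> free_star_algebra \<Longrightarrow> (\<lambda>n. x) \<in> C"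
  by (rule CI) auto

lemma C_lip2:
  assumes X: "X \<in> C" and Y: "Y \<in> C" and Z: "\<And>n. Z n \<in> free_star_algebra" and K: "K \<ge> 0"
    and l: "\<And>m n. q (Z m - Z n) \<le> K * (q (X m - X n) + q (Y m - Y n))"
  shows "Z \<in> C"
proof (rule CI[OF Z])
  fix \<epsilon> :: real assume e: "\<epsilon> > 0"
  define d where "d = \<epsilon> / (2 * (K + 1))"
  have d: "d > 0" using e K by (auto simp: d_def)
  obtain N1 N2 where N: "\<forall>m\<ge>N1. \<forall>n\<ge>N1. q (X m - X n) < d" "\<forall>m\<ge>N2. \<forall>n\<ge>N2. q (Y m - Y n) < d"
    using CD[OF X d] CD[OF Y d] by auto
  have "q (Z m - Z n) < \<epsilon>" if "m \<ge> max N1 N2" "n \<ge> max N1 N2" for m n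
  proof -
    have "q (Z m - Z n) \<le> K * (q (X m - X n) + q (Y m - Y n))" by (rule l)
    also have "\<dots> \<le> K * (d + d)" using N that K by (intro mult_left_mono add_mono) (auto simp: less_imp_le)
    also have "\<dots> < (K + 1) * (2 * d)" using d by (simp add: algebra_simps)
    also have "\<dots> = \<epsilon>" using K by (simp add: d_def field_simps)
    finally show ?thesis .
  qed
  thus "\<exists>N. \<forall>m\<ge>N. \<forall>n\<ge>N. q (Z m - Z n) < \<epsilon>" by blast
qed

lemma C_bdd: assumes "X \<in> C" shows "\<exists>K\<ge>0. \<forall>n. q (X n) \<le> K"
proof -
  obtain N where N: "\<forall>m\<ge>N. \<forall>n\<ge>N. q (X m - X n) < 1" using CD[OF assms, of 1] by auto
  have "Bseq (\<lambda>n. q (X n))"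
  proof (rule Cauchy_Bseq, rule CauchyI)
    fix e :: real assume "e > 0"
    from CD[OF assms this] obtain N where "\<forall>m\<ge>N. \<forall>n\<ge>N. q (X m - X n) < e" by auto
    thus "\<exists>M. \<forall>m\<ge>M. \<forall>n\<ge>M. norm (q (X m) - q (X n)) < e"
      using q_abs[OF C_F0[OF assms] C_F0[OF assms]] by (metis order_le_less_trans real_norm_def)
  qed
  then obtain K where "K > 0" "\<And>n. norm (q (X n)) \<le> K" by (auto elim: BseqE)
  thus ?thesis by (metis abs_le_D1 less_imp_le real_norm_def)
qed

lemma q_conv: assumes "X \<in> C" shows "convergent (\<lambda>n. q (X n))"
proof (rule Cauchy_convergent, rule CauchyI)
  fix e :: real assume "e > 0"
  from CD[OF assms this] obtain N where "\<forall>m\<ge>N. \<forall>n\<ge>N. q (X m - X n) < e" by auto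
  thus "\<exists>M. \<forall>m\<ge>M. \<forall>n\<ge>M. norm (q (X m) - q (X n)) < e"
    using q_abs[OF C_F0[OF assms] C_F0[OF assms]] by (metis order_le_less_trans real_norm_def)
qed

lemma C_add: "X \<in> C \<Longrightarrow> Y \<in> C \<Longrightarrow> (\<lambda>n. X n + Y n) \<in> C"
  apply (rule C_lip2[of X Y _ 1])
  using C_F0 q_add[of "X m - X n" "Y m - Y n" for m n] by (auto simp: algebra_simps)

lemma C_adj: "X \<in> C \<Longrightarrow> (\<lambda>n. adj_poly (X n)) \<in> C"
  apply (rule C_lip2[of X X _ 1])
  using C_F0 q_adj q_nonneg by (auto simp flip: adj_poly_diff)

lemma scale_diff: "scale_poly z x - scale_poly z y = scale_poly z (x - y)"
  by (simp add: scale_poly_def right_diff_distrib)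

lemma C_scale: "X \<in> C \<Longrightarrow> (\<lambda>n. scale_poly z (X n)) \<in> C"
  apply (rule C_lip2[of X X _ "cmod z"])
  using C_F0 q_nonneg q_scale by (auto simp: scale_diff distrib_left)

lemma q_mult_diff:
  assumes "x \<in> free_star_algebra" "y \<in> free_star_algebra" "x' \<in> free_star_algebra" "y' \<in> free_star_algebra"
  shows "q (x * y - x' * y') \<le> q (x - x') * q y + q x' * q (y - y')"
proof -
  have "x * y - x' * y' = (x - x') * y + x' * (y - y')" by (simp add: algebra_simps)
  thus ?thesis using q_add[of "(x - x') * y" "x' * (y - y')"] q_mult[of "x - x'" y] q_mult[of x' "y - y'"] assms
    by (auto intro: order_trans)
qed

lemma C_mult: assumes X: "X \<in> C" and Y: "Y \<in> C" shows "(\<lambda>n. X n * Y n) \<in> C"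
proof -
  obtain K1 K2 where K: "K1 \<ge> 0" "\<forall>n. q (X n) \<le> K1" "K2 \<ge> 0" "\<forall>n. q (Y n) \<le> K2"
    using C_bdd[OF X] C_bdd[OF Y] by auto
  show ?thesis
  proof (rule C_lip2[OF X Y, of _ "K1 + K2"])
    show "X n * Y n \<in> free_star_algebra" for n using C_F0 X Y by auto
    fix m n
    note F = C_F0[OF X] C_F0[OF Y]
    have "q (X m * Y m - X n * Y n) \<le> q (X m - X n) * q (Y m) + q (X n) * q (Y m - Y n)"
      using q_mult_diff F by auto
    also have "\<dots> \<le> q (X m - X n) * (K1 + K2) + (K1 + K2) * q (Y m - Y n)"
      using K F by (intro add_mono mult_mono) (auto intro!: q_nonneg add_nonneg_nonneg simp: add_increasing2 add_increasing)
    finally show "q (X m * Y m - X n * Y n) \<le> (K1 + K2) * (q (X m - X n) + q (Y m - Y n))"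
      by (simp add: algebra_simps)
  qed (use K in auto)
qed

definition eqv where "eqv X Y \<longleftrightarrow> X \<in> C \<and> Y \<in> C \<and> (\<lambda>n. q (X n - Y n)) \<longlonglongrightarrow> 0"

lemma eqv_refl: "X \<in> C \<Longrightarrow> eqv X X" by (auto simp: eqv_def)
lemma eqv_sym: "eqv X Y \<Longrightarrow> eqv Y X"
  unfolding eqv_def using q_diff_commute[OF C_F0 C_F0] by auto
lemma eqv_dom: 
  assumes "X \<in> C" "Y \<in> C" "\<And>n. q (X n - Y n) \<le> g n" "g \<longlonglongrightarrow> 0" shows "eqv X Y"
  unfolding eqv_def using assms C_F0
  by (auto intro!: tendsto_sandwich[OF _ _ tendsto_const assms(4)] always_eventually q_nonneg)
lemma eqv_lim: "eqv X Y \<Longrightarrow> (\<lambda>n. q (X n - Y n)) \<longlonglongrightarrow> 0" by (simp add: eqv_def)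
lemma eqvC: "eqv X Y \<Longrightarrow> X \<in> C" "eqv X Y \<Longrightarrow> Y \<in> C" by (auto simp: eqv_def)
lemma eqv_trans: assumes "eqv X Y" "eqv Y Z" shows "eqv X Z"
proof (rule eqv_dom)
  show "(\<lambda>n. q (X n - Y n) + q (Y n - Z n)) \<longlonglongrightarrow> 0"
    using tendsto_add[OF eqv_lim[OF assms(1)] eqv_lim[OF assms(2)]] by simp
qed (use assms in \<open>auto intro!: q_tri intro: eqvC C_F0\<close>)

lemma cl_eq: "X \<in> C \<Longrightarrow> cl X = {Y. eqv X Y}"
  by (auto simp: cauchy_class_def eqv_def)

lemma cl_eq_iff: "X \<in> C \<Longrightarrow> Y \<in> C \<Longrightarrow> cl X = cl Y \<longleftrightarrow> eqv X Y"
  using cl_eq eqv_refl eqv_sym eqv_trans by (metis mem_Collect_eq subset_antisym subsetI)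

lemma rep_cl: "X \<in> C \<Longrightarrow> eqv X (cauchy_rep (cl X))"
  unfolding cauchy_rep_def using someI[of "\<lambda>Y. Y \<in> cl X" X] cl_eq[of X] eqv_refl[of X] by auto

lemma add_cl: assumes "X \<in> C" "Y \<in> C" shows "cl X \<oplus>\<^bsub>A\<^esub> cl Y = cl (\<lambda>n. X n + Y n)"
proof -
  note r = rep_cl[OF assms(1)] rep_cl[OF assms(2)]
  have "eqv (\<lambda>n. X n + Y n) (\<lambda>n. cauchy_rep (cl X) n + cauchy_rep (cl Y) n)"
  proof (rule eqv_dom)
    show "(\<lambda>n. q (X n - cauchy_rep (cl X) n) + q (Y n - cauchy_rep (cl Y) n)) \<longlonglongrightarrow> 0"
      using tendsto_add[OF r[THEN eqv_lim]] by simp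
    fix n show "q (X n + Y n - (cauchy_rep (cl X) n + cauchy_rep (cl Y) n)) \<le> q (X n - cauchy_rep (cl X) n) + q (Y n - cauchy_rep (cl Y) n)"
      using q_add[of "X n - cauchy_rep (cl X) n" "Y n - cauchy_rep (cl Y) n"] r[THEN eqvC(2), THEN C_F0] assms[THEN C_F0]
      by (auto simp: algebra_simps)
  qed (use r assms in \<open>auto intro: C_add eqvC\<close>)
  from cl_eq_iff[OF eqvC[OF this], THEN iffD2, OF this] show ?thesis by (simp add: completion_def)
qed

lemma mult_cl: assumes "X \<in> C" "Y \<in> C" shows "cl X \<otimes>\<^bsub>A\<^esub> cl Y = cl (\<lambda>n. X n * Y n)"
proof -
  note r = rep_cl[OF assms(1)] rep_cl[OF assms(2)]
  note rC = r[THEN eqvC(2)]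
  obtain K1 K2 where K: "K1 \<ge> 0" "\<forall>n. q (cauchy_rep (cl X) n) \<le> K1" "K2 \<ge> 0" "\<forall>n. q (Y n) \<le> K2"
    using C_bdd[OF rC(1)] C_bdd[OF assms(2)] by auto
  have "eqv (\<lambda>n. X n * Y n) (\<lambda>n. cauchy_rep (cl X) n * cauchy_rep (cl Y) n)"
  proof (rule eqv_dom)
    show "(\<lambda>n. q (X n - cauchy_rep (cl X) n) * K2 + K1 * q (Y n - cauchy_rep (cl Y) n)) \<longlonglongrightarrow> 0"
      using tendsto_add[OF tendsto_mult_left_zero[OF r(1)[THEN eqv_lim], of K2] tendsto_mult_right_zero[OF r(2)[THEN eqv_lim], of K1]] by simp
    fix n 
    note F = rC[THEN C_F0] assms[THEN C_F0]
    have "q (X n * Y n - (cauchy_rep (cl X) n * cauchy_rep (cl Y) n)) \<le> q (X n - cauchy_rep (cl X) n) * q (Y n) + q (cauchy_rep (cl X) n) * q (Y n - cauchy_rep (cl Y) n)"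
      using q_mult_diff F by auto
    also have "\<dots> \<le> q (X n - cauchy_rep (cl X) n) * K2 + K1 * q (Y n - cauchy_rep (cl Y) n)"
      using K F by (intro add_mono mult_mono) (auto intro!: q_nonneg)
    finally show "q (X n * Y n - (cauchy_rep (cl X) n * cauchy_rep (cl Y) n)) \<le> q (X n - cauchy_rep (cl X) n) * K2 + K1 * q (Y n - cauchy_rep (cl Y) n)" .
  qed (use rC assms in \<open>auto intro: C_mult\<close>)
  from cl_eq_iff[OF eqvC[OF this], THEN iffD2, OF this] show ?thesis by (simp add: completion_def)
qed

lemma scale_cl: assumes "X \<in> C" shows "z \<cdot>\<^bsub>A\<^esub> cl X = cl (\<lambda>n. scale_poly z (X n))"
proof -
  note r = rep_cl[OF assms(1)]
  have "eqv (\<lambda>n. scale_poly z (X n)) (\<lambda>n. scale_poly z (cauchy_rep (cl X) n))"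
  proof (rule eqv_dom)
    show "(\<lambda>n. cmod z * q (X n - cauchy_rep (cl X) n)) \<longlonglongrightarrow> 0"
      using tendsto_mult_right_zero[OF r[THEN eqv_lim]] .
  qed (use r[THEN eqvC(2), THEN C_F0] assms[THEN C_F0] r[THEN eqvC(2)] assms in \<open>auto simp: scale_diff q_scale intro: C_scale\<close>)
  from cl_eq_iff[OF eqvC[OF this], THEN iffD2, OF this] show ?thesis by (simp add: completion_def)
qed

lemma adj_cl: assumes "X \<in> C" shows "adj A (cl X) = cl (\<lambda>n. adj_poly (X n))"
proof -
  note r = rep_cl[OF assms(1)]
  have "eqv (\<lambda>n. adj_poly (X n)) (\<lambda>n. adj_poly (cauchy_rep (cl X) n))"
  proof (rule eqv_dom)
    show "(\<lambda>n. q (X n - cauchy_rep (cl X) n)) \<longlonglongrightarrow> 0"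
      using r[THEN eqv_lim] .
  qed (use r[THEN eqvC(2), THEN C_F0] assms[THEN C_F0] r[THEN eqvC(2)] assms in \<open>auto simp: q_adj simp flip: adj_poly_diff intro: C_adj\<close>)
  from cl_eq_iff[OF eqvC[OF this], THEN iffD2, OF this] show ?thesis by (simp add: completion_def)
qed

lemma norm_cl: assumes "X \<in> C" shows "(\<lambda>n. q (X n)) \<longlonglongrightarrow> cnorm A (cl X)"
proof -
  note r = rep_cl[OF assms(1)]
  have l: "(\<lambda>n. q (cauchy_rep (cl X) n)) \<longlonglongrightarrow> cnorm A (cl X)"
    using q_conv[OF r[THEN eqvC(2)]] by (simp add: completion_def convergent_LIMSEQ_iff)
  have "(\<lambda>n. q (X n) - q (cauchy_rep (cl X) n)) \<longlonglongrightarrow> 0"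
    by (rule tendsto_rabs_zero_cancel, rule tendsto_sandwich[OF _ _ tendsto_const r[THEN eqv_lim]])
       (auto intro!: always_eventually q_abs C_F0 assms r[THEN eqvC(2)])
  from tendsto_add[OF this l] show ?thesis by simp
qed

lemma carrier_A: "carrier A = cl ` C" and zero_A: "\<zero>\<^bsub>A\<^esub> = cl (\<lambda>n. 0)"
  by (simp_all add: completion_def)

lemma scale_simps: "scale_poly z (x + y) = scale_poly z x + scale_poly z y"
  "scale_poly (z + w) x = scale_poly z x + scale_poly w x"
  "scale_poly (z * w) x = scale_poly z (scale_poly w x)" "scale_poly 1 x = x"
  by (rule poly_mapping_eqI; simp add: lookup_add algebra_simps)+

lemma C_uminus: "X \<in> C \<Longrightarrow> (\<lambda>n. - X n) \<in> C"
proof -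
  have "scale_poly (-1) x = - x" for x :: "'g star_poly" by (rule poly_mapping_eqI) simp
  thus "X \<in> C \<Longrightarrow> (\<lambda>n. - X n) \<in> C" using C_scale[of X "-1"] by simp
qed

lemma abg: "abelian_group A"
proof (rule abelian_groupI)
  fix x assume "x \<in> carrier A"
  then obtain X where X: "X \<in> C" "x = cl X" by (auto simp: carrier_A)
  show "\<exists>y\<in>carrier A. y \<oplus>\<^bsub>A\<^esub> x = \<zero>\<^bsub>A\<^esub>"
    using X C_uminus by (intro bexI[of _ "cl (\<lambda>n. - X n)"]) (auto simp: add_cl zero_A carrier_A)
qed (auto simp: carrier_A zero_A add_cl C_add algebra_simps)

lemma uminus_cl: assumes "X \<in> C" shows "\<ominus>\<^bsub>A\<^esub> cl X = cl (\<lambda>n. - X n)"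
  using abelian_group.minus_equality[OF abg, of "cl (\<lambda>n. - X n)" "cl X"] assms C_uminus
  by (auto simp: add_cl zero_A carrier_A)

lemma diff_cl: assumes "X \<in> C" "Y \<in> C" shows "cl X \<ominus>\<^bsub>A\<^esub> cl Y = cl (\<lambda>n. X n - Y n)"
  using assms by (simp add: a_minus_def uminus_cl add_cl C_uminus)

lemma C_diff: "X \<in> C \<Longrightarrow> Y \<in> C \<Longrightarrow> (\<lambda>n. X n - Y n) \<in> C"
  using C_add[OF _ C_uminus, of X Y] by simp

lemma norm_const: "x \<in> free_star_algebra \<Longrightarrow> cnorm A (cl (\<lambda>n. x)) = q x"
  using LIMSEQ_unique[OF norm_cl[OF C_const[of x]] tendsto_const] by simp

lemma norm_nonneg: "X \<in> C \<Longrightarrow> 0 \<le> cnorm A (cl X)"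
  using norm_cl[of X] LIMSEQ_le_const[of _ _ 0] q_nonneg C_F0 by blast

lemma norm_zero: "X \<in> C \<Longrightarrow> cnorm A (cl X) = 0 \<longleftrightarrow> cl X = \<zero>\<^bsub>A\<^esub>"
proof -
  assume X: "X \<in> C"
  have "cl X = \<zero>\<^bsub>A\<^esub> \<longleftrightarrow> eqv X (\<lambda>n. 0)" using X by (simp add: zero_A cl_eq_iff)
  also have "\<dots> \<longleftrightarrow> (\<lambda>n. q (X n)) \<longlonglongrightarrow> 0" using X by (simp add: eqv_def)
  also have "\<dots> \<longleftrightarrow> cnorm A (cl X) = 0" using norm_cl[OF X] LIMSEQ_unique by metis
  finally show ?thesis by simp
qed

lemma norm_add: assumes "X \<in> C" "Y \<in> C" shows "cnorm A (cl X \<oplus>\<^bsub>A\<^esub> cl Y) \<le> cnorm A (cl X) + cnorm A (cl Y)"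
  unfolding add_cl[OF assms]
  by (rule LIMSEQ_le[OF norm_cl tendsto_add[OF norm_cl norm_cl]]) (use assms C_F0 q_add in \<open>auto intro: C_add\<close>)

lemma norm_mult: assumes "X \<in> C" "Y \<in> C" shows "cnorm A (cl X \<otimes>\<^bsub>A\<^esub> cl Y) \<le> cnorm A (cl X) * cnorm A (cl Y)"
  unfolding mult_cl[OF assms]
  by (rule LIMSEQ_le[OF norm_cl tendsto_mult[OF norm_cl norm_cl]]) (use assms C_F0 q_mult in \<open>auto intro: C_mult\<close>)

lemma norm_scale: assumes "X \<in> C" shows "cnorm A (z \<cdot>\<^bsub>A\<^esub> cl X) = cmod z * cnorm A (cl X)"
proof -
  have "(\<lambda>n. q (scale_poly z (X n))) \<longlonglongrightarrow> cmod z * cnorm A (cl X)"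
    using tendsto_mult_left[OF norm_cl[OF assms], of "cmod z"] assms C_F0 q_scale by simp
  from LIMSEQ_unique[OF norm_cl[OF C_scale[OF assms]] this]
  show ?thesis by (simp add: scale_cl[OF assms])
qed

lemma norm_cstar: assumes "X \<in> C" shows "cnorm A (adj A (cl X) \<otimes>\<^bsub>A\<^esub> cl X) = (cnorm A (cl X))\<^sup>2"
proof -
  have "(\<lambda>n. q (adj_poly (X n) * X n)) \<longlonglongrightarrow> (cnorm A (cl X))\<^sup>2"
    using tendsto_power[OF norm_cl[OF assms], of 2] assms C_F0 q_cstar by simp
  from LIMSEQ_unique[OF norm_cl[OF C_mult[OF C_adj[OF assms] assms]] this]
  show ?thesis by (simp add: adj_cl[OF assms] mult_cl[OF C_adj[OF assms] assms])
qed

lemma dense: assumes "X \<in> C" "\<epsilon> > 0" shows "\<exists>x\<in>free_star_algebra. cnorm A (cl X \<ominus>\<^bsub>A\<^esub> cl (\<lambda>n. x)) < \<epsilon>"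
proof -
  obtain N where N: "\<forall>m\<ge>N. \<forall>n\<ge>N. q (X m - X n) < \<epsilon>/2" using CD[OF assms(1), of "\<epsilon>/2"] assms by auto
  have F: "X N \<in> free_star_algebra" using C_F0 assms by auto
  have "cnorm A (cl (\<lambda>n. X n - X N)) \<le> \<epsilon>/2"
    by (rule LIMSEQ_le_const2[OF norm_cl]) (use N assms F in \<open>auto intro!: C_diff exI[of _ N] less_imp_le\<close>)
  thus ?thesis using assms F by (intro bexI[of _ "X N"]) (auto simp: diff_cl)
qed

lemma complete:
  assumes a: "\<And>n. a n \<in> carrier A" and c: "\<And>\<epsilon>. \<epsilon> > 0 \<Longrightarrow> \<exists>N. \<forall>m\<ge>N. \<forall>n\<ge>N. cnorm A (a m \<ominus>\<^bsub>A\<^esub> a n) < \<epsilon>"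
  shows "\<exists>b\<in>carrier A. (\<lambda>n. cnorm A (a n \<ominus>\<^bsub>A\<^esub> b)) \<longlonglongrightarrow> 0"
proof -
  have "\<forall>n. \<exists>Y. Y \<in> C \<and> a n = cl Y" using a unfolding carrier_A by blast
  then obtain Y where "\<forall>n. Y n \<in> C \<and> a n = cl (Y n)" using choice[of "\<lambda>n Y. Y \<in> C \<and> a n = cl Y"] by blast
  hence Y: "\<And>n. Y n \<in> C" "\<And>n. a n = cl (Y n)" by blast+
  have "\<forall>n. \<exists>x. x \<in> free_star_algebra \<and> cnorm A (cl (Y n) \<ominus>\<^bsub>A\<^esub> cl (\<lambda>k. x)) < inverse (real (Suc n))"
  proof
    fix n
    show "\<exists>x. x \<in> free_star_algebra \<and> cnorm A (cl (Y n) \<ominus>\<^bsub>A\<^esub> cl (\<lambda>k. x)) < inverse (real (Suc n))"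
      using dense[OF Y(1)[of n], of "inverse (real (Suc n))"] by auto
  qed
  from choice[OF this] obtain X where "\<forall>n. X n \<in> free_star_algebra \<and> cnorm A (cl (Y n) \<ominus>\<^bsub>A\<^esub> cl (\<lambda>k. X n)) < inverse (real (Suc n))" by blast
  hence X: "\<And>n. X n \<in> free_star_algebra" "\<And>n. cnorm A (a n \<ominus>\<^bsub>A\<^esub> cl (\<lambda>k. X n)) < inverse (real (Suc n))" unfolding Y(2) by blast+
  have dn: "cnorm A (cl U \<ominus>\<^bsub>A\<^esub> cl W) \<le> cnorm A (cl U \<ominus>\<^bsub>A\<^esub> cl V) + cnorm A (cl V \<ominus>\<^bsub>A\<^esub> cl W)" if "U \<in> C" "V \<in> C" "W \<in> C" for U V W
    using norm_add[of "\<lambda>n. U n - V n" "\<lambda>n. V n - W n"] that C_diff[OF that(1,2)] C_diff[OF that(2,3)] by (simp add: diff_cl add_cl)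
  have ds: "cnorm A (cl U \<ominus>\<^bsub>A\<^esub> cl V) = cnorm A (cl V \<ominus>\<^bsub>A\<^esub> cl U)" if "U \<in> C" "V \<in> C" for U V
  proof -
    have "(\<lambda>n. q (U n - V n)) \<longlonglongrightarrow> cnorm A (cl (\<lambda>n. V n - U n))"
      unfolding q_diff_commute[OF C_F0[OF that(1)] C_F0[OF that(2)]] by (rule norm_cl[OF C_diff[OF that(2,1)]])
    from LIMSEQ_unique[OF norm_cl[OF C_diff[OF that]] this]
    have "cnorm A (cl (\<lambda>n. U n - V n)) = cnorm A (cl (\<lambda>n. V n - U n))" .
    thus ?thesis using that by (simp add: diff_cl)
  qed
  have XC: "X \<in> C"
  proof (rule CI)
    fix n show "X n \<in> free_star_algebra" by (rule X(1))
  next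
    fix \<epsilon> :: real assume e: "\<epsilon> > 0"
    obtain N1 where N1: "\<forall>m\<ge>N1. \<forall>n\<ge>N1. cnorm A (a m \<ominus>\<^bsub>A\<^esub> a n) < \<epsilon>/3" using c[of "\<epsilon>/3"] e by auto
    obtain N2 where N2: "inverse (real (Suc N2)) < \<epsilon>/3" using reals_Archimedean[of "\<epsilon>/3"] e by auto
    have "q (X m - X n) < \<epsilon>" if "m \<ge> max N1 N2" "n \<ge> max N1 N2" for m n
    proof -
      have i: "inverse (real (Suc k)) < \<epsilon>/3" if "k \<ge> N2" for k
      proof -
        have "inverse (real (Suc k)) \<le> inverse (real (Suc N2))" using that by (intro le_imp_inverse_le) auto
        thus ?thesis using N2 by linarith
      qed
      have "q (X m - X n) = cnorm A (cl (\<lambda>k. X m) \<ominus>\<^bsub>A\<^esub> cl (\<lambda>k. X n))"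
        using X(1) by (simp add: diff_cl norm_const)
      also have "\<dots> \<le> cnorm A (cl (\<lambda>k. X m) \<ominus>\<^bsub>A\<^esub> a m) + (cnorm A (a m \<ominus>\<^bsub>A\<^esub> a n) + cnorm A (a n \<ominus>\<^bsub>A\<^esub> cl (\<lambda>k. X n)))"
        using dn[of "\<lambda>k. X m" "Y m" "\<lambda>k. X n"] dn[of "Y m" "Y n" "\<lambda>k. X n"] Y(1) X(1) by (simp add: Y(2))
      also have "cnorm A (cl (\<lambda>k. X m) \<ominus>\<^bsub>A\<^esub> a m) = cnorm A (a m \<ominus>\<^bsub>A\<^esub> cl (\<lambda>k. X m))" unfolding Y(2) using ds[OF Y(1) C_const[OF X(1)]] by simp
      finally have *: "q (X m - X n) \<le> cnorm A (a m \<ominus>\<^bsub>A\<^esub> cl (\<lambda>k. X m)) + (cnorm A (a m \<ominus>\<^bsub>A\<^esub> a n) + cnorm A (a n \<ominus>\<^bsub>A\<^esub> cl (\<lambda>k. X n)))" .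
      have "cnorm A (a m \<ominus>\<^bsub>A\<^esub> a n) < \<epsilon>/3" "m \<ge> N2" "n \<ge> N2" using N1[rule_format, of m n] that by auto
      with * X(2)[of m] X(2)[of n] i[of m] i[of n] show ?thesis by linarith
    qed
    thus "\<exists>N. \<forall>m\<ge>N. \<forall>n\<ge>N. q (X m - X n) < \<epsilon>" by blast
  qed
  have "(\<lambda>n. cnorm A (a n \<ominus>\<^bsub>A\<^esub> cl X)) \<longlonglongrightarrow> 0"
  proof (rule LIMSEQ_I)
    fix \<epsilon> :: real assume e: "\<epsilon> > 0"
    obtain N1 where N1: "\<forall>m\<ge>N1. \<forall>n\<ge>N1. q (X m - X n) < \<epsilon>/3" using CD[OF XC, of "\<epsilon>/3"] e by auto
    obtain N2 where N2: "inverse (real (Suc N2)) < \<epsilon>/3" using reals_Archimedean[of "\<epsilon>/3"] e by auto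
    have "cnorm A (a n \<ominus>\<^bsub>A\<^esub> cl X) < \<epsilon>" if "n \<ge> max N1 N2" for n
    proof -
      have i: "inverse (real (Suc n)) < \<epsilon>/3"
      proof -
        have "inverse (real (Suc n)) \<le> inverse (real (Suc N2))" using that by (intro le_imp_inverse_le) auto
        thus ?thesis using N2 by linarith
      qed
      have "cnorm A (cl (\<lambda>k. X n - X k)) \<le> \<epsilon>/3"
        by (rule LIMSEQ_le_const2[OF norm_cl]) (use N1 that XC X(1) in \<open>auto intro!: C_diff exI[of _ N1] less_imp_le\<close>)
      hence "cnorm A (cl (\<lambda>k. X n) \<ominus>\<^bsub>A\<^esub> cl X) \<le> \<epsilon>/3" using X(1) XC by (simp add: diff_cl)
      moreover have "cnorm A (a n \<ominus>\<^bsub>A\<^esub> cl X) \<le> cnorm A (a n \<ominus>\<^bsub>A\<^esub> cl (\<lambda>k. X n)) + cnorm A (cl (\<lambda>k. X n) \<ominus>\<^bsub>A\<^esub> cl X)"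
        using dn[of "Y n" "\<lambda>k. X n" X] X(1)[of n] Y(1)[of n] XC by (simp add: Y(2))
      ultimately show ?thesis using X(2)[of n] i e by linarith
    qed
    moreover have "0 \<le> cnorm A (a n \<ominus>\<^bsub>A\<^esub> cl X)" for n
      unfolding Y(2) diff_cl[OF Y(1) XC] by (rule norm_nonneg[OF C_diff[OF Y(1) XC]])
    ultimately show "\<exists>no. \<forall>n\<ge>no. norm (cnorm A (a n \<ominus>\<^bsub>A\<^esub> cl X) - 0) < \<epsilon>" by (intro exI[of _ "max N1 N2"]) auto
  qed
  thus ?thesis unfolding carrier_A using XC by blast
qed

theorem completion_cstar: "cstar_algebra A"
  unfolding cstar_algebra_def
  apply (intro conjI)
  subgoal by (rule abg)
  subgoal by (auto simp: carrier_A mult_cl C_mult)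
  subgoal by (auto simp: carrier_A scale_cl C_scale)
  subgoal by (auto simp: carrier_A adj_cl C_adj)
  subgoal by (auto simp: carrier_A mult_cl add_cl C_mult C_add algebra_simps)
  subgoal by (auto simp: carrier_A mult_cl add_cl scale_cl C_mult C_add C_scale scale_simps scale_poly_left scale_poly_right[symmetric])
  subgoal by (auto simp: carrier_A mult_cl add_cl scale_cl adj_cl C_mult C_add C_scale C_adj adj_poly_add adj_poly_mult adj_scale)
  subgoal by (auto simp: carrier_A norm_nonneg norm_zero norm_add norm_scale norm_mult norm_cstar)
  subgoal by (intro allI impI, elim conjE, rule complete) auto
  done

end


section \<open>Graph C*-algebras\<close>

text \<open>A directed graph is given by its range and source maps \<open>r s :: 'e \<Rightarrow> 'v\<close>; the vertex and
  edge sets are the (nonempty, otherwise arbitrary) types \<open>'v\<close> and \<open>'e\<close>.\<close>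

definition projection :: "('a, 'm) cstar_scheme \<Rightarrow> 'a \<Rightarrow> bool" where
  "projection A p \<longleftrightarrow> p \<in> carrier A \<and> adj A p = p \<and> p \<otimes>\<^bsub>A\<^esub> p = p"

definition partial_isometry :: "('a, 'm) cstar_scheme \<Rightarrow> 'a \<Rightarrow> bool" where
  "partial_isometry A t \<longleftrightarrow> t \<in> carrier A \<and> t \<otimes>\<^bsub>A\<^esub> adj A t \<otimes>\<^bsub>A\<^esub> t = t"

text \<open>The usual order on projections: \<open>p \<le> q\<close> iff \<open>p q = p\<close>.\<close>

definition proj_le :: "('a, 'm) cstar_scheme \<Rightarrow> 'a \<Rightarrow> 'a \<Rightarrow> bool" where
  "proj_le A p q \<longleftrightarrow> projection A p \<and> projection A q \<and> p \<otimes>\<^bsub>A\<^esub> q = p"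

definition graph_family ::
  "('e \<Rightarrow> 'v) \<Rightarrow> ('e \<Rightarrow> 'v) \<Rightarrow> ('a, 'm) cstar_scheme \<Rightarrow> ('v \<Rightarrow> 'a) \<Rightarrow> ('e \<Rightarrow> 'a) \<Rightarrow> bool" where
  "graph_family r s A P S \<longleftrightarrow>
     (\<forall>v. projection A (P v)) \<and>
     (\<forall>v w. v \<noteq> w \<longrightarrow> P v \<otimes>\<^bsub>A\<^esub> P w = \<zero>\<^bsub>A\<^esub>) \<and>
     (\<forall>e. partial_isometry A (S e)) \<and>
     (\<forall>e f. e \<noteq> f \<longrightarrow> (S e \<otimes>\<^bsub>A\<^esub> adj A (S e)) \<otimes>\<^bsub>A\<^esub> (S f \<otimes>\<^bsub>A\<^esub> adj A (S f)) = \<zero>\<^bsub>A\<^esub>) \<and>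
     (\<forall>e. adj A (S e) \<otimes>\<^bsub>A\<^esub> S e = P (s e)) \<and>
     (\<forall>e. proj_le A (S e \<otimes>\<^bsub>A\<^esub> adj A (S e)) (P (r e))) \<and>
     (\<forall>v. finite (r -` {v}) \<and> r -` {v} \<noteq> {} \<longrightarrow>
        P v = (\<Oplus>\<^bsub>A\<^esub>e\<in>r -` {v}. S e \<otimes>\<^bsub>A\<^esub> adj A (S e)))"

text \<open>\<open>C*(E)\<close> is the universal C*-algebra generated by a graph family: the completion of the free
  *-algebra on \<open>E\<^sup>0 \<squnion> E\<^sup>1\<close> in the largest C*-seminorm for which the generators become a graph
  family.  (A *-homomorphism \<open>\<pi>\<close> from the free *-algebra to some C*-algebra amounts to the
  C*-seminorm \<open>x \<mapsto> \<parallel>\<pi>(x)\<parallel>\<close>, whose completion is the closure of the image of \<open>\<pi>\<close>.)\<close>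

definition graph_seminorm ::
  "('e \<Rightarrow> 'v) \<Rightarrow> ('e \<Rightarrow> 'v) \<Rightarrow> ('v + 'e) star_poly \<Rightarrow> real" where
  "graph_seminorm r s x = Sup {q x | q. cstar_seminorm q \<and>
     graph_family r s (completion q) (completion_gen q \<circ> Inl) (completion_gen q \<circ> Inr)}"

type_synonym ('v, 'e) gelem = "(nat \<Rightarrow> ('v + 'e) star_poly) set"

definition graph_cstar :: "('e \<Rightarrow> 'v) \<Rightarrow> ('e \<Rightarrow> 'v) \<Rightarrow> ('v, 'e) gelem cstar" where
  "graph_cstar r s = completion (graph_seminorm r s)"

definition vertex_proj :: "('e \<Rightarrow> 'v) \<Rightarrow> ('e \<Rightarrow> 'v) \<Rightarrow> 'v \<Rightarrow> ('v, 'e) gelem" where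
  "vertex_proj r s v = completion_gen (graph_seminorm r s) (Inl v)"

definition edge_isom :: "('e \<Rightarrow> 'v) \<Rightarrow> ('e \<Rightarrow> 'v) \<Rightarrow> 'e \<Rightarrow> ('v, 'e) gelem" where
  "edge_isom r s e = completion_gen (graph_seminorm r s) (Inr e)"


subsection \<open>Paths\<close>

datatype ('v, 'e) path = Vertex 'v | Edges "'e list"

primrec is_path :: "('e \<Rightarrow> 'v) \<Rightarrow> ('e \<Rightarrow> 'v) \<Rightarrow> ('v, 'e) path \<Rightarrow> bool" where
  "is_path r s (Vertex v) \<longleftrightarrow> True"
| "is_path r s (Edges \<mu>) \<longleftrightarrow> \<mu> \<noteq> [] \<and> (\<forall>i. Suc i < length \<mu> \<longrightarrow> r (\<mu> ! Suc i) = s (\<mu> ! i))"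

primrec path_length :: "('v, 'e) path \<Rightarrow> nat" where
  "path_length (Vertex v) = 0"
| "path_length (Edges \<mu>) = length \<mu>"

primrec path_source :: "('e \<Rightarrow> 'v) \<Rightarrow> ('v, 'e) path \<Rightarrow> 'v" where
  "path_source s (Vertex v) = v"
| "path_source s (Edges \<mu>) = s (last \<mu>)"

primrec path_weight :: "('e \<Rightarrow> real) \<Rightarrow> ('v, 'e) path \<Rightarrow> real" where
  "path_weight c (Vertex v) = 1"
| "path_weight c (Edges \<mu>) = prod_list (map c \<mu>)"

fun mult_list :: "('a, 'm) cstar_scheme \<Rightarrow> 'a list \<Rightarrow> 'a" where
  "mult_list A [] = undefined"
| "mult_list A [a] = a"
| "mult_list A (a # b # as) = a \<otimes>\<^bsub>A\<^esub> mult_list A (b # as)"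

primrec spath :: "('e \<Rightarrow> 'v) \<Rightarrow> ('e \<Rightarrow> 'v) \<Rightarrow> ('v, 'e) path \<Rightarrow> ('v, 'e) gelem" where
  "spath r s (Vertex v) = vertex_proj r s v"
| "spath r s (Edges \<mu>) = mult_list (graph_cstar r s) (map (edge_isom r s) \<mu>)"


subsection \<open>Gauge action and core\<close>

definition gauge :: "('e \<Rightarrow> 'v) \<Rightarrow> ('e \<Rightarrow> 'v) \<Rightarrow> complex \<Rightarrow> ('v, 'e) gelem \<Rightarrow> ('v, 'e) gelem" where
  "gauge r s z = (THE \<gamma>. \<gamma> \<in> extensional (carrier (graph_cstar r s)) \<and>
     star_hom (graph_cstar r s) (graph_cstar r s) \<gamma> \<and>
     (\<forall>e. \<gamma> (edge_isom r s e) = z \<cdot>\<^bsub>graph_cstar r s\<^esub> edge_isom r s e) \<and>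
     (\<forall>v. \<gamma> (vertex_proj r s v) = vertex_proj r s v))"

definition gauge_core :: "('e \<Rightarrow> 'v) \<Rightarrow> ('e \<Rightarrow> 'v) \<Rightarrow> ('v, 'e) gelem cstar" where
  "gauge_core r s = (graph_cstar r s)\<lparr>carrier :=
     {a \<in> carrier (graph_cstar r s). \<forall>z. cmod z = 1 \<longrightarrow> gauge r s z a = a}\<rparr>"


subsection \<open>The algebra of functions on the vertices\<close>

definition char_fun :: "'x \<Rightarrow> 'x \<Rightarrow> complex" where
  "char_fun x = (\<lambda>y. if y = x then 1 else 0)"

definition C0_alg :: "('v \<Rightarrow> complex) cstar" where
  "C0_alg = \<lparr>carrier = {f. \<forall>\<epsilon>>0. finite {v. \<epsilon> \<le> cmod (f v)}},
      mult = (\<lambda>f g v. f v * g v),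
      one = undefined,
      zero = (\<lambda>v. 0),
      add = (\<lambda>f g v. f v + g v),
      cscale = (\<lambda>z f v. z * f v),
      adj = (\<lambda>f v. cnj (f v)),
      cnorm = (\<lambda>f. SUP v. cmod (f v))\<rparr>"

text \<open>The identification of \<open>C\<^sub>0(E\<^sup>0)\<close> with the closed span of the \<open>p\<^sub>v\<close>.\<close>

definition C0_embed :: "('e \<Rightarrow> 'v) \<Rightarrow> ('e \<Rightarrow> 'v) \<Rightarrow> ('v \<Rightarrow> complex) \<Rightarrow> ('v, 'e) gelem" where
  "C0_embed r s = (THE \<iota>. \<iota> \<in> extensional (carrier C0_alg) \<and>
     star_hom C0_alg (graph_cstar r s) \<iota> \<and> (\<forall>v. \<iota> (char_fun v) = vertex_proj r s v))"

definition restr_C0 ::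
  "('e \<Rightarrow> 'v) \<Rightarrow> ('e \<Rightarrow> 'v) \<Rightarrow> (('v, 'e) gelem \<Rightarrow> complex) \<Rightarrow> ('v \<Rightarrow> complex) \<Rightarrow> complex" where
  "restr_C0 r s \<omega> a = \<omega> (C0_embed r s a)"


section \<open>The transform of traces\<close>

text \<open>Elements of the Hilbert \<open>C\<^sub>0(E\<^sup>0)\<close>-module \<open>X\<close> are functions on \<open>E\<^sup>1\<close>, and the operators
  needed act on them pointwise.\<close>

definition edge_inner :: "('e \<Rightarrow> 'v) \<Rightarrow> ('e \<Rightarrow> complex) \<Rightarrow> ('e \<Rightarrow> complex) \<Rightarrow> 'v \<Rightarrow> complex" where
  "edge_inner s \<xi> \<eta> = (\<lambda>v. \<Sum>\<^sub>\<infinity>e\<in>s -` {v}. cnj (\<xi> e) * \<eta> e)"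

definition left_act :: "('e \<Rightarrow> 'v) \<Rightarrow> ('v \<Rightarrow> complex) \<Rightarrow> ('e \<Rightarrow> complex) \<Rightarrow> 'e \<Rightarrow> complex" where
  "left_act r a \<xi> = (\<lambda>e. a (r e) * \<xi> e)"

definition mult_op :: "('e \<Rightarrow> real) \<Rightarrow> ('e \<Rightarrow> complex) \<Rightarrow> 'e \<Rightarrow> complex" where
  "mult_op m \<xi> = (\<lambda>e. of_real (m e) * \<xi> e)"

text \<open>Infinite sums are limits over the finite subsets of \<open>E\<^sup>1\<close>.  \<open>trace_pos\<close> is the
  \<open>[0,\<infinity>]\<close>-valued trace of positive operators; \<open>trace_of\<close> is meaningful when the sum converges.\<close>

definition trace_pos ::
  "('e \<Rightarrow> 'v) \<Rightarrow> (('v \<Rightarrow> complex) \<Rightarrow> complex) \<Rightarrow> (('e \<Rightarrow> complex) \<Rightarrow> 'e \<Rightarrow> complex) \<Rightarrow> ennreal" where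
  "trace_pos s \<tau> T = (\<Sum>\<^sub>\<infinity>e. ennreal (Re (\<tau> (edge_inner s (char_fun e) (T (char_fun e))))))"

definition trace_of ::
  "('e \<Rightarrow> 'v) \<Rightarrow> (('v \<Rightarrow> complex) \<Rightarrow> complex) \<Rightarrow> (('e \<Rightarrow> complex) \<Rightarrow> 'e \<Rightarrow> complex) \<Rightarrow> complex" where
  "trace_of s \<tau> T = (\<Sum>\<^sub>\<infinity>e. \<tau> (edge_inner s (char_fun e) (T (char_fun e))))"

definition trace_transform_pos ::
  "('e \<Rightarrow> 'v) \<Rightarrow> ('e \<Rightarrow> 'v) \<Rightarrow> ('e \<Rightarrow> real) \<Rightarrow> real \<Rightarrow> (('v \<Rightarrow> complex) \<Rightarrow> complex) \<Rightarrow>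
    ('v \<Rightarrow> complex) \<Rightarrow> ennreal" where
  "trace_transform_pos r s c \<beta> \<tau> a = trace_pos s \<tau> (left_act r a \<circ> mult_op (\<lambda>e. c e powr - \<beta>))"

definition trace_transform ::
  "('e \<Rightarrow> 'v) \<Rightarrow> ('e \<Rightarrow> 'v) \<Rightarrow> ('e \<Rightarrow> real) \<Rightarrow> real \<Rightarrow> (('v \<Rightarrow> complex) \<Rightarrow> complex) \<Rightarrow>
    ('v \<Rightarrow> complex) \<Rightarrow> complex" where
  "trace_transform r s c \<beta> \<tau> a = trace_of s \<tau> (left_act r a \<circ> mult_op (\<lambda>e. c e powr - \<beta>))"

definition cond_K1 ::
  "('e \<Rightarrow> 'v) \<Rightarrow> ('e \<Rightarrow> 'v) \<Rightarrow> ('e \<Rightarrow> real) \<Rightarrow> real \<Rightarrow> (('v \<Rightarrow> complex) \<Rightarrow> complex) \<Rightarrow> bool" where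
  "cond_K1 r s c \<beta> \<tau> \<longleftrightarrow>
     (\<forall>a\<in>closed_cspan C0_alg {char_fun v | v. finite (r -` {v}) \<and> r -` {v} \<noteq> {}}.
        trace_transform_pos r s c \<beta> \<tau> (\<lambda>v. of_real (cmod (a v))) < \<infinity> \<and> trace_transform r s c \<beta> \<tau> a = \<tau> a)"

definition cond_K2 ::
  "('e \<Rightarrow> 'v) \<Rightarrow> ('e \<Rightarrow> 'v) \<Rightarrow> ('e \<Rightarrow> real) \<Rightarrow> real \<Rightarrow> (('v \<Rightarrow> complex) \<Rightarrow> complex) \<Rightarrow> bool" where
  "cond_K2 r s c \<beta> \<tau> \<longleftrightarrow>
     (\<forall>a\<in>carrier C0_alg. (\<forall>v. a v \<in> \<real>\<^sub>\<ge>\<^sub>0) \<longrightarrow> trace_transform_pos r s c \<beta> \<tau> a \<le> ennreal (Re (\<tau> a)))"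

definition scaling_state ::
  "('e \<Rightarrow> 'v) \<Rightarrow> ('e \<Rightarrow> 'v) \<Rightarrow> ('e \<Rightarrow> real) \<Rightarrow> real \<Rightarrow> (('v, 'e) gelem \<Rightarrow> complex) \<Rightarrow> bool" where
  "scaling_state r s c \<beta> \<omega> \<longleftrightarrow> state (gauge_core r s) \<omega> \<and>
     (\<forall>\<mu> \<nu>. is_path r s \<mu> \<and> is_path r s \<nu> \<and> path_length \<mu> = path_length \<nu> \<and>
        path_source s \<mu> = path_source s \<nu> \<longrightarrow>
        \<omega> (spath r s \<mu> \<otimes>\<^bsub>graph_cstar r s\<^esub> adj (graph_cstar r s) (spath r s \<nu>)) =
          (if \<mu> = \<nu> then of_real (path_weight c \<mu> powr - \<beta>) * \<omega> (vertex_proj r s (path_source s \<mu>)) else 0))"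

end

theory Submission
  imports Defs
begin

text \<open>
  Modulo the graph relations every nonempty word in the generators vanishes or equals some
  \<open>s\<^sub>\<mu> s\<^sub>\<nu>\<^sup>*\<close>, and the words of degree \<open>0\<close> span a dense subspace of the core.  Hence a
  state satisfying the scaling condition is determined by its values \<open>t\<^sub>v\<close> on the vertex
  projections.  For such a state, (K2) says that the projection
  \<open>p\<^sub>v - \<Sum>\<^bsub>e\<in>D\<^esub> s\<^sub>e s\<^sub>e\<^sup>*\<close> has a nonnegative value for every finite \<open>D \<subseteq> r\<^sup>-\<^sup>1(v)\<close>, and
  (K1) that this value is \<open>0\<close> when \<open>v\<close> is regular and \<open>D = r\<^sup>-\<^sup>1(v)\<close>.

  Conversely, let \<open>t\<close> satisfy (K1) and (K2) and put \<open>\<phi>(s\<^sub>\<mu> s\<^sub>\<nu>\<^sup>*) = [\<mu> = \<nu>] c(\<mu>)\<^sup>-\<^sup>\<beta> t\<^bsub>s(\<mu>)\<^esub>\<close>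
  on words.  On any finite set of words \<open>\<phi>\<close> is a finite combination, with nonnegative
  coefficients, of vector states of the representation on finite paths (and of the constant
  term): a path that ends at \<open>v\<close> before the truncation carries the mass that \<open>t\<^sub>v\<close> does not pass
  on to its one-edge extensions, which is nonnegative by (K2) and vanishes at regular vertices
  by (K1).  So \<open>\<phi>\<close> is positive and kills the graph relations, including the Cuntz-Krieger
  relations that the path representation itself violates.  The operator norm of its GNS
  representation is then one of the seminorms whose supremum defines \<open>C*(E)\<close>; therefore \<open>\<phi>\<close> is
  bounded and extends to the completion.
\<close>

section \<open>Linear functionals on the free *-algebra and the GNS seminorm\<close>

text \<open>A measure on path space representing \<open>phi\<close> would in general charge infinite
  as well as finite paths and call for an extension theorem. A finite set of words, however, sees
  only finitely many edges and bounded lengths: a truncated path space suffices, and its values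
  agree with \<open>phi\<close> exactly once the truncation is large enough, not just in the limit.
  The free algebra is taken with its unit so that \<open>phi\<close> is a vector state; the mass
  missing from a truncation is put on the constant term, which keeps positivity. As C*(E) need not
  be unital, norm one cannot be read off at a unit. Finite sums of vertex projections act as exact
  units on a given polynomial modulo the seminorm, and comparison with them shows that a positive
  contractive functional, on the core or on the functions on the vertices, is a state iff the finite
  sums of its vertex values come arbitrarily close to 1. This criterion carries the normalisation
  from states to traces, back, and through convex combinations. \<open>phi\<close> is positive on
  words of every degree, so its extension is simply restricted to the core, without a conditional
  expectation.\<close>

definition lin :: "('g monomial \<Rightarrow> complex) \<Rightarrow> 'g star_poly \<Rightarrow> complex" where
  "lin f x = (\<Sum>w\<in>Poly_Mapping.keys x. Poly_Mapping.lookup x w * f w)"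

lemma lin_superset:
  assumes "finite W" "Poly_Mapping.keys x \<subseteq> W"
  shows "lin f x = (\<Sum>w\<in>W. Poly_Mapping.lookup x w * f w)"
  unfolding lin_def using assms by (intro sum.mono_neutral_left) (auto simp: in_keys_iff)

lemma lin_0 [simp]: "lin f 0 = 0"
  by (simp add: lin_def)

lemma lin_single [simp]: "lin f (Poly_Mapping.single w z) = z * f w"
  by (subst lin_superset[of "{w}"]) auto

lemma lin_add: "lin f (x + y) = lin f x + lin f y"
proof -
  let ?W = "Poly_Mapping.keys x \<union> Poly_Mapping.keys y"
  have "Poly_Mapping.keys (x + y) \<subseteq> ?W" by (rule Poly_Mapping.keys_add)
  thus ?thesis
    by (simp add: lin_superset[of ?W] lookup_add ring_distribs sum.distrib)
qed

lemma lin_scale: "lin f (scale_poly z x) = z * lin f x"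
  by (induction x rule: star_poly_induct)
    (simp_all add: lin_add ring_distribs scale_poly_def mult_single)

lemma lin_uminus: "lin f (- x) = - lin f x"
  using lin_add[of f x "- x"] by (simp add: eq_neg_iff_add_eq_0 add.commute)

lemma lin_diff: "lin f (x - y) = lin f x - lin f y"
  using lin_add[of f x "- y"] by (simp add: lin_uminus)

lemma lin_sum: "lin f (sum g D) = (\<Sum>i\<in>D. lin f (g i))"
  by (induction D rule: infinite_finite_induct) (simp_all add: lin_add)

lemma lin_mult: "lin f (x * y) = lin (\<lambda>u. lin (\<lambda>v. f (u + v)) y) x"
proof (induction x rule: star_poly_induct)
  case (2 w z)
  show ?case
    by (induction y rule: star_poly_induct) (simp_all add: mult_single ring_distribs lin_add)
qed (simp_all add: ring_distribs lin_add)

lemma lin_adj: "lin f (adj_poly x) = cnj (lin (\<lambda>w. cnj (f (adj_mono w))) x)"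
  by (induction x rule: star_poly_induct) (simp_all add: adj_poly_add lin_add)

lemma lin_cong: "(\<And>w. w \<in> Poly_Mapping.keys x \<Longrightarrow> f w = g w) \<Longrightarrow> lin f x = lin g x"
  by (simp add: lin_def)

lemma adj_poly_1 [simp]: "adj_poly 1 = (1 :: 'g star_poly)"
  by (metis adj_mono_0 adj_poly_single complex_cnj_one single_one)

lemma lin_1 [simp]: "lin f 1 = f 0"
  by (metis lin_single mult_1 single_one)

lemma scale_poly_uminus1: "scale_poly (-1) x = - x"
  by (rule poly_mapping_eqI) simp

text \<open>Only z = - t cnj B with t real is tested, which makes the hypothesis a quadratic
  inequality in t. Its minimum at t = 1 / C gives the bound; for C = 0 the inequality is affine and
  fails at t = (A + 1) / (2 |B|^2) unless B = 0.\<close>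

lemma discriminant_bound:
  fixes A C :: real and B :: complex
  assumes C: "0 \<le> C" and pos: "\<And>z. 0 \<le> A + 2 * Re (z * B) + (cmod z)\<^sup>2 * C"
  shows "(cmod B)\<^sup>2 \<le> A * C"
proof -
  have A: "0 \<le> A" using pos[of 0] by simp
  have t: "0 \<le> A - 2 * t * (cmod B)\<^sup>2 + t\<^sup>2 * (cmod B)\<^sup>2 * C" for t :: real
  proof -
    have "Re (- (of_real t * cnj B) * B) = - t * (cmod B)\<^sup>2"
      unfolding cmod_power2 by (simp add: power2_eq_square algebra_simps)
    thus ?thesis using pos[of "- (of_real t * cnj B)"] by (simp add: norm_mult power_mult_distrib)
  qed
  show ?thesis
  proof (cases "C = 0 \<or> B = 0")
    case True
    show ?thesis
    proof (cases "B = 0")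
      case True thus ?thesis using A C by simp
    next
      case False
      hence "C = 0" using True by simp
      with t[of "(A + 1) / (2 * (cmod B)\<^sup>2)"] False have False by (simp add: field_simps)
      thus ?thesis ..
    qed
  next
    case False
    hence "C > 0" using C by simp
    with t[of "1 / C"] show ?thesis by (simp add: field_simps power2_eq_square)
  qed
qed

text \<open>Positivity alone makes \<open>f\<close> a state of the free unital *-algebra; that the letters act as
  contractions makes the operator norm of the associated GNS representation finite.\<close>

locale gns =
  fixes f :: "'g monomial \<Rightarrow> complex"
  assumes pos: "lin f (adj_poly x * x) \<in> \<real>\<^sub>\<ge>\<^sub>0"
    and herm: "f (adj_mono w) = cnj (f w)"
    and unit: "f 0 = 1"
    and letter_le: "Re (lin f (adj_poly (Poly_Mapping.single (Letters [l]) 1 * y)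
                      * (Poly_Mapping.single (Letters [l]) 1 * y))) \<le> Re (lin f (adj_poly y * y))"
begin

section \<open>The GNS inner product on polynomials\<close>

definition ip where "ip x y = lin f (adj_poly x * y)"
definition N where "N x = sqrt (Re (ip x x))"

lemma lin_f_adj: "lin f (adj_poly x) = cnj (lin f x)"
  by (simp add: lin_adj herm)

lemma ip_cnj: "ip y x = cnj (ip x y)"
  unfolding ip_def by (simp flip: lin_f_adj add: adj_poly_mult)

lemma ip_add: "ip x (y + z) = ip x y + ip x z" "ip (x + y) z = ip x z + ip y z"
  by (simp_all add: ip_def adj_poly_add ring_distribs lin_add)

lemma ip_scale: "ip x (scale_poly c y) = c * ip x y" "ip (scale_poly c x) y = cnj c * ip x y"
  by (simp_all add: ip_def adj_scale flip: scale_poly_left scale_poly_right lin_scale)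

lemma ip_adj: "ip (x * y) z = ip y (adj_poly x * z)"
  by (simp add: ip_def adj_poly_mult mult.assoc)

lemma ip_self: "0 \<le> Re (ip x x)" "ip x x = of_real (Re (ip x x))"
  using pos[of x] by (auto simp: ip_def complex_nonneg_Reals_iff complex_eq_iff)

lemma N_nonneg [simp]: "0 \<le> N x"
  using ip_self by (simp add: N_def)

lemma N_sq: "(N x)\<^sup>2 = Re (ip x x)"
  using ip_self by (simp add: N_def)

lemma N_expand: "(N (x + scale_poly z y))\<^sup>2 = (N x)\<^sup>2 + 2 * Re (z * ip x y) + (cmod z)\<^sup>2 * (N y)\<^sup>2"
proof -
  have e: "ip (x + scale_poly z y) (x + scale_poly z y)
      = ip x x + (z * ip x y + cnj (z * ip x y)) + cnj z * (z * ip y y)"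
    by (simp add: ip_add ip_scale algebra_simps ip_cnj[of x y])
  have "cnj z * (z * ip y y) = of_real ((cmod z)\<^sup>2 * Re (ip y y))"
    by (subst ip_self(2)) (simp add: complex_norm_square[symmetric] mult.assoc[symmetric] mult.commute[of "cnj z" z] del: of_real_power)
  thus ?thesis unfolding N_sq e by simp
qed

lemma cauchy_schwarz: "cmod (ip x y) \<le> N x * N y"
proof -
  have "(cmod (ip x y))\<^sup>2 \<le> (N x)\<^sup>2 * (N y)\<^sup>2"
  proof (rule discriminant_bound)
    show "0 \<le> (N x)\<^sup>2 + 2 * Re (z * ip x y) + (cmod z)\<^sup>2 * (N y)\<^sup>2" for z
      unfolding N_expand[symmetric] by simp
  qed simp
  thus ?thesis by (simp flip: power_mult_distrib add: power2_le_iff_abs_le)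
qed

lemma N_add: "N (x + y) \<le> N x + N y"
proof -
  have "(N (x + y))\<^sup>2 = (N x)\<^sup>2 + 2 * Re (ip x y) + (N y)\<^sup>2"
    using N_expand[of x 1 y] by (simp add: scale_poly_def)
  also have "\<dots> \<le> (N x)\<^sup>2 + 2 * (N x * N y) + (N y)\<^sup>2"
    using cauchy_schwarz[of x y] complex_Re_le_cmod[of "ip x y"] by simp
  also have "\<dots> = (N x + N y)\<^sup>2" by (simp add: power2_eq_square algebra_simps)
  finally show ?thesis by (rule power2_le_imp_le) simp
qed

lemma N_0 [simp]: "N 0 = 0" by (simp add: N_def ip_def)

lemma N_scale: "N (scale_poly z x) = cmod z * N x"
proof -
  have "(N (scale_poly z x))\<^sup>2 = (cmod z * N x)\<^sup>2"
    using N_expand[of 0 z x] by (simp add: ip_def power_mult_distrib)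
  thus ?thesis by (simp add: power2_eq_iff_nonneg)
qed

lemma N_letters: "N (Poly_Mapping.single (Letters ls) 1 * y) \<le> N y"
proof (induction ls)
  case Nil
  have "Poly_Mapping.single (Letters []) 1 = (1 :: 'g star_poly)"
    by (simp flip: zero_monomial_def)
  thus ?case by simp
next
  case (Cons l ls)
  have e: "Poly_Mapping.single (Letters (l # ls)) (1::complex)
    = Poly_Mapping.single (Letters [l]) 1 * Poly_Mapping.single (Letters ls) 1"
    by (simp add: mult_single plus_monomial_def)
  have "N (Poly_Mapping.single (Letters (l # ls)) 1 * y) \<le> N (Poly_Mapping.single (Letters ls) 1 * y)"
    using letter_le[of l "Poly_Mapping.single (Letters ls) 1 * y"]
    by (simp add: e mult.assoc N_def ip_def)
  thus ?case using Cons by simp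
qed

lemma N_word: "N (Poly_Mapping.single w 1 * y) \<le> N y"
  using N_letters[of "letters w"] by simp

section \<open>The operator norm of the GNS representation\<close>

definition op_bounds where "op_bounds x = {K. 0 \<le> K \<and> (\<forall>y. N (x * y) \<le> K * N y)}"
text \<open>The quotient by the null vectors of \<open>N\<close> and its completion are never
  formed: the least bound of left multiplication for the seminorm \<open>N\<close> is already the
  norm of the GNS operator.\<close>

definition op_norm where "op_norm x = Inf (op_bounds x)"

lemma op_bounds_nonempty: "op_bounds x \<noteq> {}"
proof (induction x rule: star_poly_induct)
  case 1
  show ?case by (auto simp: op_bounds_def intro!: exI[of _ 0])
next
  case (2 w z)
  have e: "Poly_Mapping.single w z = scale_poly z (Poly_Mapping.single (Letters (letters w)) 1)"
    by (simp add: scale_poly_def mult_single)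
  have "cmod z \<in> op_bounds (Poly_Mapping.single w z)"
    by (auto simp: op_bounds_def e N_scale simp flip: scale_poly_left
          intro!: mult_left_mono N_word)
  thus ?case by blast
next
  case (3 x y)
  then obtain K L where K: "K \<in> op_bounds x" and L: "L \<in> op_bounds y" by blast
  have "N ((x + y) * z) \<le> (K + L) * N z" for z
  proof -
    have "N ((x + y) * z) \<le> N (x * z) + N (y * z)" by (simp add: ring_distribs N_add)
    also have "\<dots> \<le> K * N z + L * N z" using K L by (intro add_mono) (auto simp: op_bounds_def)
    finally show ?thesis by (simp add: ring_distribs)
  qed
  hence "K + L \<in> op_bounds (x + y)" using K L by (auto simp: op_bounds_def)
  thus ?case by blast
qed

lemma op_norm_nonneg [simp]: "0 \<le> op_norm x"
  unfolding op_norm_def by (rule cInf_greatest[OF op_bounds_nonempty]) (auto simp: op_bounds_def)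

lemma op_norm_least: "0 \<le> K \<Longrightarrow> (\<And>y. N (x * y) \<le> K * N y) \<Longrightarrow> op_norm x \<le> K"
  unfolding op_norm_def by (rule cInf_lower) (auto simp: op_bounds_def intro: bdd_belowI[of _ 0])

lemma op_norm_bound: "N (x * y) \<le> op_norm x * N y"
\<comment> \<open>The infimum is attained: dividing by \<open>N y\<close> bounds it from below,
  while a null vector is sent to a null vector by any admissible constant.\<close>
proof (cases "N y = 0")
  case True
  obtain K where "K \<in> op_bounds x" using op_bounds_nonempty by blast
  hence "N (x * y) \<le> K * N y" by (simp add: op_bounds_def)
  thus ?thesis using True by simp
next
  case False
  hence p: "N y > 0" by (simp add: less_le)
  have "N (x * y) / N y \<le> op_norm x" unfolding op_norm_def
    by (rule cInf_greatest[OF op_bounds_nonempty]) (use p in \<open>auto simp: op_bounds_def field_simps\<close>)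
  thus ?thesis using p by (simp add: field_simps)
qed

lemma op_norm_add: "op_norm (x + y) \<le> op_norm x + op_norm y"
proof (rule op_norm_least)
  fix z
  have "N ((x + y) * z) \<le> N (x * z) + N (y * z)" by (simp add: ring_distribs N_add)
  also have "\<dots> \<le> op_norm x * N z + op_norm y * N z" by (intro add_mono op_norm_bound)
  finally show "N ((x + y) * z) \<le> (op_norm x + op_norm y) * N z" by (simp add: ring_distribs)
qed simp

lemma op_norm_mult: "op_norm (x * y) \<le> op_norm x * op_norm y"
proof (rule op_norm_least)
  fix z
  have "N ((x * y) * z) \<le> op_norm x * N (y * z)" by (simp add: mult.assoc op_norm_bound)
  also have "\<dots> \<le> op_norm x * (op_norm y * N z)" by (intro mult_left_mono op_norm_bound) simp
  finally show "N ((x * y) * z) \<le> (op_norm x * op_norm y) * N z" by (simp add: mult.assoc)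
qed simp

lemma op_norm_scale: "op_norm (scale_poly z x) = cmod z * op_norm x"
proof (rule antisym)
  have le: "op_norm (scale_poly z x) \<le> cmod z * op_norm x" for z x
    by (rule op_norm_least)
      (auto simp: N_scale mult.assoc simp flip: scale_poly_left intro!: mult_left_mono op_norm_bound)
  show "op_norm (scale_poly z x) \<le> cmod z * op_norm x" by (rule le)
  show "cmod z * op_norm x \<le> op_norm (scale_poly z x)"
  proof (cases "z = 0")
    case False
    have "scale_poly (inverse z) (scale_poly z x) = x"
      by (rule poly_mapping_eqI) (simp add: False)
    with le[of "inverse z" "scale_poly z x"] False show ?thesis
      by (simp add: norm_divide norm_inverse divide_simps mult.commute)
  qed simp
qed

text \<open>Moving the adjoint across the inner product bounds the square of \<open>?a\<close> by
  \<open>?a\<close> times the claimed bound, and one factor cancels.\<close>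

lemma op_norm_adj_le: "op_norm (adj_poly x) \<le> op_norm x"
proof (rule op_norm_least)
  fix y
  let ?a = "N (adj_poly x * y)"
  have "?a\<^sup>2 \<le> cmod (ip y (x * (adj_poly x * y)))"
    unfolding N_sq using complex_Re_le_cmod by (simp add: ip_adj)
  also have "\<dots> \<le> N y * (op_norm x * ?a)"
    by (intro order_trans[OF cauchy_schwarz] mult_left_mono op_norm_bound) simp
  finally have "?a * ?a \<le> (op_norm x * N y) * ?a" by (simp add: power2_eq_square mult_ac)
  thus "?a \<le> op_norm x * N y"
    by (cases "?a = 0") (auto simp: less_le mult_le_cancel_right)
qed simp

lemma op_norm_cstar: "op_norm (adj_poly x * x) = (op_norm x)\<^sup>2"
proof (rule antisym)
  have "op_norm (adj_poly x * x) \<le> op_norm (adj_poly x) * op_norm x" by (rule op_norm_mult)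
  also have "\<dots> \<le> op_norm x * op_norm x" by (intro mult_right_mono op_norm_adj_le) simp
  finally show "op_norm (adj_poly x * x) \<le> (op_norm x)\<^sup>2" by (simp add: power2_eq_square)
  have "op_norm x \<le> sqrt (op_norm (adj_poly x * x))"
  proof (rule op_norm_least)
    fix y
    have "(N (x * y))\<^sup>2 \<le> cmod (ip y (adj_poly x * x * y))"
      unfolding N_sq using complex_Re_le_cmod by (simp add: ip_adj mult.assoc)
    also have "\<dots> \<le> N y * (op_norm (adj_poly x * x) * N y)"
      by (intro order_trans[OF cauchy_schwarz] mult_left_mono op_norm_bound) simp
    also have "\<dots> = (sqrt (op_norm (adj_poly x * x)) * N y)\<^sup>2"
      by (simp add: power_mult_distrib) (simp add: power2_eq_square)
    finally show "N (x * y) \<le> sqrt (op_norm (adj_poly x * x)) * N y"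
      by (rule power2_le_imp_le) simp
  qed simp
  thus "(op_norm x)\<^sup>2 \<le> op_norm (adj_poly x * x)"
    by (metis op_norm_nonneg power_mono real_sqrt_pow2)
qed

theorem op_norm_cstar_seminorm: "cstar_seminorm op_norm"
  by (simp add: cstar_seminorm_def op_norm_add op_norm_mult op_norm_scale op_norm_cstar)

text \<open>The functional is the vector state of the cyclic vector 1, which is a unit vector
  because the empty word has value 1.\<close>

lemma lin_le_op_norm: "cmod (lin f x) \<le> op_norm x"
proof -
  have 1: "N 1 = 1" by (simp add: N_def ip_def unit)
  have "cmod (lin f x) = cmod (ip 1 (x * 1))" by (simp add: ip_def)
  also have "\<dots> \<le> N 1 * N (x * 1)" by (rule cauchy_schwarz)
  also have "\<dots> \<le> op_norm x" using op_norm_bound[of x 1] 1 by simp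
  finally show ?thesis .
qed

text \<open>The square of \<open>N (d * y)\<close> is the value at
  \<open>adj_poly (d * y) * d * y\<close>, so \<open>d\<close> has to be killed between arbitrary
  factors, not just by itself.\<close>

lemma op_norm_zeroI:
  assumes "\<And>u y. lin f (u * d * y) = 0"
  shows "op_norm d = 0"
proof -
  have "N (d * y) = 0" for y
    using assms[of "adj_poly (d * y)" y] by (simp add: N_def ip_def mult.assoc)
  hence "op_norm d \<le> 0" by (intro op_norm_least) auto
  thus ?thesis using op_norm_nonneg[of d] by simp
qed

end

section \<open>The universal seminorm\<close>

abbreviation mon :: "'g letter list \<Rightarrow> 'g star_poly" where
  "mon ls \<equiv> Poly_Mapping.single (Letters ls) 1"

abbreviation vg :: "'v \<Rightarrow> ('v + 'e) letter" where "vg v \<equiv> Gen (Inl v)"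
abbreviation va :: "'v \<Rightarrow> ('v + 'e) letter" where "va v \<equiv> Adj (Inl v)"
abbreviation eg :: "'e \<Rightarrow> ('v + 'e) letter" where "eg e \<equiv> Gen (Inr e)"
abbreviation ea :: "'e \<Rightarrow> ('v + 'e) letter" where "ea e \<equiv> Adj (Inr e)"

lemma mon_mult: "mon a * mon b = mon (a @ b)"
  by (simp add: mult_single plus_monomial_def)

lemma adj_mon [simp]: "adj_poly (mon a) = mon (rev (map flip_letter a))"
  by (simp add: adj_mono_def)

declare adj_poly_single [simp del]

lemma mon_free [simp]: "mon a \<in> free_star_algebra \<longleftrightarrow> a \<noteq> []"
  by (auto simp: free_star_algebra_def lookup_single when_def zero_monomial_def)

lemma sum_free: "(\<And>i. i \<in> D \<Longrightarrow> f i \<in> free_star_algebra) \<Longrightarrow> sum f D \<in> free_star_algebra"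
  by (induction D rule: infinite_finite_induct) auto

lemma star_poly_decomp: "x = (\<Sum>w\<in>Poly_Mapping.keys x. scale_poly (Poly_Mapping.lookup x w) (mon (letters w)))"
  (is "x = ?y")
proof (rule poly_mapping_eqI)
  fix v
  have "Poly_Mapping.lookup ?y v = (\<Sum>w\<in>Poly_Mapping.keys x. if w = v then Poly_Mapping.lookup x w else 0)"
    unfolding lookup_sum by (rule sum.cong) (auto simp: lookup_single when_def)
  also have "\<dots> = Poly_Mapping.lookup x v" by (simp add: in_keys_iff)
  finally show "Poly_Mapping.lookup x v = Poly_Mapping.lookup ?y v" by simp
qed

text \<open>Unlike in \<open>star_poly_induct\<close>, every partial sum of the expansion into words
  stays without constant term, so facts that hold on \<open>free_star_algebra\<close> only can be
  used in the induction.\<close>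

lemma free_star_algebra_induct [consumes 1, case_names zero mon add]:
  assumes x: "x \<in> free_star_algebra"
    and 0: "P 0" and 1: "\<And>ls z. ls \<noteq> [] \<Longrightarrow> P (scale_poly z (mon ls))"
    and 2: "\<And>x y. x \<in> free_star_algebra \<Longrightarrow> y \<in> free_star_algebra \<Longrightarrow> P x \<Longrightarrow> P y \<Longrightarrow> P (x + y)"
  shows "P x"
proof -
  let ?g = "\<lambda>w. scale_poly (Poly_Mapping.lookup x w) (mon (letters w))"
  have ne: "letters w \<noteq> []" if "w \<in> Poly_Mapping.keys x" for w
    using that x by (cases w) (auto simp: free_star_algebra_def in_keys_iff zero_monomial_def)
  have "P (sum ?g D) \<and> sum ?g D \<in> free_star_algebra" if "finite D" "D \<subseteq> Poly_Mapping.keys x" for D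
    using that
  proof (induction D rule: finite_induct)
    case (insert w D)
    have "?g w \<in> free_star_algebra" using ne insert mon_free[of "letters w"] by (intro F0_closed) blast
    moreover have "P (?g w)" using ne insert by (intro 1) blast
    ultimately show ?case using insert 2 by (simp del: monomial.collapse)
  qed (simp add: 0)
  from this[of "Poly_Mapping.keys x"] show ?thesis using star_poly_decomp[of x] by simp
qed

context free_cstar_seminorm
begin

text \<open>The canonical map of the free algebra into the completion; by \<open>em_eq_iff\<close>
  it identifies exactly the polynomials at seminorm distance 0.\<close>

definition em where
  "em x = cl (\<lambda>n::nat. x)"

lemma em_carrier [simp]: "x \<in> free_star_algebra \<Longrightarrow> em x \<in> carrier A"
  by (simp add: em_def carrier_A)

lemma em_add: "x \<in> free_star_algebra \<Longrightarrow> y \<in> free_star_algebra \<Longrightarrow> em x \<oplus>\<^bsub>A\<^esub> em y = em (x + y)"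
  by (simp add: em_def add_cl)

lemma em_mult: "x \<in> free_star_algebra \<Longrightarrow> y \<in> free_star_algebra \<Longrightarrow> em x \<otimes>\<^bsub>A\<^esub> em y = em (x * y)"
  by (simp add: em_def mult_cl)

lemma em_scale: "x \<in> free_star_algebra \<Longrightarrow> z \<cdot>\<^bsub>A\<^esub> em x = em (scale_poly z x)"
  by (simp add: em_def scale_cl)

lemma em_adj: "x \<in> free_star_algebra \<Longrightarrow> adj A (em x) = em (adj_poly x)"
  by (simp add: em_def adj_cl)

lemma em_norm: "x \<in> free_star_algebra \<Longrightarrow> cnorm A (em x) = q x"
  by (simp add: em_def norm_const)

lemma em_0: "\<zero>\<^bsub>A\<^esub> = em 0"
  by (simp add: em_def zero_A)

lemma em_eq_iff: "x \<in> free_star_algebra \<Longrightarrow> y \<in> free_star_algebra \<Longrightarrow> em x = em y \<longleftrightarrow> q (x - y) = 0"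
  by (simp add: em_def cl_eq_iff eqv_def LIMSEQ_const_iff)

lemma em_sum:
  assumes "finite D" "\<And>i. i \<in> D \<Longrightarrow> f i \<in> free_star_algebra"
  shows "(\<Oplus>\<^bsub>A\<^esub>i\<in>D. em (f i)) = em (sum f D)"
proof -
  interpret abelian_group A by (rule abg)
  show ?thesis using assms
  proof (induction D rule: finite_induct)
    case (insert i D)
    have "(\<Oplus>\<^bsub>A\<^esub>j\<in>insert i D. em (f j)) = em (f i) \<oplus>\<^bsub>A\<^esub> (\<Oplus>\<^bsub>A\<^esub>j\<in>D. em (f j))"
      using insert by (intro finsum_insert) auto
    thus ?case using insert by (simp add: em_add sum_free)
  qed (simp add: em_0)
qed

lemma completion_gen_em: "completion_gen q g = em (mon [Gen g])"
  by (simp add: completion_gen_def gen_poly_def em_def)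

lemma q_eq_trans: 
  assumes "x \<in> free_star_algebra" "y \<in> free_star_algebra" "z \<in> free_star_algebra"
    "q (x - y) = 0" "q (y - z) = 0"
  shows "q (x - z) = 0"
  using em_eq_iff assms by metis

lemma q_eq: "x \<in> free_star_algebra \<Longrightarrow> y \<in> free_star_algebra \<Longrightarrow> q (x - y) = 0 \<Longrightarrow> q x = q y"
  using em_eq_iff em_norm by metis

end

section \<open>The graph relations as polynomials\<close>

inductive_set graph_rels :: "('e \<Rightarrow> 'v) \<Rightarrow> ('e \<Rightarrow> 'v) \<Rightarrow> ('v + 'e) star_poly set"
  for r s :: "'e \<Rightarrow> 'v" where
  vertex_adj: "mon [va v] - mon [vg v] \<in> graph_rels r s"
| vertex_idem: "mon [vg v, vg v] - mon [vg v] \<in> graph_rels r s"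
| vertex_orth: "v \<noteq> v' \<Longrightarrow> mon [vg v, vg v'] \<in> graph_rels r s"
| edge_isometry: "mon [eg e, ea e, eg e] - mon [eg e] \<in> graph_rels r s"
| edge_orth: "e \<noteq> f \<Longrightarrow> mon [eg e, ea e, eg f, ea f] \<in> graph_rels r s"
| edge_source: "mon [ea e, eg e] - mon [vg (s e)] \<in> graph_rels r s"
| edge_idem: "mon [eg e, ea e, eg e, ea e] - mon [eg e, ea e] \<in> graph_rels r s"
| edge_range: "mon [eg e, ea e, vg (r e)] - mon [eg e, ea e] \<in> graph_rels r s"
| vertex_sum: "finite (r -` {v}) \<Longrightarrow> r -` {v} \<noteq> {} \<Longrightarrow>
    mon [vg v] - (\<Sum>e\<in>r -` {v}. mon [eg e, ea e]) \<in> graph_rels r s"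

lemma graph_rels_free: "d \<in> graph_rels r s \<Longrightarrow> d \<in> free_star_algebra"
  by (induction rule: graph_rels.induct) (auto intro!: sum_free)

text \<open>Every axiom of a graph family is an equation between images of polynomials, hence the
  vanishing of \<open>q\<close> at a difference. Self-adjointness of the range projections holds
  already for words, so only their idempotence appears as a relation. This moves all later
  verifications from completions to words.\<close>

lemma graph_family_iff:
  fixes q :: "('v + 'e) star_poly \<Rightarrow> real"
  assumes "cstar_seminorm q"
  shows "graph_family r s (completion q) (completion_gen q \<circ> Inl) (completion_gen q \<circ> Inr)
    \<longleftrightarrow> (\<forall>d\<in>graph_rels r s. q d = 0)"
proof -
  interpret free_cstar_seminorm q by standard (rule assms)
  have rels: "(\<forall>d\<in>graph_rels r s. q d = 0) \<longleftrightarrow>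
     (\<forall>v. q (mon [va v] - mon [vg v]) = 0 \<and> q (mon [vg v, vg v] - mon [vg v]) = 0) \<and>
     (\<forall>v w. v \<noteq> w \<longrightarrow> q (mon [vg v, vg w]) = 0) \<and>
     (\<forall>e. q (mon [eg e, ea e, eg e] - mon [eg e]) = 0) \<and>
     (\<forall>e f. e \<noteq> f \<longrightarrow> q (mon [eg e, ea e, eg f, ea f]) = 0) \<and>
     (\<forall>e. q (mon [ea e, eg e] - mon [vg (s e)]) = 0) \<and>
     (\<forall>e. q (mon [eg e, ea e, eg e, ea e] - mon [eg e, ea e]) = 0 \<and>
          q (mon [eg e, ea e, vg (r e)] - mon [eg e, ea e]) = 0) \<and>
     (\<forall>v. finite (r -` {v}) \<and> r -` {v} \<noteq> {} \<longrightarrow>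
        q (mon [vg v] - (\<Sum>e\<in>r -` {v}. mon [eg e, ea e])) = 0)" (is "_ \<longleftrightarrow> ?R")
  proof
    show "\<forall>d\<in>graph_rels r s. q d = 0 \<Longrightarrow> ?R" by (intro conjI allI impI; simp add: graph_rels.intros)
    show "?R \<Longrightarrow> \<forall>d\<in>graph_rels r s. q d = 0"
      by (intro ballI, erule graph_rels.cases) simp_all
  qed
  have sums: "(\<Oplus>\<^bsub>A\<^esub>e\<in>r -` {v}. em (mon [eg e, ea e])) = em (\<Sum>e\<in>r -` {v}. mon [eg e, ea e])"
    if "finite (r -` {v})" for v
    using that by (intro em_sum) auto
  have F: "(\<Sum>e\<in>r -` {v}. mon [eg e, ea e]) \<in> free_star_algebra" for v by (rule sum_free) simp
  show ?thesis
    unfolding rels graph_family_def projection_def partial_isometry_def proj_le_def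
    by (auto simp: completion_gen_em em_adj em_mult adj_mon mon_mult em_eq_iff em_0 sums F)
qed

section \<open>The admissible seminorms and their supremum\<close>

definition graph_seminorms :: "('e \<Rightarrow> 'v) \<Rightarrow> ('e \<Rightarrow> 'v) \<Rightarrow> (('v + 'e) star_poly \<Rightarrow> real) set" where
  "graph_seminorms r s = {q. cstar_seminorm q \<and> (\<forall>d\<in>graph_rels r s. q d = 0)}"

lemma graph_seminorm_alt: "graph_seminorm r s x = (SUP q\<in>graph_seminorms r s. q x)"
proof -
  have "{q x |q. cstar_seminorm q \<and> graph_family r s (completion q) (completion_gen q \<circ> Inl) (completion_gen q \<circ> Inr)}
     = (\<lambda>q. q x) ` graph_seminorms r s"
    using graph_family_iff by (fastforce simp: graph_seminorms_def)
  thus ?thesis by (simp add: graph_seminorm_def)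
qed

lemma graph_seminorms_nonempty: "(\<lambda>x. 0) \<in> graph_seminorms r s"
  by (simp add: graph_seminorms_def cstar_seminorm_def)

text \<open>By the C*-identity the norm of a projection equals its own square, hence is at most 1;
  edges follow from s_e^* s_e = p_{s(e)}.\<close>

lemma graph_seminorms_letter_le:
  assumes "q \<in> graph_seminorms r s"
  shows "q (mon [l]) \<le> 1"
proof -
  interpret free_cstar_seminorm q by standard (use assms in \<open>simp add: graph_seminorms_def\<close>)
  have R: "d \<in> graph_rels r s \<Longrightarrow> q d = 0" for d using assms by (simp add: graph_seminorms_def)
  have v: "q (mon [vg v]) \<le> 1" for v
  proof -
    have "q ((mon [va v] - mon [vg v]) * mon [vg v]) \<le> q (mon [va v] - mon [vg v]) * q (mon [vg v])"
      by (rule q_mult) auto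
    hence "q ((mon [va v] - mon [vg v]) * mon [vg v]) = 0"
      using R[OF vertex_adj] q_nonneg[of "(mon [va v] - mon [vg v]) * mon [vg v]"] by simp
    hence "q (mon [va v, vg v] - mon [vg v, vg v]) = 0" by (simp add: left_diff_distrib mon_mult)
    hence "q (mon [va v, vg v] - mon [vg v]) = 0"
      by (rule q_eq_trans[rotated 3]) (simp_all add: R vertex_idem)
    hence "q (mon [va v, vg v]) = q (mon [vg v])" by (intro q_eq) auto
    moreover have "q (mon [va v, vg v]) = (q (mon [vg v]))\<^sup>2"
      using q_cstar[of "mon [vg v]"] by (simp add: adj_mon mon_mult)
    ultimately show ?thesis by (cases "q (mon [vg v]) = 0") (auto simp: power2_eq_square)
  qed
  have e: "q (mon [eg e]) \<le> 1" for e
  proof -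
    have "q (mon [ea e, eg e]) = q (mon [vg (s e)])"
      by (rule q_eq) (simp_all add: R edge_source)
    hence "(q (mon [eg e]))\<^sup>2 \<le> 1"
      using q_cstar[of "mon [eg e]"] v[of "s e"] by (simp add: mon_mult)
    thus ?thesis by (simp add: abs_square_le_1 abs_le_iff)
  qed
  have a: "q (mon [Adj g]) = q (mon [Gen g])" for g
    using q_adj[of "mon [Gen g]"] by (simp add: adj_mon)
  show ?thesis
  proof (cases l)
    case (Gen g) thus ?thesis using v e by (cases g) auto
  next
    case (Adj g) thus ?thesis using v e a by (cases g) auto
  qed
qed

lemma graph_seminorms_mon_le:
  assumes "q \<in> graph_seminorms r s" "ls \<noteq> []"
  shows "q (mon ls) \<le> 1"
  using assms(2)
proof (induction ls rule: list_nonempty_induct)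
  case (single l) show ?case by (rule graph_seminorms_letter_le[OF assms(1)])
next
  case (cons l ls)
  interpret free_cstar_seminorm q by standard (use assms in \<open>simp add: graph_seminorms_def\<close>)
  have "q (mon (l # ls)) \<le> q (mon [l]) * q (mon ls)"
    using q_mult[of "mon [l]" "mon ls"] cons by (simp add: mon_mult)
  also have "\<dots> \<le> 1 * 1"
    using cons graph_seminorms_letter_le[OF assms(1)] by (intro mult_mono q_nonneg) auto
  finally show ?case by simp
qed

text \<open>A bound uniform in \<open>q\<close> comes from expanding into words, each of norm at
  most 1. It makes the real-valued supremum in \<open>graph_seminorm\<close> meaningful.\<close>

lemma graph_seminorms_bounded:
  assumes "x \<in> free_star_algebra"
  shows "\<exists>K. \<forall>q\<in>graph_seminorms r s. q x \<le> K"
  using assms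
proof (induction x rule: free_star_algebra_induct)
  case zero
  show ?case
    by (intro exI[of _ 0]) (auto simp: graph_seminorms_def free_cstar_seminorm.q_0[OF free_cstar_seminorm.intro])
next
  case (mon ls z)
  have "q (scale_poly z (mon ls)) \<le> cmod z" if "q \<in> graph_seminorms r s" for q
  proof -
    have "q (scale_poly z (mon ls)) = cmod z * q (mon ls)"
      using that mon by (simp add: graph_seminorms_def cstar_seminorm_def)
    also have "\<dots> \<le> cmod z * 1"
      by (intro mult_left_mono graph_seminorms_mon_le[OF that mon]) simp
    finally show ?thesis by simp
  qed
  thus ?case by blast
next
  case (add x y)
  then obtain K L where K: "\<forall>q\<in>graph_seminorms r s. q x \<le> K" "\<forall>q\<in>graph_seminorms r s. q y \<le> L" by blast
  have "q (x + y) \<le> K + L" if "q \<in> graph_seminorms r s" for q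
  proof -
    have "q (x + y) \<le> q x + q y" using that add by (simp add: graph_seminorms_def cstar_seminorm_def)
    thus ?thesis using K that by fastforce
  qed
  thus ?case by blast
qed

lemma graph_seminorm_upper:
  assumes "q \<in> graph_seminorms r s" "x \<in> free_star_algebra"
  shows "q x \<le> graph_seminorm r s x"
  unfolding graph_seminorm_alt using assms graph_seminorms_bounded[OF assms(2), of r s]
  by (intro cSUP_upper) (auto simp: bdd_above_def)

lemma graph_seminorm_least: "(\<And>q. q \<in> graph_seminorms r s \<Longrightarrow> q x \<le> K) \<Longrightarrow> graph_seminorm r s x \<le> K"
  unfolding graph_seminorm_alt using graph_seminorms_nonempty by (intro cSUP_least) auto

lemma graph_seminorm_zero:
  assumes "d \<in> graph_rels r s"
  shows "graph_seminorm r s d = 0"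
proof (rule antisym)
  show "graph_seminorm r s d \<le> 0"
    by (rule graph_seminorm_least) (use assms in \<open>auto simp: graph_seminorms_def\<close>)
  show "0 \<le> graph_seminorm r s d"
    using graph_seminorm_upper[OF graph_seminorms_nonempty graph_rels_free[OF assms]] by simp
qed

theorem graph_seminorm_cstar:
  fixes r s :: "'e \<Rightarrow> 'v"
  shows "cstar_seminorm (graph_seminorm r s)"
proof -
  let ?Q = "graph_seminorms r s" and ?g = "graph_seminorm r s" and ?F = free_star_algebra
  have fq: "free_cstar_seminorm q" if "q \<in> ?Q" for q
    by standard (use that in \<open>simp add: graph_seminorms_def\<close>)
  note up = graph_seminorm_upper and nn = free_cstar_seminorm.q_nonneg[OF fq]
  have g0: "0 \<le> ?g x" if "x \<in> ?F" for x
    using up[OF graph_seminorms_nonempty that] .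
  have scale: "?g (scale_poly z x) \<le> cmod z * ?g x" if "x \<in> ?F" for z x
    by (rule graph_seminorm_least)
      (use that in \<open>auto simp: free_cstar_seminorm.q_scale[OF fq] intro!: mult_left_mono up\<close>)
  show ?thesis
    unfolding cstar_seminorm_def
  proof (intro conjI ballI allI)
    fix x y :: "('v + 'e) star_poly" assume F: "x \<in> ?F" "y \<in> ?F"
    show "?g (x + y) \<le> ?g x + ?g y"
    proof (rule graph_seminorm_least)
      fix q assume q: "q \<in> ?Q"
      have "q (x + y) \<le> q x + q y" by (rule free_cstar_seminorm.q_add[OF fq[OF q] F])
      also have "\<dots> \<le> ?g x + ?g y" using q F by (intro add_mono up)
      finally show "q (x + y) \<le> ?g x + ?g y" .
    qed
    show "?g (x * y) \<le> ?g x * ?g y"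
    proof (rule graph_seminorm_least)
      fix q assume q: "q \<in> ?Q"
      have "q (x * y) \<le> q x * q y" by (rule free_cstar_seminorm.q_mult[OF fq[OF q] F])
      also have "\<dots> \<le> ?g x * ?g y" using q F by (intro mult_mono up g0 nn)
      finally show "q (x * y) \<le> ?g x * ?g y" .
    qed
  next
    fix z and x :: "('v + 'e) star_poly" assume x: "x \<in> ?F"
    show "?g (scale_poly z x) = cmod z * ?g x"
    proof (cases "z = 0")
      case True
      thus ?thesis using scale[OF x, of z] g0[of "scale_poly z x"] x by auto
    next
      case False
      have "scale_poly (inverse z) (scale_poly z x) = x" by (rule poly_mapping_eqI) (simp add: False)
      with scale[of "scale_poly z x" "inverse z"] x False have "cmod z * ?g x \<le> ?g (scale_poly z x)"
        by (simp add: norm_divide norm_inverse divide_simps mult.commute)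
      with scale[OF x, of z] show ?thesis by simp
    qed
  next
    fix x :: "('v + 'e) star_poly" assume x: "x \<in> ?F"
    show "?g (adj_poly x * x) = (?g x)\<^sup>2"
    proof (rule antisym)
      show "?g (adj_poly x * x) \<le> (?g x)\<^sup>2"
        by (rule graph_seminorm_least)
          (use x in \<open>auto simp: free_cstar_seminorm.q_cstar[OF fq] intro!: power_mono up nn\<close>)
      \<comment> \<open>A supremum is bounded member by member, and this is possible only with the
        square moved to the other side.\<close>
      have "?g x \<le> sqrt (?g (adj_poly x * x))"
      proof (rule graph_seminorm_least)
        fix q assume q: "q \<in> ?Q"
        have "(q x)\<^sup>2 \<le> ?g (adj_poly x * x)"
          using up[OF q, of "adj_poly x * x"] x by (simp add: free_cstar_seminorm.q_cstar[OF fq[OF q]])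
        thus "q x \<le> sqrt (?g (adj_poly x * x))" by (rule real_le_rsqrt)
      qed
      hence "(?g x)\<^sup>2 \<le> (sqrt (?g (adj_poly x * x)))\<^sup>2" using g0[OF x] by (intro power_mono)
      thus "(?g x)\<^sup>2 \<le> ?g (adj_poly x * x)" using g0[of "adj_poly x * x"] x by simp
    qed
  qed
qed

lemma graph_seminorm_mem: "graph_seminorm r s \<in> graph_seminorms r s"
  by (simp add: graph_seminorms_def graph_seminorm_cstar graph_seminorm_zero)

section \<open>Paths and the reduction of words\<close>

text \<open>A path is encoded by the list of its edges together with its source, so that the vertices
  are the paths with empty edge list.\<close>

primrec rng :: "('e \<Rightarrow> 'v) \<Rightarrow> 'e list \<Rightarrow> 'v \<Rightarrow> 'v" where
  "rng r [] v = v"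
| "rng r (e # es) v = r e"

primrec pth :: "('e \<Rightarrow> 'v) \<Rightarrow> ('e \<Rightarrow> 'v) \<Rightarrow> 'e list \<Rightarrow> 'v \<Rightarrow> bool" where
  "pth r s [] v \<longleftrightarrow> True"
| "pth r s (e # es) v \<longleftrightarrow> s e = rng r es v \<and> pth r s es v"

lemma rng_append: "rng r (\<mu> @ \<eta>) v = rng r \<mu> (rng r \<eta> v)"
  by (cases \<mu>) auto

lemma pth_append: "pth r s (\<mu> @ \<eta>) v \<longleftrightarrow> pth r s \<mu> (rng r \<eta> v) \<and> pth r s \<eta> v"
  by (induction \<mu>) (auto simp: rng_append)

text \<open>The letters act on paths by partial injections, the generators of the path space
  representation.\<close>

fun act1 :: "('e \<Rightarrow> 'v) \<Rightarrow> ('e \<Rightarrow> 'v) \<Rightarrow> 'v \<Rightarrow> ('v + 'e) letter \<Rightarrow> 'e list \<Rightarrow> 'e list option" where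
  "act1 r s v (Gen (Inl u)) es = (if rng r es v = u then Some es else None)"
| "act1 r s v (Adj (Inl u)) es = (if rng r es v = u then Some es else None)"
| "act1 r s v (Gen (Inr e)) es = (if rng r es v = s e then Some (e # es) else None)"
| "act1 r s v (Adj (Inr e)) [] = None"
| "act1 r s v (Adj (Inr e)) (f # es) = (if f = e then Some es else None)"

primrec act :: "('e \<Rightarrow> 'v) \<Rightarrow> ('e \<Rightarrow> 'v) \<Rightarrow> 'v \<Rightarrow> ('v + 'e) letter list \<Rightarrow> 'e list \<Rightarrow> 'e list option" where
  "act r s v [] es = Some es"
| "act r s v (l # ls) es = Option.bind (act r s v ls es) (act1 r s v l)"

lemma act_append: "act r s v (a @ b) es = Option.bind (act r s v b es) (act r s v a)"
  by (induction a) (auto simp: bind_assoc)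

lemma act1_pth: "act1 r s v l es = Some es' \<Longrightarrow> pth r s es v \<Longrightarrow> pth r s es' v"
  by (cases "(r, s, v, l, es)" rule: act1.cases) (auto split: if_splits)

lemma act_pth: "act r s v ls es = Some es' \<Longrightarrow> pth r s es v \<Longrightarrow> pth r s es' v"
  by (induction ls arbitrary: es') (auto simp: bind_eq_Some_conv intro: act1_pth)

text \<open>The adjoint letter is the inverse partial injection. Removing an edge does not test what
  adding it back tests, namely that \<open>rng\<close> of the rest is the source of the edge; the
  path hypotheses supply this.\<close>

lemma act1_flip:
  assumes "pth r s es v" "pth r s es' v"
  shows "act1 r s v (flip_letter l) es' = Some es \<longleftrightarrow> act1 r s v l es = Some es'"
  using assms
  by (cases "(r, s, v, l, es)" rule: act1.cases; cases es') (auto split: if_splits)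

lemma act_flip:
  assumes "pth r s es v" "pth r s es' v"
  shows "act r s v (rev (map flip_letter ls)) es' = Some es \<longleftrightarrow> act r s v ls es = Some es'"
  using assms
proof (induction ls arbitrary: es')
  case (Cons l ls)
  have "act r s v (rev (map flip_letter (l # ls))) es' = Some es \<longleftrightarrow>
      (\<exists>es1. pth r s es1 v \<and> act1 r s v (flip_letter l) es' = Some es1 \<and>
         act r s v (rev (map flip_letter ls)) es1 = Some es)"
    using Cons.prems by (auto simp: act_append bind_eq_Some_conv intro: act1_pth)
  also have "\<dots> \<longleftrightarrow> (\<exists>es1. pth r s es1 v \<and> act1 r s v l es1 = Some es' \<and> act r s v ls es = Some es1)"
    using Cons act1_flip by metis
  also have "\<dots> \<longleftrightarrow> act r s v (l # ls) es = Some es'"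
    using Cons.prems by (auto simp: bind_eq_Some_conv intro: act_pth)
  finally show ?case .
qed auto

text \<open>Each letter removes at most one edge. With \<open>es'\<close> empty this bounds the
  paths that a word can erase, and thereby the depth of truncation needed in
  \<open>phi_vertex_sum\<close>.\<close>

lemma act_length: "act r s v ls es = Some es' \<Longrightarrow> length es \<le> length es' + length ls"
proof (induction ls arbitrary: es')
  case (Cons l ls)
  then obtain es1 where 1: "act r s v ls es = Some es1" "act1 r s v l es1 = Some es'"
    by (auto simp: bind_eq_Some_conv)
  have "length es1 \<le> Suc (length es')"
    using 1(2) by (cases "(r, s, v, l, es1)" rule: act1.cases) (auto split: if_splits)
  thus ?case using Cons.IH[OF 1(1)] by simp
qed simp

text \<open>The words \<open>s\<^sub>\<mu> p\<^sub>u s\<^sub>\<nu>\<^sup>*\<close>, to one of which every nonempty word reduces unless it vanishes.\<close>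

definition sword :: "'e list \<Rightarrow> 'e list \<Rightarrow> 'v \<Rightarrow> ('v + 'e) letter list" where
  "sword \<mu> \<nu> u = map eg \<mu> @ [vg u] @ rev (map ea \<nu>)"

text \<open>Multiplies \<open>sword \<mu> \<nu> u\<close> by a letter on the left and restores that
  form, with \<open>None\<close> for zero. Only an adjoint edge meeting an empty \<mu> affects \<nu>
  and the vertex: there s_e^* p_{r(e)} = p_{s(e)} s_e^*.\<close>

fun red1 :: "('e \<Rightarrow> 'v) \<Rightarrow> ('e \<Rightarrow> 'v) \<Rightarrow> ('v + 'e) letter \<Rightarrow> 'e list \<Rightarrow> 'e list \<Rightarrow> 'v \<Rightarrow>
    ('e list \<times> 'e list \<times> 'v) option" where
  "red1 r s (Gen (Inl v)) \<mu> \<nu> u = (if rng r \<mu> u = v then Some (\<mu>, \<nu>, u) else None)"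
| "red1 r s (Adj (Inl v)) \<mu> \<nu> u = (if rng r \<mu> u = v then Some (\<mu>, \<nu>, u) else None)"
| "red1 r s (Gen (Inr e)) \<mu> \<nu> u = (if rng r \<mu> u = s e then Some (e # \<mu>, \<nu>, u) else None)"
| "red1 r s (Adj (Inr e)) [] \<nu> u = (if u = r e then Some ([], \<nu> @ [e], s e) else None)"
| "red1 r s (Adj (Inr e)) (f # \<mu>) \<nu> u = (if f = e then Some (\<mu>, \<nu>, u) else None)"

text \<open>The graph of the partial map given by \<open>sword \<mu> \<nu> u\<close> on paths with
  source \<open>v\<close>: a prefix \<nu> is exchanged for \<mu>.\<close>

definition shift :: "('e \<Rightarrow> 'v) \<Rightarrow> ('e \<Rightarrow> 'v) \<Rightarrow> 'e list \<Rightarrow> 'e list \<Rightarrow> 'v \<Rightarrow> 'v \<Rightarrow> 'e list \<Rightarrow> 'e list \<Rightarrow> bool" where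
  "shift r s \<mu> \<nu> u v es es' \<longleftrightarrow>
     (\<exists>\<eta>. pth r s \<eta> v \<and> rng r \<eta> v = u \<and> es = \<nu> @ \<eta> \<and> es' = \<mu> @ \<eta>)"

lemma red1_pth:
  "red1 r s l \<mu> \<nu> u = Some (\<mu>', \<nu>', u') \<Longrightarrow> pth r s \<mu> u \<Longrightarrow> pth r s \<nu> u \<Longrightarrow> pth r s \<mu>' u' \<and> pth r s \<nu>' u'"
  by (cases "(r, s, l, \<mu>, \<nu>, u)" rule: red1.cases) (auto split: if_splits simp: pth_append)

text \<open>Reduction of words and action on paths run in parallel, so a word and its normal form
  act alike.\<close>

lemma red1_shift:
  "(\<exists>es1. shift r s \<mu> \<nu> u v es es1 \<and> act1 r s v l es1 = Some es') \<longleftrightarrow>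
   (case red1 r s l \<mu> \<nu> u of None \<Rightarrow> False | Some (\<mu>', \<nu>', u') \<Rightarrow> shift r s \<mu>' \<nu>' u' v es es')"
proof (cases "(r, s, l, \<mu>, \<nu>, u)" rule: red1.cases)
  case (4 r s e \<nu> u)
  \<comment> \<open>With \<mu> empty, the edge to be removed is the first edge of \<eta>; it is
    absorbed into the prefix \<nu>.\<close>
  have "(\<exists>\<eta>. pth r s \<eta> v \<and> rng r \<eta> v = u \<and> es = \<nu> @ \<eta> \<and> act1 r s v (ea e) \<eta> = Some es') \<longleftrightarrow>
    u = r e \<and> pth r s es' v \<and> rng r es' v = s e \<and> es = \<nu> @ [e] @ es'"
  proof (intro iffI)
    assume "\<exists>\<eta>. pth r s \<eta> v \<and> rng r \<eta> v = u \<and> es = \<nu> @ \<eta> \<and> act1 r s v (ea e) \<eta> = Some es'"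
    then obtain \<eta> where "pth r s \<eta> v" "rng r \<eta> v = u" "es = \<nu> @ \<eta>" "act1 r s v (ea e) \<eta> = Some es'" by blast
    thus "u = r e \<and> pth r s es' v \<and> rng r es' v = s e \<and> es = \<nu> @ [e] @ es'"
      by (cases \<eta>) (auto split: if_splits)
  qed (auto intro!: exI[of _ "e # es'"])
  thus ?thesis using 4 by (auto simp: shift_def)
qed (auto simp: shift_def rng_append)

section \<open>Words modulo the relations\<close>

locale graph_seminorm_rels = free_cstar_seminorm q
  for q :: "('v + 'e) star_poly \<Rightarrow> real" +
  fixes r s :: "'e \<Rightarrow> 'v"
  assumes rels: "d \<in> graph_rels r s \<Longrightarrow> q d = 0"
begin

text \<open>Nonemptiness keeps both words in \<open>free_star_algebra\<close>, the domain on which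
  \<open>q\<close> is a seminorm.\<close>

definition weq :: "('v + 'e) letter list \<Rightarrow> ('v + 'e) letter list \<Rightarrow> bool" where
  "weq a b \<longleftrightarrow> a \<noteq> [] \<and> b \<noteq> [] \<and> q (mon a - mon b) = 0"

definition wzero :: "('v + 'e) letter list \<Rightarrow> bool" where
  "wzero a \<longleftrightarrow> a \<noteq> [] \<and> q (mon a) = 0"

lemma q_ideal_mult: 
  assumes "x \<in> free_star_algebra" "q x = 0"
  shows "y \<in> free_star_algebra \<Longrightarrow> q (y * x) = 0" "y \<in> free_star_algebra \<Longrightarrow> q (x * y) = 0"
  using q_mult[of y x] q_mult[of x y] q_nonneg[of "y * x"] q_nonneg[of "x * y"] assms
  by (auto intro: antisym)

text \<open>The null space is an ideal. The outer words may be empty and then stand for the unit,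
  which lies outside \<open>free_star_algebra\<close>; hence the case distinctions.\<close>

lemma q_ideal:
  assumes "x \<in> free_star_algebra" "q x = 0"
  shows "q (mon a * x * mon b) = 0"
proof -
  have e: "mon [] = (1 :: ('v + 'e) star_poly)" by (simp flip: zero_monomial_def)
  have 1: "q (mon a * x) = 0" "mon a * x \<in> free_star_algebra"
    using q_ideal_mult[OF assms, of "mon a"] assms by (cases "a = []"; simp add: e)+
  show ?thesis using q_ideal_mult[OF 1(2,1), of "mon b"] 1 by (cases "b = []") (simp_all add: e)
qed

lemma weq_ctx: "weq a b \<Longrightarrow> weq (u @ a @ v) (u @ b @ v)"
  using q_ideal[of "mon a - mon b" u v] by (auto simp: weq_def ring_distribs mon_mult)

lemma wzero_ctx: "wzero a \<Longrightarrow> wzero (u @ a @ v)"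
  using q_ideal[of "mon a" u v] by (auto simp: wzero_def mon_mult)

lemma weq_refl: "a \<noteq> [] \<Longrightarrow> weq a a" by (simp add: weq_def)

lemma weq_sym: "weq a b \<Longrightarrow> weq b a"
  using q_diff_commute[of "mon a" "mon b"] by (auto simp: weq_def)

lemma weq_trans [trans]: "weq a b \<Longrightarrow> weq b d \<Longrightarrow> weq a d"
  using q_eq_trans[of "mon a" "mon b" "mon d"] by (auto simp: weq_def)

lemma weq_wzero: "weq a b \<Longrightarrow> wzero b \<Longrightarrow> wzero a"
  using q_eq[of "mon a" "mon b"] by (auto simp: weq_def wzero_def)

lemma weq_adj: "weq a b \<Longrightarrow> weq (rev (map flip_letter a)) (rev (map flip_letter b))"
  using q_adj[of "mon a - mon b"] by (auto simp: weq_def adj_poly_diff)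

lemma weq_rels:
  "weq [va v] [vg v]" "weq [vg v, vg v] [vg v]" "weq [eg e, ea e, eg e] [eg e]"
  "weq [ea e, eg e] [vg (s e)]" "weq [eg e, ea e, vg (r e)] [eg e, ea e]"
  by (simp_all add: weq_def rels graph_rels.intros)

lemma wzero_rels: "v \<noteq> v' \<Longrightarrow> wzero [vg v, vg v']" "e \<noteq> f \<Longrightarrow> wzero [eg e, ea e, eg f, ea f]"
  by (simp_all add: wzero_def rels graph_rels.intros)

text \<open>The range relation has the vertex on the right of s_e s_e^*. Its adjoint has it on the
  left, and s_e = s_e s_e^* s_e carries it over to s_e.\<close>

lemma range_edge: "weq [vg (r e), eg e] [eg e]"
proof -
  have "weq [vg (r e), eg e] [vg (r e), eg e, ea e, eg e]"
    using weq_ctx[OF weq_sym[OF weq_rels(3)], where u = "[vg (r e)]" and v = "[]"] by simp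
  also have "weq \<dots> [va (r e), eg e, ea e, eg e]"
    using weq_ctx[OF weq_sym[OF weq_rels(1)], where u = "[]" and v = "[eg e, ea e, eg e]"] by simp
  also have "weq \<dots> [eg e, ea e, eg e]"
    using weq_ctx[OF weq_adj[OF weq_rels(5)], where u = "[]" and v = "[eg e]"] by simp
  also have "weq \<dots> [eg e]" by (rule weq_rels)
  finally show ?thesis .
qed

lemma edge_source_vertex: "weq [eg e, vg (s e)] [eg e]"
proof -
  have "weq [eg e, vg (s e)] [eg e, ea e, eg e]"
    using weq_ctx[OF weq_sym[OF weq_rels(4)], where u = "[eg e]" and v = "[]"] by simp
  also have "weq \<dots> [eg e]" by (rule weq_rels)
  finally show ?thesis .
qed

lemma adj_range: "weq [ea e, vg (r e)] [ea e]"
proof -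
  have "weq [ea e, vg (r e)] [ea e, va (r e)]"
    using weq_ctx[OF weq_sym[OF weq_rels(1)], where u = "[ea e]" and v = "[]"] by simp
  also have "weq \<dots> [ea e]" using weq_adj[OF range_edge] by simp
  finally show ?thesis .
qed

lemma source_adj: "weq [vg (s e), ea e] [ea e]"
proof -
  have "weq [vg (s e), ea e] [va (s e), ea e]"
    using weq_ctx[OF weq_sym[OF weq_rels(1)], where u = "[]" and v = "[ea e]"] by simp
  also have "weq \<dots> [ea e]" using weq_adj[OF edge_source_vertex] by simp
  finally show ?thesis .
qed

lemma wzero_pairs:
  "v \<noteq> r e \<Longrightarrow> wzero [vg v, eg e]" "u \<noteq> s e \<Longrightarrow> wzero [eg e, vg u]" "u \<noteq> r e \<Longrightarrow> wzero [ea e, vg u]"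
  "s e \<noteq> r f \<Longrightarrow> wzero [eg e, eg f]" "e \<noteq> f \<Longrightarrow> wzero [ea e, eg f]"
proof -
  show "wzero [vg v, eg e]" if "v \<noteq> r e"
    using weq_wzero[OF weq_ctx[OF weq_sym[OF range_edge], where u = "[vg v]" and v = "[]"]]
      wzero_ctx[OF wzero_rels(1)[OF that], of "[]" "[eg e]"] by simp
  show 2: "wzero [eg e, vg u]" if "u \<noteq> s e" for u
    using weq_wzero[OF weq_ctx[OF weq_sym[OF edge_source_vertex], where u = "[]" and v = "[vg u]"]]
      wzero_ctx[OF wzero_rels(1)[OF that[symmetric]], of "[eg e]" "[]"] by simp
  show "wzero [ea e, vg u]" if "u \<noteq> r e"
    using weq_wzero[OF weq_ctx[OF weq_sym[OF adj_range], where u = "[]" and v = "[vg u]"]]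
      wzero_ctx[OF wzero_rels(1)[OF that[symmetric]], of "[ea e]" "[]"] by simp
  show "wzero [eg e, eg f]" if "s e \<noteq> r f"
    using weq_wzero[OF weq_ctx[OF weq_sym[OF range_edge], where u = "[eg e]" and v = "[]"]]
      wzero_ctx[OF 2[OF that[symmetric]], of "[]" "[eg f]"] by simp
  \<comment> \<open>Expanding both letters by the isometry relation brings the two orthogonal range
    projections side by side.\<close>
  show "wzero [ea e, eg f]" if "e \<noteq> f"
  proof -
    have "weq [ea e, eg f] [ea e, eg e, ea e, eg f]"
      using weq_ctx[OF weq_sym[OF weq_adj[OF weq_rels(3)]], where u = "[]" and v = "[eg f]"] by simp
    also have "weq \<dots> [ea e, eg e, ea e, eg f, ea f, eg f]"
      using weq_ctx[OF weq_sym[OF weq_rels(3)], where u = "[ea e, eg e, ea e]" and v = "[]"] by simp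
    finally show ?thesis
      by (rule weq_wzero) (use wzero_ctx[OF wzero_rels(2)[OF that], of "[ea e]" "[eg f]"] in simp)
  qed
qed

lemma red1_weq:
  assumes "pth r s \<mu> u"
  shows "case red1 r s l \<mu> \<nu> u of None \<Rightarrow> wzero (l # sword \<mu> \<nu> u)
    | Some (\<mu>', \<nu>', u') \<Rightarrow> weq (l # sword \<mu> \<nu> u) (sword \<mu>' \<nu>' u')"
proof -
  let ?t = "rev (map ea \<nu>)"
  have v: "if rng r \<mu> u = v then weq (vg v # sword \<mu> \<nu> u) (sword \<mu> \<nu> u) else wzero (vg v # sword \<mu> \<nu> u)" for v
  proof (cases \<mu>)
    case Nil
    thus ?thesis
      using weq_ctx[OF weq_rels(2), of "[]" _ ?t] wzero_ctx[OF wzero_rels(1), of _ _ "[]" ?t]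
      by (auto simp: sword_def)
  next
    case (Cons f \<mu>')
    thus ?thesis
      using weq_ctx[OF range_edge, of "[]" _ "map eg \<mu>' @ [vg u] @ ?t"]
        wzero_ctx[OF wzero_pairs(1), of _ _ "[]" "map eg \<mu>' @ [vg u] @ ?t"]
      by (auto simp: sword_def)
  qed
  have va: "weq (va v # sword \<mu> \<nu> u) (vg v # sword \<mu> \<nu> u)" for v
    using weq_ctx[OF weq_rels(1), of "[]" _ "sword \<mu> \<nu> u"] by simp
  show ?thesis
  proof (cases "(r, s, l, \<mu>, \<nu>, u)" rule: red1.cases)
    case (1 _ _ v') thus ?thesis using v[of v'] by auto
  next
    case (2 _ _ v') thus ?thesis using v[of v'] weq_trans[OF va] weq_wzero[OF va] by auto
  next
    case (3 _ _ e)
    have "wzero (eg e # sword \<mu> \<nu> u)" if "rng r \<mu> u \<noteq> s e"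
    proof (cases \<mu>)
      case Nil
      thus ?thesis using wzero_ctx[OF wzero_pairs(2), of _ _ "[]" ?t] that by (auto simp: sword_def)
    next
      case (Cons f \<mu>')
      thus ?thesis using wzero_ctx[OF wzero_pairs(4), of _ _ "[]" "map eg \<mu>' @ [vg u] @ ?t"] that
        by (auto simp: sword_def)
    qed
    moreover have "weq (eg e # sword \<mu> \<nu> u) (sword (e # \<mu>) \<nu> u)"
      by (simp add: sword_def weq_refl)
    ultimately show ?thesis using 3 by auto
  next
    case (4 _ _ e)
    have "weq [ea e, vg (r e)] [vg (s e), ea e]" by (rule weq_trans[OF adj_range weq_sym[OF source_adj]])
    thus ?thesis using 4 weq_ctx[of "[ea e, vg (r e)]" "[vg (s e), ea e]" "[]" ?t]
      wzero_ctx[OF wzero_pairs(3), of _ _ "[]" ?t] by (auto simp: sword_def)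
  next
    case (5 _ _ e f \<mu>')
    have "weq (ea e # sword (e # \<mu>') \<nu> u) (sword \<mu>' \<nu> u)" if "f = e"
    proof -
      have "weq (ea e # sword (e # \<mu>') \<nu> u) (vg (s e) # sword \<mu>' \<nu> u)"
        using weq_ctx[OF weq_rels(4), of "[]" _ "sword \<mu>' \<nu> u"] by (simp add: sword_def)
      \<comment> \<open>By the path condition \<open>s e\<close> is the range of what remains, so
        the projection is absorbed.\<close>
      also have "weq \<dots> (sword \<mu>' \<nu> u)"
      proof (cases \<mu>')
        case Nil
        thus ?thesis using assms 5 that weq_ctx[OF weq_rels(2), of "[]" _ ?t] by (auto simp: sword_def)
      next
        case (Cons h \<mu>'')
        thus ?thesis using assms 5 that weq_ctx[OF range_edge, of "[]" h "map eg \<mu>'' @ [vg u] @ ?t"]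
          by (auto simp: sword_def)
      qed
      finally show ?thesis .
    qed
    moreover have "wzero (ea e # sword (f # \<mu>') \<nu> u)" if "f \<noteq> e"
      using wzero_ctx[OF wzero_pairs(5)[OF that[symmetric]], of "[]" "map eg \<mu>' @ [vg u] @ ?t"]
      by (simp add: sword_def)
    ultimately show ?thesis using 5 by auto
  qed
qed

text \<open>The vertex whose projection can be appended to the letter without changing it; this puts
  a single letter in the form needed to start the reduction.\<close>

fun letter_source :: "('v + 'e) letter \<Rightarrow> 'v" where
  "letter_source (Gen (Inl v)) = v"
| "letter_source (Adj (Inl v)) = v"
| "letter_source (Gen (Inr e)) = s e"
| "letter_source (Adj (Inr e)) = r e"

lemma weq_letter: "weq [l] (l # sword [] [] (letter_source l))"
proof (cases l rule: letter_source.cases)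
  case (1 v) thus ?thesis using weq_sym[OF weq_rels(2)] by (simp add: sword_def)
next
  case (2 v)
  have "weq [va v] [va v, va v]" using weq_adj[OF weq_sym[OF weq_rels(2)]] by simp
  also have "weq \<dots> [va v, vg v]" using weq_ctx[OF weq_rels(1), of "[va v]" _ "[]"] by simp
  finally show ?thesis using 2 by (simp add: sword_def)
next
  case (3 e) thus ?thesis using weq_sym[OF edge_source_vertex] by (simp add: sword_def)
next
  case (4 e) thus ?thesis using weq_sym[OF adj_range] by (simp add: sword_def)
qed

lemma act1_letter_source: "pth r s es v \<Longrightarrow> act1 r s v l es = Some es' \<Longrightarrow> rng r es v = letter_source l"
  by (cases "(r, s, v, l, es)" rule: act1.cases) (auto split: if_splits)

text \<open>Algebraic normal form and action are proved in one induction because the same \<mu>,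
  \<nu> and u have to serve both: later the action is used to read off their lengths.\<close>

theorem word_reduction:
  assumes "ls \<noteq> []"
  shows "(wzero ls \<and> (\<forall>v es. pth r s es v \<longrightarrow> act r s v ls es = None)) \<or>
    (\<exists>\<mu> \<nu> u. pth r s \<mu> u \<and> pth r s \<nu> u \<and> weq ls (sword \<mu> \<nu> u) \<and>
       (\<forall>v es es'. pth r s es v \<longrightarrow> (act r s v ls es = Some es' \<longleftrightarrow> shift r s \<mu> \<nu> u v es es')))"
    (is "?P ls")
proof -
  \<comment> \<open>Shared by the start and the induction step: a letter in front of a word already
    in normal form.\<close>
  have step: "?P (l # ls)"
    if w: "weq (l # ls) (l # sword \<mu> \<nu> u)" and p: "pth r s \<mu> u" "pth r s \<nu> u"
    and a: "\<And>v es es'. pth r s es v \<Longrightarrow>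
          act r s v (l # ls) es = Some es' \<longleftrightarrow> (\<exists>es1. shift r s \<mu> \<nu> u v es es1 \<and> act1 r s v l es1 = Some es')"
    for l ls \<mu> \<nu> u
  proof (cases "red1 r s l \<mu> \<nu> u")
    case None
    have "wzero (l # ls)" using red1_weq[OF p(1), of l \<nu>] None weq_wzero[OF w] by simp
    moreover have "act r s v (l # ls) es = None" if "pth r s es v" for v es
    proof -
      have "act r s v (l # ls) es \<noteq> Some es'" for es'
        unfolding a[OF that] red1_shift None by simp
      thus ?thesis by blast
    qed
    ultimately show ?thesis by blast
  next
    case (Some t)
    then obtain \<mu>' \<nu>' u' where t: "red1 r s l \<mu> \<nu> u = Some (\<mu>', \<nu>', u')" by (cases t) auto
    have "weq (l # ls) (sword \<mu>' \<nu>' u')" using red1_weq[OF p(1), of l \<nu>] t weq_trans[OF w] by simp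
    moreover have "act r s v (l # ls) es = Some es' \<longleftrightarrow> shift r s \<mu>' \<nu>' u' v es es'" if "pth r s es v" for v es es'
      unfolding a[OF that] red1_shift t by simp
    ultimately show ?thesis using red1_pth[OF t p] by blast
  qed
  show ?thesis using assms
  proof (induction ls rule: list_nonempty_induct)
    case (single l)
    show ?case
    proof (rule step)
      show "weq [l] (l # sword [] [] (letter_source l))" by (rule weq_letter)
      fix v es es' assume "pth r s es v"
      thus "act r s v [l] es = Some es' \<longleftrightarrow>
          (\<exists>es1. shift r s [] [] (letter_source l) v es es1 \<and> act1 r s v l es1 = Some es')"
        using act1_letter_source[of es v l es'] by (auto simp: shift_def)
    qed simp_all
  next
    case (cons l ls)
    show ?case
    proof (cases "wzero ls \<and> (\<forall>v es. pth r s es v \<longrightarrow> act r s v ls es = None)")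
      case True
      thus ?thesis using wzero_ctx[of ls "[l]" "[]"] by auto
    next
      case False
      then obtain \<mu> \<nu> u where m: "pth r s \<mu> u" "pth r s \<nu> u" "weq ls (sword \<mu> \<nu> u)"
        "\<And>v es es'. pth r s es v \<Longrightarrow> act r s v ls es = Some es' \<longleftrightarrow> shift r s \<mu> \<nu> u v es es'"
        using cons.IH by blast
      show ?thesis
        by (rule step[OF _ m(1,2)])
          (use weq_ctx[OF m(3), of "[l]" "[]"] m(4) in \<open>auto simp: bind_eq_Some_conv\<close>)
    qed
  qed
qed

end

section \<open>The trace functional of a weighted graph\<close>

text \<open>The action involves no seminorm, so its half of \<open>word_reduction\<close> can be
  extracted with the zero seminorm, which satisfies all relations.\<close>

lemma act_reduction:
  fixes r s :: "'e \<Rightarrow> 'v" and ls :: "('v + 'e) letter list"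
  assumes "ls \<noteq> []"
  shows "(\<forall>v es. pth r s es v \<longrightarrow> act r s v ls es = None) \<or>
    (\<exists>\<mu> \<nu> u. pth r s \<mu> u \<and> pth r s \<nu> u \<and>
       (\<forall>v es es'. pth r s es v \<longrightarrow> (act r s v ls es = Some es' \<longleftrightarrow> shift r s \<mu> \<nu> u v es es')))"
proof -
  interpret graph_seminorm_rels "\<lambda>x :: ('v + 'e) star_poly. 0" r s
    by standard (simp_all add: cstar_seminorm_def)
  show ?thesis using word_reduction[OF assms] by blast
qed

lemma act_sword:
  assumes "pth r s \<mu> u"
  shows "act r s v (sword \<mu> \<nu> u) es = Some es' \<longleftrightarrow>
    (\<exists>\<eta>. rng r \<eta> v = u \<and> es = \<nu> @ \<eta> \<and> es' = \<mu> @ \<eta>)"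
proof -
  have a: "act r s v (rev (map ea \<nu>)) es = Some \<eta> \<longleftrightarrow> es = \<nu> @ \<eta>" for es \<eta> :: "'a list"
  proof (induction \<nu> arbitrary: es)
    case (Cons e \<nu>)
    thus ?case by (cases es) (auto simp: act_append)
  qed auto
  have b: "act r s v (map eg \<mu>) \<eta> = Some es' \<longleftrightarrow> es' = \<mu> @ \<eta>" if "rng r \<eta> v = u" for \<eta> es'
    using assms that
    by (induction \<mu> arbitrary: es') (auto simp: bind_eq_Some_conv rng_append)
  show ?thesis
    by (auto simp: sword_def act_append bind_eq_Some_conv a b split: if_splits)
qed

lemma nonneg_Reals_sum: "(\<And>i. i \<in> A \<Longrightarrow> (g i :: complex) \<in> \<real>\<^sub>\<ge>\<^sub>0) \<Longrightarrow> sum g A \<in> \<real>\<^sub>\<ge>\<^sub>0"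
  by (induction A rule: infinite_finite_induct) auto

lemma sum_rotate: "(\<Sum>a\<in>A. \<Sum>b\<in>B. \<Sum>c\<in>C. g a b c) = (\<Sum>c\<in>C. \<Sum>a\<in>A. \<Sum>b\<in>B. g a b c)"
proof -
  have "(\<Sum>a\<in>A. \<Sum>b\<in>B. \<Sum>c\<in>C. g a b c) = (\<Sum>a\<in>A. \<Sum>c\<in>C. \<Sum>b\<in>B. g a b c)"
    by (intro sum.cong refl sum.swap)
  also have "\<dots> = (\<Sum>c\<in>C. \<Sum>a\<in>A. \<Sum>b\<in>B. g a b c)" by (rule sum.swap)
  finally show ?thesis .
qed

lemma cnj_mult_self: "cnj z * z = of_real ((cmod z)\<^sup>2)"
  by (metis complex_norm_square mult.commute)

lemma letters_adj_mono: "letters (adj_mono m) = rev (map flip_letter (letters m))"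
  by (simp add: adj_mono_def)

lemma letters_plus: "letters (m + m') = letters m @ letters m'"
  by (simp add: plus_monomial_def)

lemma adj_mono_eq_0_iff: "adj_mono m = 0 \<longleftrightarrow> m = 0"
  by (metis adj_mono_0 adj_mono_invol)

text \<open>Later \<open>w e\<close> is c(e) to the power -\<beta> and \<open>t\<close> the vertex
  values of a trace; \<open>le\<close> and \<open>eq\<close> are then (K2) and (K1) at a vertex. The
  total mass is only bounded by 1 here, and norm one is recovered afterwards.\<close>

locale edge_weights =
  fixes r s :: "'e \<Rightarrow> 'v" and w :: "'e \<Rightarrow> real" and t :: "'v \<Rightarrow> real"
  assumes w_nonneg: "0 \<le> w e" and t_nonneg: "0 \<le> t v"
    and le: "finite D \<Longrightarrow> D \<subseteq> r -` {v} \<Longrightarrow> (\<Sum>e\<in>D. w e * t (s e)) \<le> t v"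
    and eq: "finite (r -` {v}) \<Longrightarrow> r -` {v} \<noteq> {} \<Longrightarrow> (\<Sum>e\<in>r -` {v}. w e * t (s e)) = t v"
    and total: "finite V \<Longrightarrow> sum t V \<le> 1"
begin

section \<open>The mass distribution on truncated paths\<close>

definition wt :: "'e list \<Rightarrow> real" where
  "wt \<mu> = prod_list (map w \<mu>)"

definition defect :: "'e set \<Rightarrow> 'v \<Rightarrow> real" where
  "defect D v = t v - (\<Sum>e\<in>{e\<in>D. r e = v}. w e * t (s e))"

text \<open>\<open>tree D n es v f\<close> integrates \<open>f\<close> over the extensions of the path \<open>es\<close> (with source \<open>v\<close>)
  by at most \<open>n\<close> edges from \<open>D\<close>: a path of full length carries the mass of its source, a
  shorter one the part of that mass not passed on to its extensions.\<close>

primrec tree :: "'e set \<Rightarrow> nat \<Rightarrow> 'e list \<Rightarrow> 'v \<Rightarrow> ('e list \<Rightarrow> 'v \<Rightarrow> complex) \<Rightarrow> complex" where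
  "tree D 0 es v f = of_real (t v) * f es v"
| "tree D (Suc n) es v f = of_real (defect D v) * f es v
     + (\<Sum>e\<in>{e\<in>D. r e = v}. of_real (w e) * tree D n (es @ [e]) (s e) f)"

lemma defect_nonneg: "finite D \<Longrightarrow> 0 \<le> defect D v"
  unfolding defect_def using le[of "{e\<in>D. r e = v}" v] by auto

lemma tree_cong:
  assumes "\<And>\<eta> v'. pth r s \<eta> v' \<Longrightarrow> rng r \<eta> v' = v \<Longrightarrow> f (es @ \<eta>) v' = g (es @ \<eta>) v'"
  shows "tree D n es v f = tree D n es v g"
  using assms
proof (induction n arbitrary: es v)
  case 0
  show ?case using 0[of "[]" v] by simp
next
  case (Suc n)
  have "tree D n (es @ [e]) (s e) f = tree D n (es @ [e]) (s e) g" if "r e = v" for e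
    by (rule Suc.IH) (use Suc.prems[of "e # \<eta>" v' for \<eta> v'] that in auto)
  thus ?case using Suc.prems[of "[]" v] by (auto intro!: sum.cong)
qed

lemma tree_0 [simp]: "tree D n es v (\<lambda>es v. 0) = 0"
  by (induction n arbitrary: es v) auto

lemma tree_add: "tree D n es v (\<lambda>es v. f es v + g es v) = tree D n es v f + tree D n es v g"
  by (induction n arbitrary: es v) (auto simp: ring_distribs sum.distrib)

lemma tree_scale: "tree D n es v (\<lambda>es v. c * f es v) = c * tree D n es v f"
  by (induction n arbitrary: es v) (auto simp: ring_distribs sum_distrib_left mult_ac)

lemma tree_nonneg:
  assumes "finite D" "\<And>es v. f es v \<in> \<real>\<^sub>\<ge>\<^sub>0"
  shows "tree D n es v f \<in> \<real>\<^sub>\<ge>\<^sub>0"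
  by (induction n arbitrary: es v)
    (auto intro!: nonneg_Reals_add_I nonneg_Reals_sum nonneg_Reals_mult_I
      simp: assms defect_nonneg t_nonneg w_nonneg)

text \<open>The masses telescope: what a path keeps and what its extensions receive add up to the
  mass of its source.\<close>

lemma tree_1: "tree D n es v (\<lambda>es v. 1) = of_real (t v)"
  by (induction n arbitrary: es v) (auto simp: defect_def simp flip: of_real_mult of_real_sum)

text \<open>The mass of the extensions of \<mu> is the same for every truncation that contains
  \<mu>. This stability is what makes the values of words eventually constant.\<close>

lemma tree_cylinder:
  assumes "pth r s \<mu> u" "set \<mu> \<subseteq> D" "finite D" "length \<mu> \<le> n"
  shows "tree D n es (rng r \<mu> u)
      (\<lambda>es' v. of_bool (\<exists>\<eta>. rng r \<eta> v = u \<and> es' = es @ \<mu> @ \<eta>)) = of_real (wt \<mu> * t u)"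
  using assms
proof (induction \<mu> arbitrary: n es)
  case Nil
  have "tree D n es u (\<lambda>es' v. of_bool (\<exists>\<eta>. rng r \<eta> v = u \<and> es' = es @ \<eta>)) = tree D n es u (\<lambda>es v. 1)"
    by (rule tree_cong) auto
  thus ?case by (simp add: tree_1 wt_def)
next
  case (Cons e \<mu>)
  then obtain m where n: "n = Suc m" by (cases n) auto
  let ?f = "\<lambda>es' v. of_bool (\<exists>\<eta>. rng r \<eta> v = u \<and> es' = es @ (e # \<mu>) @ \<eta>) :: complex"
  \<comment> \<open>Only the branch through \<open>e\<close> meets the cylinder.\<close>
  have z: "tree D m (es @ [e']) (s e') ?f = (if e' = e then of_real (wt \<mu> * t u) else 0)" for e'
  proof (cases "e' = e")
    case True
    thus ?thesis using Cons.IH[of m "es @ [e]"] Cons.prems n by simp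
  next
    case False
    have "tree D m (es @ [e']) (s e') ?f = tree D m (es @ [e']) (s e') (\<lambda>es v. 0)"
      by (rule tree_cong) (use False in auto)
    thus ?thesis using False by simp
  qed
  have "tree D n es (r e) ?f
     = (\<Sum>e'\<in>{e'\<in>D. r e' = r e}. if e' = e then of_real (w e) * of_real (wt \<mu> * t u) else 0)"
    unfolding n tree.simps z by (auto intro!: sum.cong)
  also have "\<dots> = of_real (w e) * of_real (wt \<mu> * t u)" using Cons.prems by (subst sum.delta) auto
  finally show ?case by (simp add: wt_def)
qed

text \<open>Paths short of full length carry the defect of their source, which vanishes here; a path
  of full length would carry all of \<open>t v'\<close>, hence the strict bound on the
  length.\<close>

lemma tree_supported_on_zero_defect:
  assumes "\<And>\<eta> v'. pth r s \<eta> v' \<Longrightarrow> rng r \<eta> v' = v \<Longrightarrow> f (es @ \<eta>) v' \<noteq> 0 \<Longrightarrow>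
      defect D v' = 0 \<and> length \<eta> < n"
  shows "tree D n es v f = 0"
  using assms
proof (induction n arbitrary: es v)
  case 0
  thus ?case using 0[of "[]" v] by auto
next
  case (Suc n)
  have "tree D n (es @ [e]) (s e) f = 0" if "r e = v" for e
  proof (rule Suc.IH)
    fix \<eta> v' assume "pth r s \<eta> v'" "rng r \<eta> v' = s e" "f ((es @ [e]) @ \<eta>) v' \<noteq> 0"
    thus "defect D v' = 0 \<and> length \<eta> < n" using Suc.prems[of "e # \<eta>" v'] that by simp
  qed
  thus ?case using Suc.prems[of "[]" v] by auto
qed

section \<open>Integration over truncated path space\<close>

definition forest :: "'e set \<times> 'v set \<times> nat \<Rightarrow> ('e list \<Rightarrow> 'v \<Rightarrow> complex) \<Rightarrow> complex" where
  "forest = (\<lambda>(D, V, n) f. \<Sum>v\<in>V. tree D n [] v f)"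

text \<open>Edge set, set of range vertices and depth grow independently. With a filter, the
  requirements of finitely many words can be met by one truncation.\<close>

definition truncations :: "('e set \<times> 'v set \<times> nat) filter" where
  "truncations = finite_subsets_at_top UNIV \<times>\<^sub>F finite_subsets_at_top UNIV \<times>\<^sub>F sequentially"

lemma eventually_truncations:
  assumes "finite D0" "finite V0"
  shows "\<forall>\<^sub>F x in truncations. D0 \<subseteq> fst x \<and> finite (fst x) \<and>
    V0 \<subseteq> fst (snd x) \<and> finite (fst (snd x)) \<and> n0 \<le> snd (snd x)"
proof -
  have "\<forall>\<^sub>F D in finite_subsets_at_top UNIV. D0 \<subseteq> D \<and> finite D"
    "\<forall>\<^sub>F V in finite_subsets_at_top UNIV. V0 \<subseteq> V \<and> finite V"
    using assms by (auto simp: eventually_finite_subsets_at_top)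
  from eventually_prodI[OF this(1) eventually_prodI[OF this(2) eventually_ge_at_top[of n0]]]
  show ?thesis unfolding truncations_def by (rule eventually_mono) auto
qed

lemma truncations_neq_bot: "truncations \<noteq> bot"
  by (simp add: truncations_def prod_filter_eq_bot)

lemma forest_cong: "(\<And>es v. pth r s es v \<Longrightarrow> f es v = g es v) \<Longrightarrow> forest x f = forest x g"
  unfolding forest_def by (auto split: prod.split intro!: sum.cong tree_cong)

lemma forest_add: "forest x (\<lambda>es v. f es v + g es v) = forest x f + forest x g"
  by (auto simp: forest_def tree_add sum.distrib split: prod.split)

lemma forest_scale: "forest x (\<lambda>es v. c * f es v) = c * forest x f"
  by (auto simp: forest_def tree_scale sum_distrib_left split: prod.split)

lemma forest_0: "forest x (\<lambda>es v. 0) = 0"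
  by (auto simp: forest_def split: prod.split)

lemma forest_sum: "forest x (\<lambda>es v. \<Sum>i\<in>I. f i es v) = (\<Sum>i\<in>I. forest x (f i))"
  by (induction I rule: infinite_finite_induct) (auto simp: forest_0 forest_add)

lemma forest_nonneg:
  assumes "finite (fst x)" "\<And>es v. pth r s es v \<Longrightarrow> f es v \<in> \<real>\<^sub>\<ge>\<^sub>0"
  shows "forest x f \<in> \<real>\<^sub>\<ge>\<^sub>0"
proof -
  have "forest x f = forest x (\<lambda>es v. if pth r s es v then f es v else 0)"
    by (rule forest_cong) simp
  also have "\<dots> \<in> \<real>\<^sub>\<ge>\<^sub>0" using assms
    by (auto simp: forest_def split: prod.split intro!: nonneg_Reals_sum tree_nonneg)
  finally show ?thesis .
qed

lemma forest_cylinder: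
  assumes "pth r s \<mu> u" "set \<mu> \<subseteq> fst x" "finite (fst x)" "rng r \<mu> u \<in> fst (snd x)"
    "finite (fst (snd x))" "length \<mu> \<le> snd (snd x)"
  shows "forest x (\<lambda>es v. of_bool (\<exists>\<eta>. rng r \<eta> v = u \<and> es = \<mu> @ \<eta>)) = of_real (wt \<mu> * t u)"
proof -
  obtain D V n where x: "x = (D, V, n)" by (cases x) auto
  let ?f = "\<lambda>es v. of_bool (\<exists>\<eta>. rng r \<eta> v = u \<and> es = \<mu> @ \<eta>) :: complex"
  have "tree D n [] v ?f = (if v = rng r \<mu> u then of_real (wt \<mu> * t u) else 0)" for v
  proof (cases "v = rng r \<mu> u")
    case True
    thus ?thesis using tree_cylinder[of \<mu> u D n "[]"] assms x by simp
  next
    case False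
    have "tree D n [] v ?f = tree D n [] v (\<lambda>es v. 0)"
      by (rule tree_cong) (use False in \<open>auto simp: rng_append\<close>)
    thus ?thesis using False by simp
  qed
  thus ?thesis using assms x by (simp add: forest_def)
qed

section \<open>The functional on words, from the diagonal coefficients of the path
  representation\<close>

definition fixed :: "('v + 'e) letter list \<Rightarrow> 'e list \<Rightarrow> 'v \<Rightarrow> complex" where
  "fixed ls es v = of_bool (act r s v ls es = Some es)"

text \<open>The truncated values are eventually constant rather than just convergent, so
  \<open>THE\<close> replaces a limit. The empty word is set apart: its truncated value is
  \<open>sum t V\<close>, which need not become constant, and a vector state needs the value
  1.\<close>

definition phi :: "('v + 'e) monomial \<Rightarrow> complex" where
  "phi m = (if m = 0 then 1 else THE z. \<forall>\<^sub>F x in truncations. forest x (fixed (letters m)) = z)"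

lemma phi_eqI:
  assumes "m \<noteq> 0" "\<forall>\<^sub>F x in truncations. forest x (fixed (letters m)) = z"
  shows "phi m = z"
proof -
  have "z' = z" if "\<forall>\<^sub>F x in truncations. forest x (fixed (letters m)) = z'" for z'
    using eventually_conj[OF assms(2) that] truncations_neq_bot eventually_happens'
    by (metis (mono_tags, lifting))
  from the_equality[where P = "\<lambda>z. \<forall>\<^sub>F x in truncations. forest x (fixed (letters m)) = z", OF assms(2) this]
  show ?thesis using assms(1) by (simp add: phi_def)
qed

lemma eventually_forest_cylinder:
  assumes "pth r s \<mu> u" "\<And>es v. pth r s es v \<Longrightarrow> f es v = of_bool (\<exists>\<eta>. rng r \<eta> v = u \<and> es = \<mu> @ \<eta>)"
  shows "\<forall>\<^sub>F x in truncations. forest x f = of_real (wt \<mu> * t u)"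
  using eventually_truncations[of "set \<mu>" "{rng r \<mu> u}" "length \<mu>"]
proof (rule eventually_mono[rotated, rotated])
  fix x :: "'e set \<times> 'v set \<times> nat"
  assume x: "set \<mu> \<subseteq> fst x \<and> finite (fst x) \<and> {rng r \<mu> u} \<subseteq> fst (snd x) \<and>
    finite (fst (snd x)) \<and> length \<mu> \<le> snd (snd x)"
  have "forest x f = forest x (\<lambda>es v. of_bool (\<exists>\<eta>. rng r \<eta> v = u \<and> es = \<mu> @ \<eta>))"
    by (rule forest_cong) (rule assms(2))
  also have "\<dots> = of_real (wt \<mu> * t u)" using x by (intro forest_cylinder assms(1)) auto
  finally show "forest x f = of_real (wt \<mu> * t u)" .
qed simp_all

lemma phi_sword:
  assumes "pth r s \<mu> u"
  shows "phi (Letters (sword \<mu> \<mu> u)) = of_real (wt \<mu> * t u)"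
    and "\<mu> \<noteq> \<nu> \<Longrightarrow> phi (Letters (sword \<mu> \<nu> u)) = 0"
proof -
  have n: "Letters (sword \<mu> \<nu> u) \<noteq> 0" for \<nu> by (simp add: zero_monomial_def sword_def)
  show "phi (Letters (sword \<mu> \<mu> u)) = of_real (wt \<mu> * t u)"
    by (rule phi_eqI[OF n], rule eventually_forest_cylinder[OF assms])
      (auto simp: fixed_def act_sword[OF assms])
  show "phi (Letters (sword \<mu> \<nu> u)) = 0" if "\<mu> \<noteq> \<nu>"
  proof (rule phi_eqI[OF n])
    have "fixed (sword \<mu> \<nu> u) = (\<lambda>es v. 0)" using that
      by (auto simp: fixed_def act_sword[OF assms] fun_eq_iff)
    thus "\<forall>\<^sub>F x in truncations. forest x (fixed (letters (Letters (sword \<mu> \<nu> u)))) = 0"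
      by (simp add: forest_0)
  qed
qed

text \<open>A word in normal form fixes paths only if \<mu> = \<nu>, and then exactly those
  beginning with \<mu> followed by a path with range u; the mass of this cylinder is stable.\<close>

lemma eventually_forest_fixed:
  assumes "m \<noteq> 0"
  shows "\<forall>\<^sub>F x in truncations. forest x (fixed (letters m)) = phi m"
proof -
  have "letters m \<noteq> []" using assms by (cases m) (simp add: zero_monomial_def)
  from act_reduction[OF this, of r s]
  have "\<exists>z. \<forall>\<^sub>F x in truncations. forest x (fixed (letters m)) = z"
  proof (elim disjE exE conjE)
    assume n: "\<forall>v es. pth r s es v \<longrightarrow> act r s v (letters m) es = None"
    have "forest x (fixed (letters m)) = forest x (\<lambda>es v. 0)" for x
      by (rule forest_cong) (use n in \<open>auto simp: fixed_def\<close>)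
    thus ?thesis by (intro exI[of _ 0]) (simp add: forest_0)
  next
    fix \<mu> \<nu> u
    assume p: "pth r s \<mu> u" and a: "\<forall>v es es'. pth r s es v \<longrightarrow>
      act r s v (letters m) es = Some es' \<longleftrightarrow> shift r s \<mu> \<nu> u v es es'"
    show ?thesis
    proof (cases "\<mu> = \<nu>")
      case True
      show ?thesis
        by (intro exI, rule eventually_forest_cylinder[OF p])
          (use a True in \<open>auto simp: fixed_def shift_def pth_append\<close>)
    next
      case False
      have "forest x (fixed (letters m)) = forest x (\<lambda>es v. 0)" for x
        by (rule forest_cong) (use a False in \<open>auto simp: fixed_def shift_def\<close>)
      thus ?thesis by (intro exI[of _ 0]) (simp add: forest_0)
    qed
  qed
  thus ?thesis using phi_eqI[OF assms] by metis
qed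

text \<open>The mass outside \<open>V\<close> goes to the character that sees only the constant
  term. It is nonnegative by \<open>total\<close> and corrects the value at the empty word.\<close>

lemma eventually_phi:
  assumes "finite M"
  shows "\<forall>\<^sub>F x in truncations. \<forall>m\<in>M.
    phi m = forest x (fixed (letters m)) + of_real (1 - sum t (fst (snd x))) * of_bool (m = 0)"
proof (rule eventually_ball_finite[OF assms], rule ballI)
  fix m
  show "\<forall>\<^sub>F x in truncations.
    phi m = forest x (fixed (letters m)) + of_real (1 - sum t (fst (snd x))) * of_bool (m = 0)"
  proof (cases "m = 0")
    case True
    have "fixed [] = (\<lambda>es v. 1)" by (simp add: fixed_def fun_eq_iff)
    hence "forest x (fixed []) = of_real (sum t (fst (snd x)))" for x
      by (simp add: forest_def tree_1 split: prod.split)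
    thus ?thesis using True by (simp add: phi_def zero_monomial_def)
  next
    case False
    thus ?thesis using eventually_forest_fixed[OF False] by (auto elim: eventually_mono)
  qed
qed

lemma phi_as_forest:
  assumes "finite M" "finite D0"
  obtains x where "\<forall>m\<in>M.
      phi m = forest x (fixed (letters m)) + of_real (1 - sum t (fst (snd x))) * of_bool (m = 0)"
    "D0 \<subseteq> fst x" "finite (fst x)" "finite (fst (snd x))" "n0 \<le> snd (snd x)"
proof -
  obtain x where "(\<forall>m\<in>M. phi m = forest x (fixed (letters m))
        + of_real (1 - sum t (fst (snd x))) * of_bool (m = 0)) \<and>
      (D0 \<subseteq> fst x \<and> finite (fst x) \<and> {} \<subseteq> fst (snd x) \<and> finite (fst (snd x)) \<and> n0 \<le> snd (snd x))"
    using eventually_happens'[OF truncations_neq_bot eventually_conj[OF eventually_phi[OF assms(1)]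
        eventually_truncations[OF assms(2) finite.emptyI]]] by blast
  with that show ?thesis by blast
qed

lemma phi_cong:
  assumes "m \<noteq> 0" "m' \<noteq> 0"
    "\<And>es v. pth r s es v \<Longrightarrow> act r s v (letters m) es = Some es \<longleftrightarrow> act r s v (letters m') es = Some es"
  shows "phi m = phi m'"
proof (rule phi_eqI[OF assms(1)], rule eventually_mono[OF eventually_forest_fixed[OF assms(2)]])
  fix x assume "forest x (fixed (letters m')) = phi m'"
  moreover have "forest x (fixed (letters m)) = forest x (fixed (letters m'))"
    by (rule forest_cong) (simp add: fixed_def assms(3))
  ultimately show "forest x (fixed (letters m)) = phi m'" by simp
qed

text \<open>A word and its adjoint fix the same paths, and the common value is real, being a
  nonnegative integral of an indicator.\<close>

lemma phi_adj: "phi (adj_mono m) = cnj (phi m)"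
proof (cases "m = 0")
  case False
  have "phi (adj_mono m) = phi m"
    by (rule phi_cong) (use False in \<open>auto simp: adj_mono_eq_0_iff letters_adj_mono act_flip\<close>)
  moreover have "phi m \<in> \<real>\<^sub>\<ge>\<^sub>0"
  proof -
    have "finite {m}" by simp
    from phi_as_forest[OF this finite.emptyI, of 0] obtain x where
      x: "\<forall>m'\<in>{m}. phi m' = forest x (fixed (letters m'))
        + of_real (1 - sum t (fst (snd x))) * of_bool (m' = 0)"
      "{} \<subseteq> fst x" "finite (fst x)" "finite (fst (snd x))" "0 \<le> snd (snd x)" by blast
    hence "forest x (fixed (letters m)) = phi m" using False by simp
    thus ?thesis using x(3) forest_nonneg[of x "fixed (letters m)"] by (auto simp: fixed_def)
  qed
  ultimately show ?thesis by (auto simp: complex_nonneg_Reals_iff complex_eq_iff)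
qed (simp add: phi_def)

text \<open>One truncation serves all words of \<open>adj_poly y * y\<close>. The integrand at a
  path \<open>es\<close> is the squared length of \<open>y\<close> applied to the basis vector of
  \<open>es\<close>; the leftover mass multiplies the squared modulus of the constant term.\<close>

lemma phi_pos: "lin phi (adj_poly y * y) \<in> \<real>\<^sub>\<ge>\<^sub>0"
proof -
  let ?K = "Poly_Mapping.keys y" and ?y = "Poly_Mapping.lookup y"
  have e: "lin phi (adj_poly y * y)
      = (\<Sum>a\<in>?K. \<Sum>b\<in>?K. (cnj (?y a) * ?y b) * phi (adj_mono a + b))"
    by (simp add: lin_mult lin_adj) (simp add: lin_def sum_distrib_left mult_ac)
  have "finite ((\<lambda>(a, b). adj_mono a + b) ` (?K \<times> ?K))" by simp
  from phi_as_forest[OF this finite.emptyI, of 0]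
  obtain x where x: "\<forall>m\<in>(\<lambda>(a, b). adj_mono a + b) ` (?K \<times> ?K).
     phi m = forest x (fixed (letters m)) + of_real (1 - sum t (fst (snd x))) * of_bool (m = 0)"
    "{} \<subseteq> fst x" "finite (fst x)" "finite (fst (snd x))" "0 \<le> snd (snd x)" by blast
  define rho where "rho = 1 - sum t (fst (snd x))"
  have rho: "0 \<le> rho" using total[OF x(4)] by (simp add: rho_def)
  let ?f = "\<lambda>es v. \<Sum>a\<in>?K. \<Sum>b\<in>?K. (cnj (?y a) * ?y b) * fixed (letters (adj_mono a + b)) es v"
  have "lin phi (adj_poly y * y) = (\<Sum>a\<in>?K. \<Sum>b\<in>?K. (cnj (?y a) * ?y b) *
      (forest x (fixed (letters (adj_mono a + b))) + of_real rho * of_bool (adj_mono a + b = 0)))"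
    unfolding e rho_def by (intro sum.cong refl) (subst bspec[OF x(1)], auto)
  also have "\<dots> = forest x ?f + of_real rho *
      (\<Sum>a\<in>?K. \<Sum>b\<in>?K. (cnj (?y a) * ?y b) * of_bool (a = 0 \<and> b = 0))"
    by (simp add: forest_sum forest_scale ring_distribs sum.distrib sum_distrib_left
        monomial_add_0_iff adj_mono_eq_0_iff mult_ac)
  also have "(\<Sum>a\<in>?K. \<Sum>b\<in>?K. (cnj (?y a) * ?y b) * of_bool (a = 0 \<and> b = 0))
      = (\<Sum>a\<in>?K. cnj (?y a) * of_bool (a = 0)) * (\<Sum>b\<in>?K. ?y b * of_bool (b = 0))"
    unfolding sum_product by (intro sum.cong refl) (simp only: of_bool_conj mult_ac)
  also have "\<dots> = of_real ((cmod (\<Sum>b\<in>?K. ?y b * of_bool (b = 0)))\<^sup>2)"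
  proof -
    have c: "(\<Sum>a\<in>?K. cnj (?y a) * of_bool (a = 0)) = cnj (\<Sum>b\<in>?K. ?y b * of_bool (b = 0))" by simp
    show ?thesis unfolding c by (rule cnj_mult_self)
  qed
  finally have fin: "lin phi (adj_poly y * y) = forest x ?f
    + of_real (rho * (cmod (\<Sum>b\<in>?K. ?y b * of_bool (b = 0)))\<^sup>2)" by simp
  have "forest x ?f \<in> \<real>\<^sub>\<ge>\<^sub>0"
  proof (rule forest_nonneg[OF x(3)])
    fix es v assume p: "pth r s es v"
    define A where "A m = act r s v (letters m) es" for m
    \<comment> \<open>The finitely many images of \<open>es\<close> under words of \<open>y\<close>;
      below, \<open>B es'\<close> is the coefficient of \<open>es'\<close> in \<open>y\<close>
      applied to \<open>es\<close>.\<close>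
    define E where "E = (\<Union>m\<in>?K. set_option (A m))"
    have fE: "finite E" by (simp add: E_def)
    define B where "B es' = (\<Sum>b\<in>?K. ?y b * of_bool (A b = Some es'))" for es'
    \<comment> \<open>The diagonal coefficient of a^* b is the inner product of the images of
      \<open>es\<close> under a and b.\<close>
    have fx: "fixed (letters (adj_mono a + b)) es v
        = (\<Sum>es'\<in>E. of_bool (A a = Some es') * of_bool (A b = Some es'))" if "a \<in> ?K" "b \<in> ?K" for a b
    proof (cases "A b")
      case None
      thus ?thesis by (simp add: fixed_def letters_plus act_append A_def)
    next
      case (Some es1)
      have p1: "pth r s es1 v" using act_pth[OF Some[unfolded A_def] p] .
      have "fixed (letters (adj_mono a + b)) es v = of_bool (A a = Some es1)"
        using Some act_flip[OF p p1, of "letters a"]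
        by (simp add: fixed_def letters_plus act_append A_def letters_adj_mono)
      also have "\<dots> = (\<Sum>es'\<in>E. if es' = es1 then of_bool (A a = Some es1) else 0)"
        using fE Some that by (subst sum.delta) (auto simp: E_def intro!: bexI[of _ b])
      also have "\<dots> = (\<Sum>es'\<in>E. of_bool (A a = Some es') * of_bool (A b = Some es'))"
        using Some by (intro sum.cong) auto
      finally show ?thesis .
    qed
    have "?f es v = (\<Sum>a\<in>?K. \<Sum>b\<in>?K. (cnj (?y a) * ?y b) *
        (\<Sum>es'\<in>E. of_bool (A a = Some es') * of_bool (A b = Some es')))"
      by (intro sum.cong refl) (simp add: fx)
    also have "\<dots> = (\<Sum>es'\<in>E. \<Sum>a\<in>?K. \<Sum>b\<in>?K.
        (cnj (?y a) * of_bool (A a = Some es')) * (?y b * of_bool (A b = Some es')))"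
      unfolding sum_distrib_left sum_rotate[of _ E] by (intro sum.cong refl) (simp only: mult_ac)
    also have "\<dots> = (\<Sum>es'\<in>E. of_real ((cmod (B es'))\<^sup>2))"
    proof (intro sum.cong refl)
      fix es'
      have "(\<Sum>a\<in>?K. cnj (?y a) * of_bool (A a = Some es')) = cnj (B es')" by (simp add: B_def)
      moreover have "(\<Sum>a\<in>?K. \<Sum>b\<in>?K. (cnj (?y a) * of_bool (A a = Some es')) * (?y b * of_bool (A b = Some es')))
         = (\<Sum>a\<in>?K. cnj (?y a) * of_bool (A a = Some es')) * B es'"
        unfolding B_def sum_product ..
      ultimately show "(\<Sum>a\<in>?K. \<Sum>b\<in>?K. (cnj (?y a) * of_bool (A a = Some es')) * (?y b * of_bool (A b = Some es')))
          = of_real ((cmod (B es'))\<^sup>2)" by (simp only: cnj_mult_self)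
    qed
    also have "\<dots> \<in> \<real>\<^sub>\<ge>\<^sub>0" by (intro nonneg_Reals_sum) simp
    finally show "?f es v \<in> \<real>\<^sub>\<ge>\<^sub>0" .
  qed
  thus ?thesis unfolding fin using rho by (intro nonneg_Reals_add_I) auto
qed

section \<open>The relations are annihilated\<close>

lemma lin_phi_mon: "lin phi (mon a) = phi (Letters a)"
  by simp

lemma lin_phi_kills:
  assumes "\<And>a b. lin phi (mon a * d * mon b) = 0"
  shows "lin phi (x * d * y) = 0"
proof (induction x rule: star_poly_induct)
  case (2 m z)
  show ?case
  proof (induction y rule: star_poly_induct)
    case (2 m' z')
    have "Poly_Mapping.single m z * d * Poly_Mapping.single m' z'
        = scale_poly z' (scale_poly z (mon (letters m) * d * mon (letters m')))"
    proof -
      have 1: "Poly_Mapping.single m z = scale_poly z (mon (letters m))" for m :: "('v + 'e) monomial" and z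
        by (simp add: scale_poly_def mult_single)
      show ?thesis unfolding 1[of m] 1[of m'] by (simp add: mult.assoc flip: scale_poly_left scale_poly_right)
    qed
    thus ?case using assms by (simp only: lin_scale) simp
  qed (simp_all add: ring_distribs lin_add)
qed (simp_all add: ring_distribs lin_add)

text \<open>\<open>phi\<close> sees a word only through its action, so any relation that holds in
  the path representation is killed without computing a value.\<close>

lemma phi_act_cong:
  assumes "a \<noteq> []" "b \<noteq> []" "\<And>es v. pth r s es v \<Longrightarrow> act r s v a es = act r s v b es"
  shows "lin phi (mon u * mon a * mon u') = lin phi (mon u * mon b * mon u')"
proof -
  have "act r s v (u @ a @ u') es = act r s v (u @ b @ u') es" if "pth r s es v" for es v
    using assms(3) act_pth[OF _ that] by (cases "act r s v u' es") (auto simp: act_append)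
  thus ?thesis unfolding mon_mult lin_phi_mon
    using assms by (intro phi_cong) (auto simp: zero_monomial_def)
qed

lemma phi_act_zero:
  assumes "a \<noteq> []" "\<And>es v. pth r s es v \<Longrightarrow> act r s v a es = None"
  shows "lin phi (mon u * mon a * mon u') = 0"
proof -
  have "act r s v (u @ a @ u') es = None" if "pth r s es v" for es v
    using assms(2) act_pth[OF _ that] by (cases "act r s v u' es") (auto simp: act_append)
  hence "forest x (fixed (u @ a @ u')) = forest x (\<lambda>es v. 0)" for x
    by (intro forest_cong) (simp add: fixed_def)
  thus ?thesis unfolding mon_mult lin_phi_mon
    using assms(1) by (intro phi_eqI) (simp_all add: zero_monomial_def forest_0)
qed

lemma phi_act_cong':
  assumes "a \<noteq> []" "b \<noteq> []" "\<And>es v. pth r s es v \<Longrightarrow> act r s v a es = act r s v b es"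
  shows "lin phi (x * mon a * y) = lin phi (x * mon b * y)"
proof -
  have "lin phi (x * (mon a - mon b) * y) = 0"
    by (rule lin_phi_kills)
      (simp only: right_diff_distrib left_diff_distrib lin_diff phi_act_cong[OF assms] diff_self)
  thus ?thesis by (simp only: right_diff_distrib left_diff_distrib lin_diff right_minus_eq)
qed

text \<open>The word \<open>?h\<close> acts as a projection h, so positivity at y - h y bounds the
  value of y^* h y by that of y^* y.\<close>

lemma phi_letter_le:
  "Re (lin phi (adj_poly (mon [l] * y) * (mon [l] * y))) \<le> Re (lin phi (adj_poly y * y))"
proof -
  let ?h = "[flip_letter l, l]"
  have fl: "flip_letter (flip_letter l) = l" by (cases l) auto
  have act: "act r s v (?h @ ?h) es = act r s v ?h es" if "pth r s es v" for es v
  proof (cases "act1 r s v l es")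
    case (Some es1)
    hence "act1 r s v (flip_letter l) es1 = Some es" using act1_flip[OF that act1_pth[OF Some that]] by simp
    thus ?thesis using Some by simp
  qed simp
  have z: "adj_poly (y - mon ?h * y) * (y - mon ?h * y) =
     adj_poly y * y - adj_poly y * mon ?h * y - adj_poly y * mon ?h * y + adj_poly y * mon (?h @ ?h) * y"
    by (simp add: adj_poly_diff adj_poly_mult fl ring_distribs mult.assoc mon_mult)
      (simp add: mon_mult flip: mult.assoc)
  have "lin phi (adj_poly y * mon (?h @ ?h) * y) = lin phi (adj_poly y * mon ?h * y)"
    by (rule phi_act_cong') (simp_all only: act, simp_all)
  hence "lin phi (adj_poly (y - mon ?h * y) * (y - mon ?h * y))
      = lin phi (adj_poly y * y) - lin phi (adj_poly y * mon ?h * y)"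
    unfolding z by (simp only: lin_add lin_diff) simp
  moreover have "adj_poly (mon [l] * y) * (mon [l] * y) = adj_poly y * mon ?h * y"
    by (simp add: adj_poly_mult mult.assoc) (simp add: mon_mult flip: mult.assoc)
  ultimately show ?thesis using phi_pos[of "y - mon ?h * y"] by (simp add: complex_nonneg_Reals_iff)
qed

text \<open>This is the relation the path representation violates. The two sides differ only on
  paths that \<open>b\<close> erases completely and whose source is the regular vertex
  \<open>v\<close>; by (K1) these carry no mass.\<close>

lemma phi_vertex_sum:
  assumes "finite (r -` {v})" "r -` {v} \<noteq> {}"
  shows "phi (Letters (a @ [vg v] @ b)) = (\<Sum>e\<in>r -` {v}. phi (Letters (a @ [eg e, ea e] @ b)))"
proof -
  let ?M = "insert (Letters (a @ [vg v] @ b)) ((\<lambda>e. Letters (a @ [eg e, ea e] @ b)) ` (r -` {v}))"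
  have "finite ?M" using assms by simp
  \<comment> \<open>The truncation contains all edges with range \<open>v\<close>, which makes the
    defect at \<open>v\<close> zero, and is deeper than the at most \<open>length b\<close> edges
    that \<open>b\<close> can erase.\<close>
  from phi_as_forest[OF this assms(1), of "Suc (length b)"]
  obtain x where x: "\<forall>m\<in>?M.
     phi m = forest x (fixed (letters m)) + of_real (1 - sum t (fst (snd x))) * of_bool (m = 0)"
    "r -` {v} \<subseteq> fst x" "finite (fst x)" "finite (fst (snd x))" "Suc (length b) \<le> snd (snd x)" by blast
  let ?f = "\<lambda>es v'. fixed (a @ [vg v] @ b) es v' + - 1 * (\<Sum>e\<in>r -` {v}. fixed (a @ [eg e, ea e] @ b) es v')"
  have f: "act r s v' b es = Some [] \<and> v' = v" if p: "pth r s es v'" and n: "?f es v' \<noteq> 0" for es v'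
  proof (cases "act r s v' b es")
    case None
    with n show ?thesis by (simp add: fixed_def act_append)
  next
    case (Some es1)
    show ?thesis
    proof (cases es1)
      case Nil
      with n Some show ?thesis by (auto simp: fixed_def act_append split: if_splits)
    next
      case (Cons e es2)
      have "pth r s es1 v'" by (rule act_pth[OF Some p])
      hence "fixed (a @ [eg e', ea e'] @ b) es v' = (if e' = e then of_bool (act r s v' a es1 = Some es) else 0)" for e'
        using Some Cons by (auto simp: fixed_def act_append)
      hence "(\<Sum>e\<in>r -` {v}. fixed (a @ [eg e, ea e] @ b) es v')
          = of_bool (r e = v \<and> act r s v' a es1 = Some es)"
        using assms(1) by simp
      moreover have "fixed (a @ [vg v] @ b) es v' = of_bool (r e = v \<and> act r s v' a es1 = Some es)"
        using Some Cons by (auto simp: fixed_def act_append)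
      ultimately have False using n by simp
      thus ?thesis ..
    qed
  qed
  have "{e \<in> fst x. r e = v} = r -` {v}" using x(2) by auto
  hence d: "defect (fst x) v = 0" by (simp add: defect_def eq[OF assms])
  have "tree (fst x) (snd (snd x)) [] v' ?f = 0" for v'
  proof (rule tree_supported_on_zero_defect)
    fix \<eta> u assume "pth r s \<eta> u" "?f ([] @ \<eta>) u \<noteq> 0"
    hence "act r s u b \<eta> = Some []" "u = v" using f by auto
    thus "defect (fst x) u = 0 \<and> length \<eta> < snd (snd x)" using d act_length[of r s u b \<eta> "[]"] x(5) by auto
  qed
  hence "forest x ?f = 0" unfolding forest_def split_def by (intro sum.neutral ballI)
  hence "forest x (fixed (a @ [vg v] @ b)) + - 1 * (\<Sum>e\<in>r -` {v}. forest x (fixed (a @ [eg e, ea e] @ b))) = 0"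
    by (simp only: forest_add forest_scale forest_sum)
  thus ?thesis using x(1) by (simp add: zero_monomial_def)
qed

lemma phi_kills_rels:
  assumes "d \<in> graph_rels r s"
  shows "lin phi (x * d * y) = 0"
proof (rule lin_phi_kills)
  fix a b
  note zero = phi_act_zero[of _ a b] and cong = phi_act_cong[of _ _ a b]
  have diff: "lin phi (mon a * (mon u - mon u') * mon b) = 0"
    if "u \<noteq> []" "u' \<noteq> []" "\<And>es v. pth r s es v \<Longrightarrow> act r s v u es = act r s v u' es" for u u'
    by (simp only: right_diff_distrib left_diff_distrib lin_diff cong[OF that] diff_self)
  show "lin phi (mon a * d * mon b) = 0" using assms
  proof cases
    case (vertex_adj v) show ?thesis unfolding vertex_adj by (rule diff) auto
  next
    case (vertex_idem v) show ?thesis unfolding vertex_idem by (rule diff) auto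
  next
    case (vertex_orth v v') show ?thesis unfolding vertex_orth(1) by (rule zero) (use vertex_orth(2) in auto)
  next
    case (edge_isometry e) show ?thesis unfolding edge_isometry by (rule diff) auto
  next
    case (edge_orth e f)
    have "act r s v [eg e, ea e, eg f, ea f] es = None" if "pth r s es v" for es v
      using edge_orth(2) that by (cases es) auto
    thus ?thesis unfolding edge_orth(1) by (intro zero) auto
  next
    case (edge_source e) show ?thesis unfolding edge_source by (rule diff) auto
  next
    case (edge_idem e)
    have "act r s v [eg e, ea e, eg e, ea e] es = act r s v [eg e, ea e] es" if "pth r s es v" for es v
      using that by (cases es) auto
    thus ?thesis unfolding edge_idem by (intro diff) auto
  next
    case (edge_range e)
    have "act r s v [eg e, ea e, vg (r e)] es = act r s v [eg e, ea e] es" if "pth r s es v" for es v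
      using that by (cases es) auto
    thus ?thesis unfolding edge_range by (intro diff) auto
  next
    case (vertex_sum v)
    have "lin phi (mon a * d * mon b) = phi (Letters (a @ [vg v] @ b))
        - (\<Sum>e\<in>r -` {v}. phi (Letters (a @ [eg e, ea e] @ b)))"
      unfolding vertex_sum(1) right_diff_distrib left_diff_distrib sum_distrib_left sum_distrib_right lin_diff lin_sum
      by (simp add: mon_mult)
    thus ?thesis by (simp only: phi_vertex_sum[OF vertex_sum(2,3)] diff_self)
  qed
qed

sublocale gns phi
proof
  show "Re (lin phi (adj_poly (Poly_Mapping.single (Letters [l]) 1 * y) * (Poly_Mapping.single (Letters [l]) 1 * y)))
      \<le> Re (lin phi (adj_poly y * y))" for l y by (rule phi_letter_le)
qed (simp_all add: phi_pos phi_adj, simp add: phi_def)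

theorem phi_le_graph_seminorm:
  assumes "x \<in> free_star_algebra"
  shows "cmod (lin phi x) \<le> graph_seminorm r s x"
proof -
  have "op_norm \<in> graph_seminorms r s"
    by (simp add: graph_seminorms_def op_norm_cstar_seminorm op_norm_zeroI phi_kills_rels)
  from graph_seminorm_upper[OF this assms] show ?thesis using lin_le_op_norm[of x] by simp
qed

end

section \<open>Gauge action and core\<close>

context free_cstar_seminorm
begin

lemma carrierE:
  assumes "a \<in> carrier A"
  obtains X where "X \<in> C" "a = cl X"
  using assms by (auto simp: carrier_A)

lemma closed:
  "a \<in> carrier A \<Longrightarrow> b \<in> carrier A \<Longrightarrow> a \<oplus>\<^bsub>A\<^esub> b \<in> carrier A"
  "a \<in> carrier A \<Longrightarrow> b \<in> carrier A \<Longrightarrow> a \<otimes>\<^bsub>A\<^esub> b \<in> carrier A"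
  "a \<in> carrier A \<Longrightarrow> b \<in> carrier A \<Longrightarrow> a \<ominus>\<^bsub>A\<^esub> b \<in> carrier A"
  "a \<in> carrier A \<Longrightarrow> z \<cdot>\<^bsub>A\<^esub> a \<in> carrier A"
  "a \<in> carrier A \<Longrightarrow> adj A a \<in> carrier A"
  "\<zero>\<^bsub>A\<^esub> \<in> carrier A"
  by (auto simp: carrier_A add_cl mult_cl diff_cl scale_cl adj_cl C_add C_mult C_diff C_scale C_adj zero_A)

lemma diff_scale:
  assumes "a \<in> carrier A" "b \<in> carrier A"
  shows "a \<ominus>\<^bsub>A\<^esub> b = a \<oplus>\<^bsub>A\<^esub> (-1) \<cdot>\<^bsub>A\<^esub> b"
proof -
  obtain X Y where "X \<in> C" "a = cl X" "Y \<in> C" "b = cl Y" using assms by (auto elim!: carrierE)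
  thus ?thesis using C_uminus[of Y] by (simp add: diff_cl scale_cl add_cl scale_poly_uminus1)
qed

lemma dist_triangle:
  assumes "a \<in> carrier A" "b \<in> carrier A" "d \<in> carrier A"
  shows "cnorm A (a \<ominus>\<^bsub>A\<^esub> d) \<le> cnorm A (a \<ominus>\<^bsub>A\<^esub> b) + cnorm A (b \<ominus>\<^bsub>A\<^esub> d)"
proof -
  obtain X Y Z where X: "X \<in> C" "a = cl X" "Y \<in> C" "b = cl Y" "Z \<in> C" "d = cl Z"
    using assms by (auto elim!: carrierE)
  have "cl (\<lambda>n. X n - Z n) = cl (\<lambda>n. X n - Y n) \<oplus>\<^bsub>A\<^esub> cl (\<lambda>n. Y n - Z n)"
    using X by (simp add: add_cl C_diff)
  thus ?thesis using X norm_add[OF C_diff[OF X(1,3)] C_diff[OF X(3,5)]] by (simp add: diff_cl)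
qed

lemma dist_commute:
  assumes "a \<in> carrier A" "b \<in> carrier A"
  shows "cnorm A (a \<ominus>\<^bsub>A\<^esub> b) = cnorm A (b \<ominus>\<^bsub>A\<^esub> a)"
proof -
  obtain X Y where X: "X \<in> C" "a = cl X" "Y \<in> C" "b = cl Y" using assms by (auto elim!: carrierE)
  have "cl (\<lambda>n. Y n - X n) = (-1) \<cdot>\<^bsub>A\<^esub> cl (\<lambda>n. X n - Y n)"
    using X by (simp add: scale_cl C_diff scale_poly_uminus1)
  thus ?thesis using X norm_scale[OF C_diff[OF X(1,3)], of "-1"] by (simp add: diff_cl)
qed

lemma cnorm_nonneg: "a \<in> carrier A \<Longrightarrow> 0 \<le> cnorm A a"
  by (auto elim!: carrierE simp: norm_nonneg)

lemma dist_eq_0: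
  assumes "a \<in> carrier A" "b \<in> carrier A" "cnorm A (a \<ominus>\<^bsub>A\<^esub> b) \<le> 0"
  shows "a = b"
proof -
  obtain X Y where X: "X \<in> C" "a = cl X" "Y \<in> C" "b = cl Y" using assms by (auto elim!: carrierE)
  have "(\<lambda>n. q (X n - Y n)) \<longlonglongrightarrow> 0"
    using norm_cl[OF C_diff[OF X(1,3)]] assms(3) cnorm_nonneg[OF closed(3)[OF assms(1,2)]] X
    by (simp add: diff_cl)
  thus ?thesis using X by (simp add: cl_eq_iff eqv_def)
qed

lemma cl_limit:
  assumes "X \<in> C"
  shows "(\<lambda>n. cnorm A (cl X \<ominus>\<^bsub>A\<^esub> em (X n))) \<longlonglongrightarrow> 0"
proof (rule LIMSEQ_I)
  fix \<epsilon> :: real assume e: "\<epsilon> > 0"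
  obtain N where N: "\<forall>m\<ge>N. \<forall>n\<ge>N. q (X m - X n) < \<epsilon>/2" using CD[OF assms, of "\<epsilon>/2"] e by auto
  have "norm (cnorm A (cl X \<ominus>\<^bsub>A\<^esub> em (X n)) - 0) < \<epsilon>" if "n \<ge> N" for n
  proof -
    have F: "X n \<in> free_star_algebra" using C_F0 assms by auto
    have "cnorm A (cl (\<lambda>k. X k - X n)) \<le> \<epsilon>/2"
      by (rule LIMSEQ_le_const2[OF norm_cl]) (use N that assms F in \<open>auto intro!: C_diff exI[of _ N] less_imp_le\<close>)
    thus ?thesis using assms F e norm_nonneg[OF C_diff[OF assms C_const[OF F]]] by (simp add: em_def diff_cl)
  qed
  thus "\<exists>N. \<forall>n\<ge>N. norm (cnorm A (cl X \<ominus>\<^bsub>A\<^esub> em (X n)) - 0) < \<epsilon>" by blast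
qed

lemma star_hom_diff:
  assumes "star_hom A A \<gamma>" "a \<in> carrier A" "b \<in> carrier A"
  shows "\<gamma> (a \<ominus>\<^bsub>A\<^esub> b) = \<gamma> a \<ominus>\<^bsub>A\<^esub> \<gamma> b"
  using assms diff_scale[OF assms(2,3)] diff_scale[of "\<gamma> a" "\<gamma> b"] closed(4)[OF assms(3)]
  by (simp add: star_hom_def)

end

definition letter_factor :: "complex \<Rightarrow> ('v + 'e) letter \<Rightarrow> complex" where
  "letter_factor z l = (case l of Gen (Inr e) \<Rightarrow> z | Adj (Inr e) \<Rightarrow> cnj z | _ \<Rightarrow> 1)"

definition letter_degree :: "('v + 'e) letter \<Rightarrow> int" where
  "letter_degree l = (case l of Gen (Inr e) \<Rightarrow> 1 | Adj (Inr e) \<Rightarrow> - 1 | _ \<Rightarrow> 0)"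

definition twist_factor :: "complex \<Rightarrow> ('v + 'e) monomial \<Rightarrow> complex" where
  "twist_factor z m = prod_list (map (letter_factor z) (letters m))"

definition word_degree :: "('v + 'e) monomial \<Rightarrow> int" where
  "word_degree m = sum_list (map letter_degree (letters m))"

lemma letter_factor_simps [simp]:
  "letter_factor z (vg v) = 1" "letter_factor z (va v) = 1"
  "letter_factor z (eg e) = z" "letter_factor z (ea e) = cnj z"
  by (simp_all add: letter_factor_def)

lemma twist_factor_cis: "twist_factor (cis a) m = cis (of_int (word_degree m) * a)"
proof -
  have "prod_list (map (letter_factor (cis a)) ls) = cis (of_int (sum_list (map letter_degree ls)) * a)"
    for ls :: "('v + 'e) letter list"
    by (induction ls) (auto simp: letter_factor_def letter_degree_def cis_mult cis_cnj ring_distribs split: letter.split sum.split)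
  thus ?thesis by (simp add: twist_factor_def word_degree_def)
qed

lemma twist_factor_degree_0:
  assumes "word_degree m = 0" "cmod z = 1"
  shows "twist_factor z m = 1"
proof -
  have "z = cis (Arg z)" using assms(2) by (metis cis_Arg norm_zero sgn_eq div_by_1 of_real_1 zero_neq_one)
  thus ?thesis using twist_factor_cis[of "Arg z" m] assms(1) by simp
qed

lemma twist_factor_plus: "twist_factor z (m + m') = twist_factor z m * twist_factor z m'"
  by (simp add: twist_factor_def plus_monomial_def)

text \<open>Adjoint edges receive \<open>cnj z\<close> instead of the inverse of \<open>z\<close>,
  which makes twisting commute with the adjoint for every \<open>z\<close>.\<close>

lemma twist_factor_adj: "twist_factor z (adj_mono m) = cnj (twist_factor z m)"
proof -
  have "letter_factor z (flip_letter l) = cnj (letter_factor z l)" for l :: "('v + 'e) letter"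
    by (auto simp: letter_factor_def split: letter.split sum.split)
  note l = this
  have "prod_list (map (letter_factor z) (rev (map flip_letter ls))) = cnj (prod_list (map (letter_factor z) ls))"
    for ls :: "('v + 'e) letter list"
    by (induction ls) (auto simp: l mult.commute)
  thus ?thesis by (simp add: twist_factor_def adj_mono_def)
qed

definition twist :: "complex \<Rightarrow> ('v + 'e) star_poly \<Rightarrow> ('v + 'e) star_poly" where
  "twist z x = Poly_Mapping.mapp (\<lambda>m c. twist_factor z m * c) x"

lemma lookup_twist [simp]: "Poly_Mapping.lookup (twist z x) m = twist_factor z m * Poly_Mapping.lookup x m"
  by (auto simp: twist_def lookup_mapp when_def in_keys_iff)

lemma twist_add: "twist z (x + y) = twist z x + twist z y"
  by (rule poly_mapping_eqI) (simp add: lookup_add ring_distribs)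

lemma twist_diff: "twist z (x - y) = twist z x - twist z y"
  by (rule poly_mapping_eqI) (simp add: lookup_minus ring_distribs)

lemma twist_0 [simp]: "twist z 0 = 0"
  by (rule poly_mapping_eqI) simp

lemma twist_scale: "twist z (scale_poly c x) = scale_poly c (twist z x)"
  by (rule poly_mapping_eqI) simp

lemma twist_single: "twist z (Poly_Mapping.single m c) = Poly_Mapping.single m (twist_factor z m * c)"
  by (rule poly_mapping_eqI) (simp add: lookup_single when_def)

lemma twist_sum: "twist z (sum f D) = (\<Sum>i\<in>D. twist z (f i))"
  by (induction D rule: infinite_finite_induct) (simp_all add: twist_add)

lemma twist_mult: "twist z (x * y) = twist z x * twist z y"
proof (induction x rule: star_poly_induct)
  case (2 m c)
  show ?case
    by (induction y rule: star_poly_induct)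
      (simp_all add: mult_single twist_single twist_add twist_factor_plus ring_distribs mult_ac)
qed (simp_all add: twist_add ring_distribs)

lemma twist_adj: "twist z (adj_poly x) = adj_poly (twist z x)"
  by (rule poly_mapping_eqI) (simp add: twist_factor_adj)

lemma twist_free [simp]: "x \<in> free_star_algebra \<Longrightarrow> twist z x \<in> free_star_algebra"
  by (simp add: free_star_algebra_def)

text \<open>Each relation is homogeneous: all its words have the same degree, so twisting multiplies
  it by a scalar.\<close>

lemma twist_graph_rels:
  assumes "d \<in> graph_rels r s" "cmod z = 1"
  shows "\<exists>c. twist z d = scale_poly c d"
proof -
  have u: "z * cnj z = 1" "cnj z * z = 1" using assms(2) by (simp_all add: complex_norm_square[symmetric] mult.commute)
  have mon: "twist z (mon a) = scale_poly (twist_factor z (Letters a)) (mon a)" for a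
    by (simp add: twist_single scale_poly_def mult_single)
  show ?thesis using assms(1)
    by (induction rule: graph_rels.induct)
      (auto simp: twist_diff twist_sum mon twist_factor_def u scale_poly_def ring_distribs sum_distrib_left
         simp flip: mult.assoc intro: exI[of _ 1] exI[of _ z])
qed

text \<open>The admissible seminorms are permuted among themselves, so twisting does not increase
  their supremum and descends to the completion.\<close>

lemma twist_graph_seminorms:
  assumes "q \<in> graph_seminorms r s" "cmod z = 1"
  shows "q \<circ> twist z \<in> graph_seminorms r s"
proof -
  interpret free_cstar_seminorm q by standard (use assms in \<open>simp add: graph_seminorms_def\<close>)
  have "q (twist z d) = 0" if "d \<in> graph_rels r s" for d
    using twist_graph_rels[OF that assms(2)] that assms(1)
    by (auto simp: q_scale graph_rels_free graph_seminorms_def)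
  moreover have "cstar_seminorm (q \<circ> twist z)"
    by (simp add: cstar_seminorm_def twist_add twist_mult twist_scale twist_adj q_add q_mult q_scale q_cstar)
  ultimately show ?thesis by (simp add: graph_seminorms_def)
qed

section \<open>The gauge action on C*(E)\<close>

locale graph_algebra =
  fixes r s :: "'e \<Rightarrow> 'v"

sublocale graph_algebra \<subseteq> graph_seminorm_rels "graph_seminorm r s" r s
  by standard (simp_all add: graph_seminorm_cstar graph_seminorm_zero)

context graph_algebra
begin

lemma graph_cstar_A: "graph_cstar r s = A"
  by (simp add: graph_cstar_def)

lemma vertex_proj_em: "vertex_proj r s v = em (mon [vg v])"
  by (simp add: vertex_proj_def completion_gen_em)

lemma edge_isom_em: "edge_isom r s e = em (mon [eg e])"
  by (simp add: edge_isom_def completion_gen_em)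

lemma twist_le:
  assumes "x \<in> free_star_algebra" "cmod z = 1"
  shows "graph_seminorm r s (twist z x) \<le> graph_seminorm r s x"
  by (rule graph_seminorm_least)
    (use graph_seminorm_upper[OF twist_graph_seminorms[OF _ assms(2)] assms(1)] in simp)

lemma C_twist:
  assumes "X \<in> C" "cmod z = 1"
  shows "(\<lambda>n. twist z (X n)) \<in> C"
proof (rule C_lip2[OF assms(1,1), of _ 1])
  fix m n
  have F: "X m - X n \<in> free_star_algebra" using C_F0[OF assms(1)] by auto
  show "graph_seminorm r s (twist z (X m) - twist z (X n))
      \<le> 1 * (graph_seminorm r s (X m - X n) + graph_seminorm r s (X m - X n))"
    using twist_le[OF F assms(2)] q_nonneg[OF F] by (simp flip: twist_diff)
qed (use C_F0[OF assms(1)] in auto)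

definition rot :: "complex \<Rightarrow> ('v, 'e) gelem \<Rightarrow> ('v, 'e) gelem" where
  "rot z = (\<lambda>a\<in>carrier A. cl (\<lambda>n. twist z (cauchy_rep a n)))"

lemma rot_cl:
  assumes "X \<in> C" "cmod z = 1"
  shows "rot z (cl X) = cl (\<lambda>n. twist z (X n))"
proof -
  note e = rep_cl[OF assms(1)]
  note F = C_F0[OF assms(1)] C_F0[OF eqvC(2)[OF e]]
  have "eqv (\<lambda>n. twist z (X n)) (\<lambda>n. twist z (cauchy_rep (cl X) n))"
    by (rule eqv_dom[OF C_twist[OF assms] C_twist[OF eqvC(2)[OF e] assms(2)] _ eqv_lim[OF e]])
      (use F twist_le[OF _ assms(2)] in \<open>auto simp flip: twist_diff\<close>)
  from cl_eq_iff[OF eqvC[OF this], THEN iffD2, OF this] show ?thesis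
    using assms by (simp add: rot_def carrier_A)
qed

lemma rot_em: "x \<in> free_star_algebra \<Longrightarrow> cmod z = 1 \<Longrightarrow> rot z (em x) = em (twist z x)"
  by (simp add: em_def rot_cl)

lemma rot_hom:
  assumes "cmod z = 1"
  shows "star_hom A A (rot z)"
proof -
  note R = rot_cl[OF _ assms] and CR = C_twist[OF _ assms]
  have "cnorm A (cl (\<lambda>n. twist z (X n))) \<le> cnorm A (cl X)" if "X \<in> C" for X
    by (rule LIMSEQ_le[OF norm_cl[OF CR[OF that]] norm_cl[OF that]])
      (use twist_le[OF C_F0[OF that] assms] in auto)
  thus ?thesis unfolding star_hom_def carrier_A
    by (auto simp: R CR C_add C_mult C_scale C_adj add_cl mult_cl scale_cl adj_cl
        twist_add twist_mult twist_scale twist_adj)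
qed

lemma star_hom_em_twist:
  assumes h: "star_hom A A \<gamma>" and z: "cmod z = 1"
    and e: "\<And>e. \<gamma> (edge_isom r s e) = z \<cdot>\<^bsub>A\<^esub> edge_isom r s e"
    and v: "\<And>v. \<gamma> (vertex_proj r s v) = vertex_proj r s v"
    and x: "x \<in> free_star_algebra"
  shows "\<gamma> (em x) = em (twist z x)"
  using x
proof (induction x rule: free_star_algebra_induct)
  case zero
  \<comment> \<open>\<open>star_hom\<close> has no clause for zero, which is therefore written as
    the scalar 0 times itself.\<close>
  have "\<gamma> (0 \<cdot>\<^bsub>A\<^esub> em 0) = 0 \<cdot>\<^bsub>A\<^esub> \<gamma> (em 0)" "\<gamma> (em 0) \<in> carrier A"
    using h by (auto simp: star_hom_def)
  moreover have "0 \<cdot>\<^bsub>A\<^esub> a = em 0" if "a \<in> carrier A" for a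
  proof -
    have "scale_poly 0 x = 0" for x :: "('v + 'e) star_poly" by (rule poly_mapping_eqI) simp
    thus ?thesis using that by (auto elim!: carrierE simp: scale_cl em_def)
  qed
  ultimately show ?case by simp
next
  case (mon ls c)
  have rm: "twist z (mon a) = scale_poly (twist_factor z (Letters a)) (mon a)" for a
    by (simp add: twist_single scale_poly_def mult_single)
  have l: "\<gamma> (em (mon [l])) = em (twist z (mon [l]))" for l
  proof -
    have g: "\<gamma> (em (mon [Gen g])) = em (twist z (mon [Gen g]))" for g
      using e v by (cases g) (simp_all add: edge_isom_em vertex_proj_em em_scale rm twist_factor_def scale_simps)
    show ?thesis
    proof (cases l)
      case (Adj g)
      have "\<gamma> (adj A (em (mon [Gen g]))) = adj A (\<gamma> (em (mon [Gen g])))"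
        using h by (auto simp: star_hom_def)
      thus ?thesis using Adj by (simp add: g em_adj flip: twist_adj)
    qed (simp add: g)
  qed
  have "\<gamma> (em (mon ls)) = em (twist z (mon ls))" using mon
  proof (induction ls rule: list_nonempty_induct)
    case (cons l ls)
    have "\<gamma> (em (mon [l]) \<otimes>\<^bsub>A\<^esub> em (mon ls)) = \<gamma> (em (mon [l])) \<otimes>\<^bsub>A\<^esub> \<gamma> (em (mon ls))"
      using h cons by (auto simp: star_hom_def)
    thus ?case using cons by (simp add: em_mult l mon_mult flip: twist_mult)
  qed (rule l)
  moreover have "\<gamma> (c \<cdot>\<^bsub>A\<^esub> em (mon ls)) = c \<cdot>\<^bsub>A\<^esub> \<gamma> (em (mon ls))"
    using h mon by (auto simp: star_hom_def)
  ultimately show ?case using mon by (simp add: em_scale twist_scale)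
next
  case (add x y)
  have "\<gamma> (em x \<oplus>\<^bsub>A\<^esub> em y) = \<gamma> (em x) \<oplus>\<^bsub>A\<^esub> \<gamma> (em y)"
    using h add by (auto simp: star_hom_def)
  thus ?case using add by (simp add: em_add twist_add)
qed

lemma star_hom_eqI:
  assumes h: "star_hom A A \<gamma>" "star_hom A A \<delta>" and em: "\<And>x. x \<in> free_star_algebra \<Longrightarrow> \<gamma> (em x) = \<delta> (em x)"
    and a: "a \<in> carrier A"
  shows "\<gamma> a = \<delta> a"
proof -
  obtain X where X: "X \<in> C" "a = cl X" using a by (rule carrierE)
  have c: "\<gamma> a \<in> carrier A" "\<delta> a \<in> carrier A" using h a by (auto simp: star_hom_def)
  have "cnorm A (\<gamma> a \<ominus>\<^bsub>A\<^esub> \<delta> a) \<le> 2 * cnorm A (cl X \<ominus>\<^bsub>A\<^esub> em (X n))" for n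
  proof -
    have F: "X n \<in> free_star_algebra" using C_F0 X by auto
    hence ec: "em (X n) \<in> carrier A" by simp
    have le: "cnorm A (\<eta> a \<ominus>\<^bsub>A\<^esub> \<eta> (em (X n))) \<le> cnorm A (a \<ominus>\<^bsub>A\<^esub> em (X n))"
      and c': "\<eta> (em (X n)) \<in> carrier A"
      if "star_hom A A \<eta>" for \<eta>
      using that star_hom_diff[OF that a ec, symmetric] closed(3)[OF a ec] ec by (auto simp: star_hom_def)
    have "cnorm A (\<gamma> a \<ominus>\<^bsub>A\<^esub> \<delta> a)
        \<le> cnorm A (\<gamma> a \<ominus>\<^bsub>A\<^esub> \<gamma> (em (X n))) + cnorm A (\<delta> (em (X n)) \<ominus>\<^bsub>A\<^esub> \<delta> a)"
      using dist_triangle[OF c(1) c'[OF h(1)] c(2)] by (simp add: em[OF F])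
    also have "\<dots> \<le> 2 * cnorm A (a \<ominus>\<^bsub>A\<^esub> em (X n))"
      using le[OF h(1)] le[OF h(2)] dist_commute[OF c'[OF h(2)] c(2)] by simp
    finally show ?thesis using X by simp
  qed
  moreover have "(\<lambda>n. 2 * cnorm A (cl X \<ominus>\<^bsub>A\<^esub> em (X n))) \<longlonglongrightarrow> 0"
    using tendsto_mult_left[OF cl_limit[OF X(1)], of 2] by simp
  ultimately have "cnorm A (\<gamma> a \<ominus>\<^bsub>A\<^esub> \<delta> a) \<le> 0"
    by - (rule LIMSEQ_le_const, assumption, blast)
  thus ?thesis using dist_eq_0 c by blast
qed

text \<open>Uniqueness: the prescribed values determine a homomorphism on polynomials, and
  norm-decreasing maps that agree on this dense set are equal. Existence is \<open>rot\<close>, the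
  continuous extension of twisting.\<close>

lemma gauge_eq_rot:
  assumes "cmod z = 1"
  shows "gauge r s z = rot z"
  unfolding gauge_def graph_cstar_A
proof (rule the_equality)
  show "rot z \<in> extensional (carrier A) \<and> star_hom A A (rot z) \<and>
      (\<forall>e. rot z (edge_isom r s e) = z \<cdot>\<^bsub>A\<^esub> edge_isom r s e) \<and>
      (\<forall>v. rot z (vertex_proj r s v) = vertex_proj r s v)"
    using assms rot_hom[OF assms]
    by (simp add: edge_isom_em vertex_proj_em rot_em em_scale twist_single twist_factor_def
        scale_poly_def mult_single) (simp add: rot_def)
  fix \<gamma> assume g: "\<gamma> \<in> extensional (carrier A) \<and> star_hom A A \<gamma> \<and>
      (\<forall>e. \<gamma> (edge_isom r s e) = z \<cdot>\<^bsub>A\<^esub> edge_isom r s e) \<and>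
      (\<forall>v. \<gamma> (vertex_proj r s v) = vertex_proj r s v)"
  have "\<gamma> a = rot z a" if "a \<in> carrier A" for a
  proof (rule star_hom_eqI[OF _ rot_hom[OF assms] _ that])
    show h: "star_hom A A \<gamma>" using g by blast
    show "\<gamma> (em x) = rot z (em x)" if "x \<in> free_star_algebra" for x
      unfolding rot_em[OF that assms] by (rule star_hom_em_twist[OF h assms _ _ that]) (use g in blast)+
  qed
  thus "\<gamma> = rot z" using g by (auto simp: rot_def intro: extensionalityI)
qed

section \<open>The core and its dense part of degree 0\<close>

lemma core_carrier: "carrier (gauge_core r s) = {a \<in> carrier A. \<forall>z. cmod z = 1 \<longrightarrow> rot z a = a}"
  by (simp add: gauge_core_def gauge_eq_rot graph_cstar_A)

lemma core_ops [simp]: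
  "mult (gauge_core r s) = mult A" "add (gauge_core r s) = add A"
  "cscale (gauge_core r s) = cscale A" "adj (gauge_core r s) = adj A" "cnorm (gauge_core r s) = cnorm A"
  "zero (gauge_core r s) = zero A"
  by (simp_all add: gauge_core_def graph_cstar_A)

abbreviation "core \<equiv> carrier (gauge_core r s)"

lemma core_A: "a \<in> core \<Longrightarrow> a \<in> carrier A"
  by (simp add: core_carrier)

lemma core_closed:
  "a \<in> core \<Longrightarrow> b \<in> core \<Longrightarrow> a \<oplus>\<^bsub>A\<^esub> b \<in> core"
  "a \<in> core \<Longrightarrow> b \<in> core \<Longrightarrow> a \<otimes>\<^bsub>A\<^esub> b \<in> core"
  "a \<in> core \<Longrightarrow> b \<in> core \<Longrightarrow> a \<ominus>\<^bsub>A\<^esub> b \<in> core"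
  "a \<in> core \<Longrightarrow> z \<cdot>\<^bsub>A\<^esub> a \<in> core"
  "a \<in> core \<Longrightarrow> adj A a \<in> core"
  using rot_hom by (auto simp: core_carrier closed star_hom_def star_hom_diff[OF rot_hom])

definition degree0 :: "('v + 'e) star_poly set" where
  "degree0 = {x \<in> free_star_algebra. \<forall>m\<in>Poly_Mapping.keys x. word_degree m = 0}"

lemma degree0_free: "x \<in> degree0 \<Longrightarrow> x \<in> free_star_algebra"
  by (simp add: degree0_def)

lemma em_core:
  assumes "x \<in> degree0"
  shows "em x \<in> core"
proof -
  have "twist z x = x" if "cmod z = 1" for z
  proof (rule poly_mapping_eqI)
    show "Poly_Mapping.lookup (twist z x) m = Poly_Mapping.lookup x m" for m
      using assms that twist_factor_degree_0[of m z]
      by (cases "m \<in> Poly_Mapping.keys x") (auto simp: degree0_def in_keys_iff)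
  qed
  thus ?thesis using assms by (simp add: core_carrier rot_em degree0_free)
qed

text \<open>The triangle inequality for polynomials along a representing sequence of
  \<open>a\<close> passes to the limit. Averaging two approximants therefore keeps the error below a
  given bound.\<close>

lemma dist_midpoint:
  assumes "a \<in> carrier A" "x \<in> free_star_algebra" "y \<in> free_star_algebra"
  shows "cnorm A (a \<ominus>\<^bsub>A\<^esub> em (scale_poly (1/2) (x + y)))
    \<le> cnorm A (a \<ominus>\<^bsub>A\<^esub> em x) / 2 + cnorm A (a \<ominus>\<^bsub>A\<^esub> em y) / 2"
proof -
  obtain X where X: "X \<in> C" "a = cl X" using assms(1) by (rule carrierE)
  let ?m = "scale_poly (1/2) (x + y)" and ?q = "graph_seminorm r s"
  have l: "(\<lambda>n. ?q (X n - y)) \<longlonglongrightarrow> cnorm A (a \<ominus>\<^bsub>A\<^esub> em y)" if "y \<in> free_star_algebra" for y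
    using norm_cl[OF C_diff[OF X(1) C_const[OF that]]] X that by (simp add: em_def diff_cl)
  have "?q (X n - ?m) \<le> ?q (X n - x) / 2 + ?q (X n - y) / 2" for n
  proof -
    have "X n - ?m = scale_poly (1/2) (X n - x) + scale_poly (1/2) (X n - y)"
      by (rule poly_mapping_eqI) (simp add: lookup_minus lookup_add field_simps)
    thus ?thesis
      using q_add[of "scale_poly (1/2) (X n - x)" "scale_poly (1/2) (X n - y)"] C_F0[OF X(1)] assms
      by (simp add: q_scale)
  qed
  thus ?thesis
    using LIMSEQ_le[OF l[of ?m] tendsto_add[OF tendsto_divide[OF l tendsto_const] tendsto_divide[OF l tendsto_const], of x 2 y 2]]
      assms by auto
qed

text \<open>Averaging \<open>x\<close> with its rotation by \<open>\<pi>/d\<close> removes the component of degree \<open>d\<close>.\<close>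

lemma core_approx_avoiding:
  assumes a: "a \<in> core" and x: "x \<in> free_star_algebra" "cnorm A (a \<ominus>\<^bsub>A\<^esub> em x) < \<epsilon>"
    and D: "finite D" "0 \<notin> D"
  shows "\<exists>y\<in>free_star_algebra. cnorm A (a \<ominus>\<^bsub>A\<^esub> em y) < \<epsilon> \<and>
    Poly_Mapping.keys y \<subseteq> Poly_Mapping.keys x \<and> (\<forall>m\<in>Poly_Mapping.keys y. word_degree m \<notin> D)"
  using D
proof (induction D rule: finite_induct)
  case empty
  show ?case using x by auto
next
  case (insert d D)
  then obtain y where y: "y \<in> free_star_algebra" "cnorm A (a \<ominus>\<^bsub>A\<^esub> em y) < \<epsilon>"
    "Poly_Mapping.keys y \<subseteq> Poly_Mapping.keys x" "\<forall>m\<in>Poly_Mapping.keys y. word_degree m \<notin> D" by auto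
  define z where "z = cis (pi / of_int d)"
  have z: "cmod z = 1" by (simp add: z_def)
  define y' where "y' = scale_poly (1/2) (y + twist z y)"
  have l: "Poly_Mapping.lookup y' m = (1 + twist_factor z m) / 2 * Poly_Mapping.lookup y m" for m
    by (simp add: y'_def lookup_add field_simps)
  have "rot z a = a" using a z by (simp add: core_carrier)
  \<comment> \<open>Since \<open>a\<close> is fixed by the gauge action and \<open>rot z\<close> is
    contractive, the rotated approximant is as good as \<open>y\<close>.\<close>
  hence "a \<ominus>\<^bsub>A\<^esub> em (twist z y) = rot z (a \<ominus>\<^bsub>A\<^esub> em y)"
    using star_hom_diff[OF rot_hom[OF z] core_A[OF a] em_carrier[OF y(1)]] y z by (simp add: rot_em)
  hence "cnorm A (a \<ominus>\<^bsub>A\<^esub> em (twist z y)) < \<epsilon>"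
    using rot_hom[OF z] closed(3)[OF core_A[OF a] em_carrier[OF y(1)]] y(2) by (auto simp: star_hom_def intro: order_le_less_trans)
  hence "cnorm A (a \<ominus>\<^bsub>A\<^esub> em y') < \<epsilon>"
    using dist_midpoint[OF core_A[OF a] y(1) twist_free[OF y(1)], of z] y(2) unfolding y'_def by simp
  moreover have "word_degree m \<noteq> d" if "m \<in> Poly_Mapping.keys y'" for m
  proof
    assume "word_degree m = d"
    hence "twist_factor z m = -1" using insert by (simp add: z_def twist_factor_cis cis_pi)
    thus False using that by (simp add: in_keys_iff l)
  qed
  moreover have "Poly_Mapping.keys y' \<subseteq> Poly_Mapping.keys y" by (auto simp: in_keys_iff l)
  moreover have "y' \<in> free_star_algebra" using y by (simp add: y'_def)
  ultimately show ?case using y by (intro bexI[of _ y']) auto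
qed

text \<open>Averaging out the finitely many nonzero degrees of one approximant takes the place of
  integrating the gauge action over the circle.\<close>

lemma core_approx:
  assumes a: "a \<in> core" and e: "\<epsilon> > 0"
  obtains x where "x \<in> degree0" "cnorm A (a \<ominus>\<^bsub>A\<^esub> em x) < \<epsilon>"
proof -
  obtain X where X: "X \<in> C" "a = cl X" using core_A[OF a] by (rule carrierE)
  obtain x where x: "x \<in> free_star_algebra" "cnorm A (a \<ominus>\<^bsub>A\<^esub> em x) < \<epsilon>"
    using dense[OF X(1) e] X(2) by (auto simp: em_def)
  from core_approx_avoiding[OF a x, of "word_degree ` Poly_Mapping.keys x - {0}"]
  obtain y where "y \<in> free_star_algebra" "cnorm A (a \<ominus>\<^bsub>A\<^esub> em y) < \<epsilon>"
    "Poly_Mapping.keys y \<subseteq> Poly_Mapping.keys x"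
    "\<forall>m\<in>Poly_Mapping.keys y. word_degree m \<notin> word_degree ` Poly_Mapping.keys x - {0}" by auto
  thus ?thesis using that[of y] by (auto simp: degree0_def)
qed

end

section \<open>The embedding of the functions on the vertices\<close>

definition finsupp :: "('v \<Rightarrow> complex) set" where
  "finsupp = {f. finite {v. f v \<noteq> 0}}"

lemma finsupp_closed [simp, intro]:
  "f \<in> finsupp \<Longrightarrow> g \<in> finsupp \<Longrightarrow> (\<lambda>v. f v + g v) \<in> finsupp"
  "f \<in> finsupp \<Longrightarrow> g \<in> finsupp \<Longrightarrow> (\<lambda>v. f v - g v) \<in> finsupp"
  "f \<in> finsupp \<Longrightarrow> (\<lambda>v. h v * f v) \<in> finsupp"
  "f \<in> finsupp \<Longrightarrow> (\<lambda>v. cnj (f v)) \<in> finsupp"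
  "char_fun v \<in> finsupp"
  "(\<lambda>v. 0) \<in> finsupp"
proof -
  assume f: "f \<in> finsupp"
  show "(\<lambda>v. h v * f v) \<in> finsupp" "(\<lambda>v. cnj (f v)) \<in> finsupp"
    using f by (auto simp: finsupp_def elim: rev_finite_subset)
  assume g: "g \<in> finsupp"
  have "{v. f v + g v \<noteq> 0} \<subseteq> {v. f v \<noteq> 0} \<union> {v. g v \<noteq> 0}" "{v. f v - g v \<noteq> 0} \<subseteq> {v. f v \<noteq> 0} \<union> {v. g v \<noteq> 0}"
    by auto
  thus "(\<lambda>v. f v + g v) \<in> finsupp" "(\<lambda>v. f v - g v) \<in> finsupp"
    using f g by (auto simp: finsupp_def dest: finite_subset)
qed (auto simp: finsupp_def char_fun_def)

text \<open>Discarding values below 1/(n+1) leaves finitely many by vanishing at infinity and costs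
  at most 1/(n+1) uniformly; these explicit rates make the approximating sequences Cauchy.\<close>

definition cutoff :: "nat \<Rightarrow> ('v \<Rightarrow> complex) \<Rightarrow> 'v \<Rightarrow> complex" where
  "cutoff n a v = (if inverse (real (Suc n)) \<le> cmod (a v) then a v else 0)"

lemma C0_carrier: "a \<in> carrier C0_alg \<longleftrightarrow> (\<forall>\<epsilon>>0. finite {v. \<epsilon> \<le> cmod (a v)})"
  by (simp add: C0_alg_def)

lemma C0_ops [simp]:
  "a \<otimes>\<^bsub>C0_alg\<^esub> b = (\<lambda>v. a v * b v)" "a \<oplus>\<^bsub>C0_alg\<^esub> b = (\<lambda>v. a v + b v)"
  "z \<cdot>\<^bsub>C0_alg\<^esub> a = (\<lambda>v. z * a v)" "adj C0_alg a = (\<lambda>v. cnj (a v))"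
  "\<zero>\<^bsub>C0_alg\<^esub> = (\<lambda>v. 0)"
  by (simp_all add: C0_alg_def)

lemma cutoff_finsupp [simp]: "a \<in> carrier C0_alg \<Longrightarrow> cutoff n a \<in> finsupp"
  by (auto simp: C0_carrier finsupp_def cutoff_def elim!: allE[of _ "inverse (real (Suc n))"] elim: rev_finite_subset)

lemma cutoff_le: "cmod (cutoff n a v - a v) \<le> inverse (real (Suc n))"
  by (auto simp: cutoff_def)

lemma cutoff_norm_le: "cmod (cutoff n a v) \<le> cmod (a v)"
  by (auto simp: cutoff_def)

lemma finsupp_C0: "f \<in> finsupp \<Longrightarrow> f \<in> carrier C0_alg"
  by (auto simp: C0_carrier finsupp_def elim!: rev_finite_subset)

lemma C0_bounded:
  assumes "a \<in> carrier C0_alg"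
  obtains K where "0 \<le> K" "\<And>v. cmod (a v) \<le> K"
proof -
  have "finite {v. 1 \<le> cmod (a v)}" using assms by (auto simp: C0_carrier)
  hence f: "finite ((\<lambda>v. cmod (a v)) ` {v. 1 \<le> cmod (a v)})" by simp
  have "cmod (a v) \<le> Max (insert 1 ((\<lambda>v. cmod (a v)) ` {v. 1 \<le> cmod (a v)}))" for v
    using f by (cases "1 \<le> cmod (a v)") (auto intro!: Max_ge simp: Max_ge_iff)
  moreover have "0 \<le> Max (insert 1 ((\<lambda>v. cmod (a v)) ` {v. 1 \<le> cmod (a v)}))"
    using f by (auto simp: Max_ge_iff)
  ultimately show ?thesis using that by blast
qed

lemma C0_norm_le: "(\<And>v. cmod (a v) \<le> K) \<Longrightarrow> cnorm C0_alg a \<le> K"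
  by (simp add: C0_alg_def cSUP_least)

lemma C0_le_norm:
  assumes "a \<in> carrier C0_alg"
  shows "cmod (a v) \<le> cnorm C0_alg a"
proof -
  obtain K where "\<And>v. cmod (a v) \<le> K" using C0_bounded[OF assms] by blast
  thus ?thesis unfolding C0_alg_def by (auto intro!: cSUP_upper bdd_aboveI2)
qed

lemma C0_closed:
  "a \<in> carrier C0_alg \<Longrightarrow> b \<in> carrier C0_alg \<Longrightarrow> (\<lambda>v. a v + b v) \<in> carrier C0_alg"
  "a \<in> carrier C0_alg \<Longrightarrow> b \<in> carrier C0_alg \<Longrightarrow> (\<lambda>v. a v - b v) \<in> carrier C0_alg"
  "a \<in> carrier C0_alg \<Longrightarrow> b \<in> carrier C0_alg \<Longrightarrow> (\<lambda>v. a v * b v) \<in> carrier C0_alg"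
  "a \<in> carrier C0_alg \<Longrightarrow> (\<lambda>v. z * a v) \<in> carrier C0_alg"
  "a \<in> carrier C0_alg \<Longrightarrow> (\<lambda>v. cnj (a v)) \<in> carrier C0_alg"
proof -
  \<comment> \<open>Bounded multipliers cover scalars and products alike; \<open>K + 1\<close> is
    used because \<open>K\<close> may be 0.\<close>
  have bd: "(\<lambda>v. h v * a v) \<in> carrier C0_alg"
    if "a \<in> carrier C0_alg" "0 \<le> K" "\<And>v. cmod (h v) \<le> K" for h a :: "'a \<Rightarrow> complex" and K
    unfolding C0_carrier
  proof (intro allI impI)
    fix \<epsilon> :: real assume e: "\<epsilon> > 0"
    have "{v. \<epsilon> \<le> cmod (h v * a v)} \<subseteq> {v. \<epsilon> / (K + 1) \<le> cmod (a v)}"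
    proof safe
      fix v assume "\<epsilon> \<le> cmod (h v * a v)"
      also have "\<dots> \<le> (K + 1) * cmod (a v)" unfolding norm_mult
        using that(3)[of v] by (intro mult_right_mono) auto
      finally show "\<epsilon> / (K + 1) \<le> cmod (a v)" using that(2) by (simp add: field_simps)
    qed
    moreover have "finite {v. \<epsilon> / (K + 1) \<le> cmod (a v)}"
      using that(1,2) e by (simp add: C0_carrier)
    ultimately show "finite {v. \<epsilon> \<le> cmod (h v * a v)}" by (rule finite_subset)
  qed
  assume a: "a \<in> carrier C0_alg"
  show sc: "(\<lambda>v. z * a v) \<in> carrier C0_alg" for z using bd[OF a, of "cmod z" "\<lambda>v. z"] by simp
  show "(\<lambda>v. cnj (a v)) \<in> carrier C0_alg" using a by (simp add: C0_carrier)
  assume b: "b \<in> carrier C0_alg"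
  have pm: "(\<lambda>v. a v + d v) \<in> carrier C0_alg" if d: "d \<in> carrier C0_alg" for d
    unfolding C0_carrier
  proof (intro allI impI)
    fix \<epsilon> :: real assume e: "\<epsilon> > 0"
    have "{v. \<epsilon> \<le> cmod (a v + d v)} \<subseteq> {v. \<epsilon>/2 \<le> cmod (a v)} \<union> {v. \<epsilon>/2 \<le> cmod (d v)}"
    proof
      fix v assume "v \<in> {v. \<epsilon> \<le> cmod (a v + d v)}"
      thus "v \<in> {v. \<epsilon>/2 \<le> cmod (a v)} \<union> {v. \<epsilon>/2 \<le> cmod (d v)}"
        using norm_triangle_ineq[of "a v" "d v"] by auto
    qed
    moreover have "finite ({v. \<epsilon>/2 \<le> cmod (a v)} \<union> {v. \<epsilon>/2 \<le> cmod (d v)})"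
      using a[unfolded C0_carrier, rule_format, OF half_gt_zero[OF e]]
        d[unfolded C0_carrier, rule_format, OF half_gt_zero[OF e]] by (rule finite_UnI)
    ultimately show "finite {v. \<epsilon> \<le> cmod (a v + d v)}" by (rule finite_subset)
  qed
  show "(\<lambda>v. a v + b v) \<in> carrier C0_alg" by (rule pm[OF b])
  have "(\<lambda>v. - b v) \<in> carrier C0_alg" using b by (simp add: C0_carrier)
  from pm[OF this] show "(\<lambda>v. a v - b v) \<in> carrier C0_alg" by simp
  obtain K where "0 \<le> K" "\<And>v. cmod (a v) \<le> K" by (rule C0_bounded[OF a]) blast
  thus "(\<lambda>v. a v * b v) \<in> carrier C0_alg" by (rule bd[OF b])
qed

lemma scale_mult_scale: "scale_poly z x * scale_poly w y = scale_poly (z * w) (x * y)"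
proof -
  have "scale_poly z x * scale_poly w y = scale_poly w (scale_poly z (x * y))"
    by (simp flip: scale_poly_left scale_poly_right)
  also have "\<dots> = scale_poly (z * w) (x * y)" by (rule poly_mapping_eqI) (simp add: mult_ac)
  finally show ?thesis .
qed

section \<open>Finitely supported functions as polynomials\<close>

context graph_algebra
begin

abbreviation "gs \<equiv> graph_seminorm r s"

definition vpoly :: "('v \<Rightarrow> complex) \<Rightarrow> ('v + 'e) star_poly" where
  "vpoly f = (\<Sum>v | f v \<noteq> 0. scale_poly (f v) (mon [vg v]))"

lemma vpoly_superset:
  assumes "finite V" "{v. f v \<noteq> 0} \<subseteq> V"
  shows "vpoly f = (\<Sum>v\<in>V. scale_poly (f v) (mon [vg v]))"
proof -
  have "scale_poly 0 x = 0" for x :: "('v + 'e) star_poly" by (rule poly_mapping_eqI) simp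
  thus ?thesis unfolding vpoly_def using assms by (intro sum.mono_neutral_left) auto
qed

lemma vpoly_free [simp]: "vpoly f \<in> free_star_algebra"
  unfolding vpoly_def by (rule sum_free) simp

lemma q_sum_0:
  assumes "\<And>i. i \<in> I \<Longrightarrow> f i \<in> free_star_algebra" "\<And>i. i \<in> I \<Longrightarrow> gs (f i) = 0"
  shows "gs (sum f I) = 0"
  using assms
proof (induction I rule: infinite_finite_induct)
  case (insert i I)
  have "gs (f i + sum f I) \<le> gs (f i) + gs (sum f I)"
    using insert by (intro q_add sum_free) auto
  moreover have "0 \<le> gs (f i + sum f I)" using insert by (intro q_nonneg F0_closed sum_free) auto
  ultimately show ?case using insert by simp
qed auto

lemma vpoly_add:
  assumes "f \<in> finsupp" "g \<in> finsupp"
  shows "vpoly (\<lambda>v. f v + g v) = vpoly f + vpoly g"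
proof -
  let ?V = "{v. f v \<noteq> 0} \<union> {v. g v \<noteq> 0}"
  have V: "finite ?V" using assms by (simp add: finsupp_def)
  have "vpoly (\<lambda>v. f v + g v) = (\<Sum>v\<in>?V. scale_poly (f v + g v) (mon [vg v]))"
    "vpoly f = (\<Sum>v\<in>?V. scale_poly (f v) (mon [vg v]))" "vpoly g = (\<Sum>v\<in>?V. scale_poly (g v) (mon [vg v]))"
    using V by (intro vpoly_superset; auto)+
  thus ?thesis by (simp add: scale_simps sum.distrib)
qed

lemma vpoly_scale: "f \<in> finsupp \<Longrightarrow> vpoly (\<lambda>v. z * f v) = scale_poly z (vpoly f)"
proof -
  assume f: "f \<in> finsupp"
  have "vpoly (\<lambda>v. z * f v) = (\<Sum>v | f v \<noteq> 0. scale_poly (z * f v) (mon [vg v]))"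
    using f by (intro vpoly_superset) (auto simp: finsupp_def)
  also have "\<dots> = scale_poly z (vpoly f)"
    by (simp add: vpoly_def scale_simps scale_poly_def sum_distrib_left mult.assoc)
      (simp add: mult_single flip: mult.assoc)
  finally show ?thesis .
qed

lemma vpoly_diff:
  assumes "f \<in> finsupp" "g \<in> finsupp"
  shows "vpoly (\<lambda>v. f v - g v) = vpoly f - vpoly g"
  using vpoly_add[OF assms(1), of "\<lambda>v. - 1 * g v"] vpoly_scale[OF assms(2), of "-1"] finsupp_closed(3)[OF assms(2), of "\<lambda>_. -1"]
  by (simp add: scale_poly_uminus1)

lemma vpoly_char: "vpoly (char_fun v) = mon [vg v]"
proof -
  have "{u. char_fun v u \<noteq> 0} = {v}" by (auto simp: char_fun_def)
  thus ?thesis by (simp add: vpoly_def scale_simps) (simp add: char_fun_def scale_simps)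
qed

text \<open>The off-diagonal products p_v p_w and the idempotence of p_v are relations, so
  multiplicativity holds only up to the seminorm.\<close>

lemma vpoly_mult:
  assumes "f \<in> finsupp" "g \<in> finsupp"
  shows "gs (vpoly f * vpoly g - vpoly (\<lambda>v. f v * g v)) = 0"
proof -
  let ?V = "{v. f v \<noteq> 0} \<union> {v. g v \<noteq> 0}"
  have V: "finite ?V" using assms by (simp add: finsupp_def)
  let ?d = "\<lambda>v w. mon [vg v, vg w] - (if v = w then mon [vg v] else 0)"
  have e: "vpoly (\<lambda>v. f v * g v) = (\<Sum>v\<in>?V. \<Sum>w\<in>?V. scale_poly (f v * g w) (if v = w then mon [vg v] else 0))"
  proof -
    have "scale_poly (f v * g v) (mon [vg v] :: ('v + 'e) star_poly)
        = (\<Sum>w\<in>?V. scale_poly (f v * g w) (if v = w then mon [vg v] else 0))"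
      if "v \<in> ?V" for v
    proof -
      have "(\<Sum>w\<in>?V. scale_poly (f v * g w) (if v = w then mon [vg v] :: ('v + 'e) star_poly else 0))
          = (\<Sum>w\<in>?V. if v = w then scale_poly (f v * g v) (mon [vg v]) else 0)"
        by (intro sum.cong) (auto simp: scale_poly_def)
      thus ?thesis using V that by (simp add: sum.delta')
    qed
    note term_eq = this
    have "vpoly (\<lambda>v. f v * g v) = (\<Sum>v\<in>?V. scale_poly (f v * g v) (mon [vg v]))"
      using V by (intro vpoly_superset) auto
    also have "\<dots> = (\<Sum>v\<in>?V. \<Sum>w\<in>?V. scale_poly (f v * g w) (if v = w then mon [vg v] else 0))"
      by (rule sum.cong[OF refl]) (rule term_eq)
    finally show ?thesis .
  qed
  have "vpoly f * vpoly g = (\<Sum>v\<in>?V. \<Sum>w\<in>?V. scale_poly (f v) (mon [vg v]) * scale_poly (g w) (mon [vg w]))"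
    using V by (simp only: vpoly_superset[of ?V f] vpoly_superset[of ?V g] Un_upper1 Un_upper2 sum_product)
  also have "\<dots> = (\<Sum>v\<in>?V. \<Sum>w\<in>?V. scale_poly (f v * g w) (mon [vg v, vg w]))"
    by (intro sum.cong refl) (simp add: scale_mult_scale mon_mult)
  finally have "vpoly f * vpoly g - vpoly (\<lambda>v. f v * g v) = (\<Sum>v\<in>?V. \<Sum>w\<in>?V. scale_poly (f v * g w) (?d v w))"
    unfolding e by (simp only: sum_subtractf[symmetric] scale_diff)
  moreover have "gs (scale_poly (f v * g w) (?d v w)) = 0" for v w
    using weq_rels(2)[of v] wzero_rels(1)[of v w] by (auto simp: q_scale weq_def wzero_def)
  ultimately show ?thesis by (auto intro!: q_sum_0 sum_free)
qed

lemma vpoly_adj: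
  assumes "f \<in> finsupp"
  shows "gs (adj_poly (vpoly f) - vpoly (\<lambda>v. cnj (f v))) = 0"
proof -
  have s: "adj_poly (sum g V) = (\<Sum>v\<in>V. adj_poly (g v))" for g :: "'v \<Rightarrow> ('v + 'e) star_poly" and V
    by (induction V rule: infinite_finite_induct) (auto simp: adj_poly_add)
  have "adj_poly (vpoly f) - vpoly (\<lambda>v. cnj (f v)) = (\<Sum>v | f v \<noteq> 0. scale_poly (cnj (f v)) (mon [va v] - mon [vg v]))"
    by (simp add: vpoly_def s adj_scale flip: sum_subtractf scale_diff)
  moreover have "gs (scale_poly (cnj (f v)) (mon [va v] - mon [vg v])) = 0" for v
    using weq_rels(1)[of v] by (auto simp: q_scale weq_def)
  ultimately show ?thesis by (auto intro!: q_sum_0)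
qed

text \<open>By the C*-identity the norm of \<open>vpoly f\<close> is controlled by its powers of exponent \<open>2\<^sup>n\<close>, for
  which the crude bound with the size of the support is harmless.\<close>

lemma vpoly_power_le:
  assumes "finite V" "{v. f v \<noteq> 0} \<subseteq> V" "\<And>v. cmod (f v) \<le> M"
  shows "gs (vpoly f) ^ (2 ^ n) \<le> real (card V) * M ^ (2 ^ n)"
  using assms(2,3)
proof (induction n arbitrary: f M)
  case 0
  have M: "0 \<le> M" using 0(2)[of undefined] norm_ge_zero order_trans by blast
  have "gs (\<Sum>v\<in>W. scale_poly (f v) (mon [vg v])) \<le> real (card W) * M" if "finite W" for W
    using that
  proof (induction W rule: finite_induct)
    case (insert v W)
    have F: "(\<Sum>v\<in>W. scale_poly (f v) (mon [vg v])) \<in> free_star_algebra" by (rule sum_free) simp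
    have "gs (scale_poly (f v) (mon [vg v])) = cmod (f v) * gs (mon [vg v])" by (simp add: q_scale)
    also have "\<dots> \<le> M * 1"
      using 0(2)[of v] graph_seminorms_letter_le[OF graph_seminorm_mem] M q_nonneg
      by (intro mult_mono) auto
    finally have "gs (scale_poly (f v) (mon [vg v])) \<le> M" by simp
    thus ?case using insert q_add[OF _ F, of "scale_poly (f v) (mon [vg v])"] by (simp add: ring_distribs)
  qed simp
  thus ?case using vpoly_superset[OF assms(1) 0(1)] assms(1) by simp
next
  case (Suc n)
  let ?g = "\<lambda>v. cnj (f v) * f v"
  have f: "f \<in> finsupp" using Suc.prems assms(1) by (auto simp: finsupp_def intro: finite_subset)
  have "gs (adj_poly (vpoly f) * vpoly f) = gs (vpoly ?g)"
  proof (rule q_eq)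
    have "gs ((adj_poly (vpoly f) - vpoly (\<lambda>v. cnj (f v))) * vpoly f) = 0"
      by (rule q_ideal_mult[OF _ vpoly_adj[OF f]]) auto
    hence "gs (adj_poly (vpoly f) * vpoly f - vpoly (\<lambda>v. cnj (f v)) * vpoly f) = 0"
      by (simp add: left_diff_distrib)
    thus "gs (adj_poly (vpoly f) * vpoly f - vpoly ?g) = 0"
      by (rule q_eq_trans[rotated 3, OF _ vpoly_mult]) (use f in auto)
  qed auto
  hence 1: "(gs (vpoly f))\<^sup>2 = gs (vpoly ?g)" by (simp add: q_cstar)
  have "gs (vpoly ?g) ^ (2 ^ n) \<le> real (card V) * (M\<^sup>2) ^ (2 ^ n)"
  proof (rule Suc.IH)
    show "cmod (?g v) \<le> M\<^sup>2" for v
      unfolding Real_Vector_Spaces.norm_mult complex_mod_cnj power2_eq_square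
      using Suc.prems(2)[of v] by (intro mult_mono) (auto intro: order_trans[OF norm_ge_zero])
  qed (use Suc.prems in auto)
  thus ?case by (simp add: power_mult flip: 1)
qed

text \<open>If the norm exceeded M by a factor above 1, the powers of this factor would outgrow the
  size of the support, which \<open>vpoly_power_le\<close> forbids.\<close>

lemma vpoly_norm_le:
  assumes "f \<in> finsupp" "\<And>v. cmod (f v) \<le> M"
  shows "gs (vpoly f) \<le> M"
proof (rule ccontr)
  assume "\<not> ?thesis"
  hence h: "M < gs (vpoly f)" by simp
  have V: "finite {v. f v \<noteq> 0}" using assms(1) by (simp add: finsupp_def)
  note le = vpoly_power_le[OF V subset_refl assms(2)]
  have M: "0 \<le> M" using assms(2)[of undefined] norm_ge_zero order_trans by blast
  show False
  proof (cases "M = 0")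
    case True thus ?thesis using le[of 0] h by simp
  next
    case False
    hence M: "0 < M" using M by simp
    let ?x = "gs (vpoly f) / M"
    have x: "1 < ?x" using h M by simp
    obtain n where n: "real (card {v. f v \<noteq> 0}) < ?x ^ n" using real_arch_pow[OF x] by blast
    have "?x ^ n \<le> ?x ^ (2 ^ n)" using x by (intro power_increasing) (auto intro: less_imp_le)
    also have "\<dots> \<le> real (card {v. f v \<noteq> 0})" using le[of n] M by (simp add: power_divide divide_le_eq)
    finally show ?thesis using n by simp
  qed
qed

section \<open>Continuous extension to all functions vanishing at infinity\<close>

definition C0_seq :: "('v \<Rightarrow> complex) \<Rightarrow> nat \<Rightarrow> ('v + 'e) star_poly" where
  "C0_seq a n = vpoly (cutoff n a)"

lemma vpoly_seq_C:
  assumes g: "\<And>n. g n \<in> finsupp" "\<And>n v. cmod (g n v - a v) \<le> B * inverse (real (Suc n))"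
  shows "(\<lambda>n. vpoly (g n)) \<in> C"
proof (rule CI)
  fix \<epsilon> :: real assume e: "\<epsilon> > 0"
  have "(\<lambda>n. B * inverse (real (Suc n))) \<longlonglongrightarrow> 0"
    using tendsto_mult_left[OF LIMSEQ_inverse_real_of_nat, of B] by simp
  from LIMSEQ_D[OF this, of "\<epsilon>/3"] e obtain N where N: "\<And>n. n \<ge> N \<Longrightarrow> \<bar>B * inverse (real (Suc n))\<bar> < \<epsilon>/3" by auto
  have "gs (vpoly (g m) - vpoly (g n)) < \<epsilon>" if "m \<ge> N" "n \<ge> N" for m n
  proof -
    have "gs (vpoly (\<lambda>v. g m v - g n v)) \<le> \<epsilon>/3 + \<epsilon>/3"
    proof (rule vpoly_norm_le)
      fix v
      have "cmod (g m v - g n v) \<le> cmod (g m v - a v) + cmod (g n v - a v)"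
        using norm_triangle_ineq4[of "g m v - a v" "g n v - a v"] by simp
      thus "cmod (g m v - g n v) \<le> \<epsilon>/3 + \<epsilon>/3" using g(2)[of m v] g(2)[of n v] N[OF that(1)] N[OF that(2)] by linarith
    qed (use g in auto)
    thus ?thesis using g e by (simp add: vpoly_diff)
  qed
  thus "\<exists>N. \<forall>m\<ge>N. \<forall>n\<ge>N. gs (vpoly (g m) - vpoly (g n)) < \<epsilon>" by blast
qed simp

lemma C0_seq_C:
  assumes "a \<in> carrier C0_alg"
  shows "C0_seq a \<in> C"
  using vpoly_seq_C[of "\<lambda>n. cutoff n a" a 1] assms cutoff_le[of _ a] by (simp add: C0_seq_def[abs_def])

definition emb :: "('v \<Rightarrow> complex) \<Rightarrow> ('v, 'e) gelem" where
  "emb a = cl (C0_seq a)"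

lemma emb_carrier: "a \<in> carrier C0_alg \<Longrightarrow> emb a \<in> carrier A"
  using C0_seq_C by (auto simp: emb_def carrier_A)

text \<open>Recognises \<open>emb a\<close> from any functions \<open>g n\<close> converging to
  \<open>a\<close> at rate B/(n+1). Each homomorphism law follows by applying the operation to
  cutoffs, with B a Lipschitz constant of that operation.\<close>

lemma emb_eqI:
  assumes a: "a \<in> carrier C0_alg" and Y: "Y \<in> C"
    and g: "\<And>n. g n \<in> finsupp" "\<And>n. gs (Y n - vpoly (g n)) = 0"
      "\<And>n v. cmod (g n v - a v) \<le> B * inverse (real (Suc n))"
  shows "cl Y = emb a"
proof -
  have "eqv Y (C0_seq a)"
  proof (rule eqv_dom[OF Y C0_seq_C[OF a]])
    fix n
    have "gs (vpoly (\<lambda>v. g n v - cutoff n a v)) \<le> (B + 1) * inverse (real (Suc n))"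
    proof (rule vpoly_norm_le)
      fix v
      have "cmod (g n v - cutoff n a v) \<le> cmod (g n v - a v) + cmod (cutoff n a v - a v)"
        using norm_triangle_ineq4[of "g n v - a v" "cutoff n a v - a v"] by simp
      also have "\<dots> \<le> B * inverse (real (Suc n)) + inverse (real (Suc n))" by (intro add_mono g cutoff_le)
      finally show "cmod (g n v - cutoff n a v) \<le> (B + 1) * inverse (real (Suc n))" by (simp add: ring_distribs)
    qed (use g a in auto)
    hence "gs (vpoly (g n) - C0_seq a n) \<le> (B + 1) * inverse (real (Suc n))"
      using g a by (simp add: vpoly_diff C0_seq_def)
    thus "gs (Y n - C0_seq a n) \<le> (B + 1) * inverse (real (Suc n))"
      using q_tri[of "Y n" "vpoly (g n)" "C0_seq a n"] g(2)[of n] C_F0[OF Y] by (simp add: C0_seq_def)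
  next
    show "(\<lambda>n. (B + 1) * inverse (real (Suc n))) \<longlonglongrightarrow> 0"
      using tendsto_mult_left[OF LIMSEQ_inverse_real_of_nat, of "B + 1"] by simp
  qed
  thus ?thesis unfolding emb_def using cl_eq_iff[OF Y C0_seq_C[OF a]] by simp
qed

lemma emb_finsupp: "f \<in> finsupp \<Longrightarrow> emb f = em (vpoly f)"
  using emb_eqI[of f "\<lambda>n. vpoly f" "\<lambda>n. f" 0] by (simp add: em_def finsupp_C0)

lemma emb_char: "emb (char_fun v) = vertex_proj r s v"
  by (simp add: emb_finsupp vpoly_char vertex_proj_em)

lemma emb_star_hom: "star_hom C0_alg A emb"
proof -
  note S = C0_seq_C
  have add: "emb (\<lambda>v. a v + b v) = emb a \<oplus>\<^bsub>A\<^esub> emb b" if "a \<in> carrier C0_alg" "b \<in> carrier C0_alg" for a b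
  proof -
    have "cl (\<lambda>n. C0_seq a n + C0_seq b n) = emb (\<lambda>v. a v + b v)"
    proof (rule emb_eqI[where g = "\<lambda>n v. cutoff n a v + cutoff n b v" and B = 2])
      fix n v
      have "cmod (cutoff n a v + cutoff n b v - (a v + b v)) \<le> cmod (cutoff n a v - a v) + cmod (cutoff n b v - b v)"
        by (metis add_diff_add norm_triangle_ineq)
      thus "cmod (cutoff n a v + cutoff n b v - (a v + b v)) \<le> 2 * inverse (real (Suc n))"
        using cutoff_le[of n a v] cutoff_le[of n b v] by linarith
    next
      show "(\<lambda>n. C0_seq a n + C0_seq b n) \<in> C" using S that by (intro C_add)
    qed (use that in \<open>auto simp: C0_closed C0_seq_def vpoly_add\<close>)
    thus ?thesis using that by (simp add: emb_def add_cl S)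
  qed
  have scale: "emb (\<lambda>v. z * a v) = z \<cdot>\<^bsub>A\<^esub> emb a" if "a \<in> carrier C0_alg" for z a
  proof -
    have "cl (\<lambda>n. scale_poly z (C0_seq a n)) = emb (\<lambda>v. z * a v)"
    proof (rule emb_eqI[where g = "\<lambda>n v. z * cutoff n a v" and B = "cmod z"])
      show "cmod (z * cutoff n a v - z * a v) \<le> cmod z * inverse (real (Suc n))" for n v
        using cutoff_le[of n a v] by (simp add: mult_left_mono Real_Vector_Spaces.norm_mult flip: right_diff_distrib del: of_nat_Suc)
    next
      show "(\<lambda>n. scale_poly z (C0_seq a n)) \<in> C" using S that by (intro C_scale)
    qed (use that in \<open>auto simp: C0_closed C0_seq_def vpoly_scale\<close>)
    thus ?thesis using that by (simp add: emb_def scale_cl S)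
  qed
  have mult: "emb (\<lambda>v. a v * b v) = emb a \<otimes>\<^bsub>A\<^esub> emb b" if ab: "a \<in> carrier C0_alg" "b \<in> carrier C0_alg" for a b
  proof -
    obtain K where K: "0 \<le> K" "\<And>v. cmod (a v) \<le> K" using C0_bounded[OF ab(1)] by blast
    obtain L where L: "0 \<le> L" "\<And>v. cmod (b v) \<le> L" using C0_bounded[OF ab(2)] by blast
    have "cl (\<lambda>n. C0_seq a n * C0_seq b n) = emb (\<lambda>v. a v * b v)"
    proof (rule emb_eqI[where g = "\<lambda>n v. cutoff n a v * cutoff n b v" and B = "L + K"])
      fix n v
      let ?i = "inverse (real (Suc n))"
      have "cutoff n a v * cutoff n b v - a v * b v = (cutoff n a v - a v) * cutoff n b v + a v * (cutoff n b v - b v)"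
        by (simp add: algebra_simps)
      hence "cmod (cutoff n a v * cutoff n b v - a v * b v)
          \<le> cmod (cutoff n a v - a v) * cmod (cutoff n b v) + cmod (a v) * cmod (cutoff n b v - b v)"
        by (metis Real_Vector_Spaces.norm_mult norm_triangle_ineq)
      also have "\<dots> \<le> ?i * L + K * ?i"
      proof -
        have "cmod (cutoff n b v) \<le> L" using cutoff_norm_le[of n b v] L(2)[of v] by linarith
        thus ?thesis using K by (intro add_mono mult_mono cutoff_le) auto
      qed
      finally show "cmod (cutoff n a v * cutoff n b v - a v * b v) \<le> (L + K) * ?i" by (simp add: algebra_simps)
    next
      show "(\<lambda>n. C0_seq a n * C0_seq b n) \<in> C" using S ab by (intro C_mult)
    qed (use ab in \<open>auto simp: C0_closed C0_seq_def vpoly_mult\<close>)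
    thus ?thesis using ab by (simp add: emb_def mult_cl S)
  qed
  have adj: "emb (\<lambda>v. cnj (a v)) = adj A (emb a)" if "a \<in> carrier C0_alg" for a
  proof -
    have "cl (\<lambda>n. adj_poly (C0_seq a n)) = emb (\<lambda>v. cnj (a v))"
    proof (rule emb_eqI[where g = "\<lambda>n v. cnj (cutoff n a v)" and B = 1])
      show "cmod (cnj (cutoff n a v) - cnj (a v)) \<le> 1 * inverse (real (Suc n))" for n v
        using cutoff_le[of n a v] by (simp flip: complex_cnj_diff del: of_nat_Suc)
    next
      show "(\<lambda>n. adj_poly (C0_seq a n)) \<in> C" using S that by (intro C_adj)
    qed (use that in \<open>auto simp: C0_closed C0_seq_def vpoly_adj\<close>)
    thus ?thesis using that by (simp add: emb_def adj_cl S)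
  qed
  have norm: "cnorm A (emb a) \<le> cnorm C0_alg a" if "a \<in> carrier C0_alg" for a
  proof -
    have "gs (C0_seq a n) \<le> cnorm C0_alg a" for n unfolding C0_seq_def
    proof (rule vpoly_norm_le)
      show "cmod (cutoff n a v) \<le> cnorm C0_alg a" for v
        using cutoff_norm_le[of n a v] C0_le_norm[OF that, of v] by linarith
    qed (use that in simp)
    thus ?thesis unfolding emb_def using LIMSEQ_le_const2[OF norm_cl[OF S[OF that]]] by blast
  qed
  show ?thesis unfolding star_hom_def
    using emb_carrier add scale mult adj norm by auto
qed

lemma C0_star_hom_diff:
  assumes h: "star_hom C0_alg A \<iota>" and a: "a \<in> carrier C0_alg" "b \<in> carrier C0_alg"
  shows "\<iota> (\<lambda>v. a v - b v) = \<iota> a \<ominus>\<^bsub>A\<^esub> \<iota> b"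
proof -
  have e: "(\<lambda>v. a v - b v) = a \<oplus>\<^bsub>C0_alg\<^esub> ((-1) \<cdot>\<^bsub>C0_alg\<^esub> b)" "(-1) \<cdot>\<^bsub>C0_alg\<^esub> b \<in> carrier C0_alg"
    using C0_closed(4)[OF a(2), of "-1"] by simp_all
  have "\<iota> a \<in> carrier A" "\<iota> b \<in> carrier A" using h a by (auto simp: star_hom_def)
  thus ?thesis unfolding e(1) using h a e(2) by (simp add: diff_scale star_hom_def del: C0_ops)
qed

lemma C0_star_hom_unique:
  assumes h: "star_hom C0_alg A \<iota>" and v: "\<And>v. \<iota> (char_fun v) = vertex_proj r s v"
    and a: "a \<in> carrier C0_alg"
  shows "\<iota> a = emb a"
proof -
  have fs: "\<iota> f = emb f" if "f \<in> finsupp" for f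
  proof -
    have "\<iota> (\<lambda>v. if v \<in> V then f v else 0) = emb (\<lambda>v. if v \<in> V then f v else 0)" if "finite V" for V
      using that
    proof (induction V rule: finite_induct)
      case empty
      \<comment> \<open>Zero is presented as a scalar multiple, the only way the homomorphism
        clauses reach it.\<close>
      have "(\<lambda>v. 0) = 0 \<cdot>\<^bsub>C0_alg\<^esub> char_fun (undefined :: 'v)" by simp
      moreover have "char_fun (undefined :: 'v) \<in> carrier C0_alg" by (intro finsupp_C0) simp
      ultimately show ?case using h emb_star_hom v emb_char unfolding star_hom_def
        by (simp del: C0_ops)
    next
      case (insert w V)
      have e: "(\<lambda>v. if v \<in> insert w V then f v else 0)
          = (f w \<cdot>\<^bsub>C0_alg\<^esub> char_fun w) \<oplus>\<^bsub>C0_alg\<^esub> (\<lambda>v. if v \<in> V then f v else 0)"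
        using insert(2) by (auto simp: char_fun_def)
      have c: "char_fun w \<in> carrier C0_alg" "(\<lambda>v. if v \<in> V then f v else 0) \<in> carrier C0_alg"
        "f w \<cdot>\<^bsub>C0_alg\<^esub> char_fun w \<in> carrier C0_alg"
        using insert(1) by (auto intro!: finsupp_C0) (auto simp: finsupp_def elim: rev_finite_subset)
      show ?case unfolding e
        using h emb_star_hom c insert.IH v emb_char unfolding star_hom_def by (simp del: C0_ops)
    qed
    from this[of "{v. f v \<noteq> 0}"] have "finite {v. f v \<noteq> 0} \<Longrightarrow>
      \<iota> (\<lambda>v. if v \<in> {v. f v \<noteq> 0} then f v else 0) = emb (\<lambda>v. if v \<in> {v. f v \<noteq> 0} then f v else 0)" .
    moreover have "(\<lambda>v. if v \<in> {v. f v \<noteq> 0} then f v else 0) = f" by auto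
    ultimately show ?thesis using that by (simp only: finsupp_def mem_Collect_eq)
  qed
  have c: "\<iota> a \<in> carrier A" "emb a \<in> carrier A" using h a emb_carrier by (auto simp: star_hom_def)
  have "cnorm A (\<iota> a \<ominus>\<^bsub>A\<^esub> emb a) \<le> 2 * inverse (real (Suc n))" for n
  proof -
    have k: "cutoff n a \<in> carrier C0_alg" using a by (intro finsupp_C0) simp
    have le: "cnorm A (\<eta> a \<ominus>\<^bsub>A\<^esub> \<eta> (cutoff n a)) \<le> inverse (real (Suc n))" "\<eta> (cutoff n a) \<in> carrier A"
      if "star_hom C0_alg A \<eta>" for \<eta>
    proof -
      have "cnorm A (\<eta> (\<lambda>v. a v - cutoff n a v)) \<le> cnorm C0_alg (\<lambda>v. a v - cutoff n a v)"
        using that C0_closed(2)[OF a k] by (simp add: star_hom_def)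
      also have "\<dots> \<le> inverse (real (Suc n))"
        using cutoff_le[of n a] by (intro C0_norm_le) (simp add: norm_minus_commute del: of_nat_Suc)
      finally show "cnorm A (\<eta> a \<ominus>\<^bsub>A\<^esub> \<eta> (cutoff n a)) \<le> inverse (real (Suc n))"
        by (simp add: C0_star_hom_diff[OF that a k] del: of_nat_Suc)
      show "\<eta> (cutoff n a) \<in> carrier A" using that k by (simp add: star_hom_def)
    qed
    have "\<iota> (cutoff n a) = emb (cutoff n a)" using a by (intro fs) simp
    thus ?thesis
      using dist_triangle[OF c(1) le(2)[OF h] c(2)] le(1)[OF h] le(1)[OF emb_star_hom]
        dist_commute[OF le(2)[OF emb_star_hom] c(2)] by simp
  qed
  moreover have "(\<lambda>n. 2 * inverse (real (Suc n))) \<longlonglongrightarrow> 0"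
    using tendsto_mult_left[OF LIMSEQ_inverse_real_of_nat, of 2] by simp
  ultimately have "cnorm A (\<iota> a \<ominus>\<^bsub>A\<^esub> emb a) \<le> 0"
    by - (rule LIMSEQ_le_const, assumption, blast)
  thus ?thesis using dist_eq_0 c by blast
qed

lemma C0_embed_emb:
  assumes "a \<in> carrier C0_alg"
  shows "C0_embed r s a = emb a"
proof -
  have "C0_embed r s = restrict emb (carrier C0_alg)"
    unfolding C0_embed_def graph_cstar_A
  proof (rule the_equality)
    have "star_hom C0_alg A (restrict emb (carrier C0_alg))"
      using emb_star_hom unfolding star_hom_def by (simp add: C0_closed)
    thus "restrict emb (carrier C0_alg) \<in> extensional (carrier C0_alg) \<and>
        star_hom C0_alg A (restrict emb (carrier C0_alg)) \<and>
        (\<forall>v. restrict emb (carrier C0_alg) (char_fun v) = vertex_proj r s v)"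
      by (simp add: emb_char finsupp_C0)
    fix \<iota> assume "\<iota> \<in> extensional (carrier C0_alg) \<and> star_hom C0_alg A \<iota> \<and> (\<forall>v. \<iota> (char_fun v) = vertex_proj r s v)"
    thus "\<iota> = restrict emb (carrier C0_alg)"
      using C0_star_hom_unique by (auto intro!: extensionalityI)
  qed
  thus ?thesis using assms by simp
qed

lemma vpoly_degree0: "vpoly f \<in> degree0"
proof -
  have "word_degree m = 0" if "m \<in> Poly_Mapping.keys (vpoly f)" for m
  proof -
    have "Poly_Mapping.lookup (vpoly f) m \<noteq> 0" using that by (simp add: in_keys_iff)
    then obtain v where "Poly_Mapping.lookup (mon [vg v] :: ('v + 'e) star_poly) m \<noteq> 0"
      unfolding vpoly_def lookup_sum by (auto elim: sum.not_neutral_contains_not_neutral)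
    thus ?thesis by (auto simp: lookup_single when_def word_degree_def letter_degree_def split: if_splits)
  qed
  thus ?thesis by (simp add: degree0_def)
qed

lemma emb_core:
  assumes "a \<in> carrier C0_alg"
  shows "emb a \<in> core"
proof -
  have "twist z (vpoly f) = vpoly f" if "cmod z = 1" for z f
  proof (rule poly_mapping_eqI)
    show "Poly_Mapping.lookup (twist z (vpoly f)) m = Poly_Mapping.lookup (vpoly f) m" for m
      using that twist_factor_degree_0[of m z] vpoly_degree0[of f]
      by (cases "m \<in> Poly_Mapping.keys (vpoly f)") (auto simp: degree0_def in_keys_iff)
  qed
  hence "rot z (emb a) = emb a" if "cmod z = 1" for z
    using rot_cl[OF C0_seq_C[OF assms] that] that by (simp add: emb_def C0_seq_def[abs_def])
  thus ?thesis using emb_carrier[OF assms] by (simp add: core_carrier)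
qed

end

section \<open>States and the conditions on traces\<close>

lemma state_bound:
  assumes st: "state B \<omega>"
    and sc: "\<And>z a. a \<in> carrier B \<Longrightarrow> z \<cdot>\<^bsub>B\<^esub> a \<in> carrier B \<and> cnorm B (z \<cdot>\<^bsub>B\<^esub> a) = cmod z * cnorm B a \<and> 0 \<le> cnorm B a"
    and a: "a \<in> carrier B"
  shows "cmod (\<omega> a) \<le> cnorm B a"
proof (rule field_le_epsilon)
  fix \<epsilon> :: real assume e: "\<epsilon> > 0"
  \<comment> \<open>Normalising by the norm plus \<epsilon> avoids division by zero.\<close>
  let ?t = "cnorm B a + \<epsilon>"
  have t: "?t > 0" using sc[OF a] e by (simp add: add_nonneg_pos)
  let ?b = "of_real (1 / ?t) \<cdot>\<^bsub>B\<^esub> a"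
  have "cnorm B ?b = \<bar>1 / ?t\<bar> * cnorm B a" using sc[OF a, of "of_real (1 / ?t)"] by (simp only: norm_of_real)
  also have "\<dots> \<le> 1" using t e by (simp add: divide_le_eq)
  finally have "cnorm B ?b \<le> 1" .
  hence m: "cmod (\<omega> ?b) \<in> {cmod (\<omega> a) | a. a \<in> carrier B \<and> cnorm B a \<le> 1}" using sc[OF a] by blast
  have "bdd_above {cmod (\<omega> a) | a. a \<in> carrier B \<and> cnorm B a \<le> 1}"
    "Sup {cmod (\<omega> a) | a. a \<in> carrier B \<and> cnorm B a \<le> 1} = 1"
    using st by (simp_all add: state_def)
  with cSup_upper[OF m] have "cmod (\<omega> ?b) \<le> 1" by simp
  moreover have "\<omega> ?b = of_real (1 / ?t) * \<omega> a" using st a by (simp add: state_def)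
  ultimately have "\<bar>1 / ?t\<bar> * cmod (\<omega> a) \<le> 1" by (simp only: norm_mult norm_of_real)
  thus "cmod (\<omega> a) \<le> ?t" using t by (simp add: divide_le_eq)
qed

lemma state_approx:
  assumes st: "state B \<omega>" and e: "\<epsilon> > 0" and b: "b \<in> carrier B" "cnorm B b \<le> 1"
  obtains a where "a \<in> carrier B" "cnorm B a \<le> 1" "1 - \<epsilon> < cmod (\<omega> a)"
proof -
  let ?S = "{cmod (\<omega> a) | a. a \<in> carrier B \<and> cnorm B a \<le> 1}"
  have ne: "?S \<noteq> {}" using b by blast
  have bdd: "bdd_above ?S" and "1 - \<epsilon> < Sup ?S" using st e by (simp_all add: state_def)
  hence "\<exists>x\<in>?S. 1 - \<epsilon> < x" by (simp only: less_cSup_iff[OF ne bdd])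
  then obtain x where "x \<in> ?S" "1 - \<epsilon> < x" ..
  thus ?thesis using that by auto
qed

lemma stateI:
  assumes "\<And>a b. a \<in> carrier B \<Longrightarrow> b \<in> carrier B \<Longrightarrow> \<omega> (a \<oplus>\<^bsub>B\<^esub> b) = \<omega> a + \<omega> b"
    and "\<And>z a. a \<in> carrier B \<Longrightarrow> \<omega> (z \<cdot>\<^bsub>B\<^esub> a) = z * \<omega> a"
    and "\<And>a. a \<in> carrier B \<Longrightarrow> \<omega> (adj B a \<otimes>\<^bsub>B\<^esub> a) \<in> \<real>\<^sub>\<ge>\<^sub>0"
    and b: "\<And>a. a \<in> carrier B \<Longrightarrow> cmod (\<omega> a) \<le> cnorm B a"
    and ap: "\<And>\<epsilon>. \<epsilon> > 0 \<Longrightarrow> \<exists>a\<in>carrier B. cnorm B a \<le> 1 \<and> 1 - \<epsilon> < cmod (\<omega> a)"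
  shows "state B \<omega>"
proof -
  let ?S = "{cmod (\<omega> a) | a. a \<in> carrier B \<and> cnorm B a \<le> 1}"
  have le: "x \<le> 1" if "x \<in> ?S" for x using that b by force
  hence bdd: "bdd_above ?S" by (auto simp: bdd_above_def)
  have "Sup ?S = 1"
  proof (rule antisym)
    show "Sup ?S \<le> 1" using ap[of 1] by (intro cSup_least le) auto
    show "1 \<le> Sup ?S"
    proof (rule field_le_epsilon)
      fix \<epsilon> :: real assume "\<epsilon> > 0"
      then obtain a where "a \<in> carrier B" "cnorm B a \<le> 1" "1 - \<epsilon> < cmod (\<omega> a)" using ap by blast
      moreover from this have "cmod (\<omega> a) \<le> Sup ?S" by (intro cSup_upper bdd) blast
      ultimately show "1 \<le> Sup ?S + \<epsilon>" by simp
    qed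
  qed
  thus ?thesis unfolding state_def using assms bdd by blast
qed

definition set_fun :: "'v set \<Rightarrow> 'v \<Rightarrow> complex" where
  "set_fun V v = of_bool (v \<in> V)"

lemma set_fun_finsupp [simp]: "finite V \<Longrightarrow> set_fun V \<in> finsupp"
  by (simp add: finsupp_def set_fun_def)

lemma char_fun_C0 [simp]: "char_fun v \<in> carrier C0_alg"
  by (rule finsupp_C0) simp

lemma C0_norm_nonneg: "a \<in> carrier C0_alg \<Longrightarrow> 0 \<le> cnorm C0_alg a"
  using C0_le_norm[of a undefined] norm_ge_zero order_trans by blast

lemma C0_norm_scale:
  assumes "a \<in> carrier C0_alg"
  shows "cnorm C0_alg (\<lambda>v. z * a v) = cmod z * cnorm C0_alg a"
proof -
  have le: "cnorm C0_alg (\<lambda>v. z * a v) \<le> cmod z * cnorm C0_alg a" if "a \<in> carrier C0_alg" for z and a :: "'a \<Rightarrow> complex"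
    using C0_le_norm[OF that] by (intro C0_norm_le) (simp add: norm_mult mult_left_mono)
  show ?thesis
  proof (cases "z = 0")
    case True
    thus ?thesis using le[OF assms, of 0] C0_norm_nonneg[OF C0_closed(4)[OF assms, of 0]] by simp
  next
    case False
    thus ?thesis using le[OF assms, of z] le[OF C0_closed(4)[OF assms, of z], of "inverse z"]
      by (simp add: norm_inverse norm_divide divide_simps mult.commute flip: mult.assoc)
  qed
qed

text \<open>A state stripped of its normalisation, which \<open>state_C0_iff\<close> then expresses
  through the vertex values alone.\<close>

locale C0_positive =
  fixes \<tau> :: "('v \<Rightarrow> complex) \<Rightarrow> complex"
  assumes add: "a \<in> carrier C0_alg \<Longrightarrow> b \<in> carrier C0_alg \<Longrightarrow> \<tau> (\<lambda>v. a v + b v) = \<tau> a + \<tau> b"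
    and scale: "a \<in> carrier C0_alg \<Longrightarrow> \<tau> (\<lambda>v. z * a v) = z * \<tau> a"
    and pos: "a \<in> carrier C0_alg \<Longrightarrow> \<tau> (\<lambda>v. cnj (a v) * a v) \<in> \<real>\<^sub>\<ge>\<^sub>0"
    and bound: "a \<in> carrier C0_alg \<Longrightarrow> cmod (\<tau> a) \<le> cnorm C0_alg a"
begin

definition t :: "'v \<Rightarrow> real" where "t v = Re (\<tau> (char_fun v))"

lemma \<tau>_char: "\<tau> (char_fun v) = of_real (t v)" and t_nonneg: "0 \<le> t v"
proof -
  have "(\<lambda>u. cnj (char_fun v u) * char_fun v u) = char_fun v" by (auto simp: char_fun_def)
  hence "\<tau> (char_fun v) \<in> \<real>\<^sub>\<ge>\<^sub>0" using pos[of "char_fun v"] by simp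
  thus "\<tau> (char_fun v) = of_real (t v)" "0 \<le> t v"
    by (auto simp: t_def complex_nonneg_Reals_iff complex_eq_iff)
qed

lemma \<tau>_0: "\<tau> (\<lambda>v. 0) = 0"
  using scale[of "char_fun undefined" 0] by simp

lemma diff:
  assumes "a \<in> carrier C0_alg" "b \<in> carrier C0_alg"
  shows "\<tau> (\<lambda>v. a v - b v) = \<tau> a - \<tau> b"
  using add[OF assms(1) C0_closed(4)[OF assms(2), of "-1"]] scale[OF assms(2), of "-1"] by simp

lemma \<tau>_restrict:
  assumes "finite V"
  shows "\<tau> (\<lambda>v. set_fun V v * f v) = (\<Sum>v\<in>V. f v * of_real (t v))"
  using assms
proof (induction V rule: finite_induct)
  case (insert w V)
  have c: "(\<lambda>v. set_fun V v * f v) \<in> carrier C0_alg"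
    using insert(1) by (intro finsupp_C0) (auto simp: finsupp_def set_fun_def)
  have "(\<lambda>v. set_fun (insert w V) v * f v) = (\<lambda>v. f w * char_fun w v + set_fun V v * f v)"
    using insert(2) by (auto simp: set_fun_def char_fun_def)
  thus ?case using insert add[OF C0_closed(4)[OF char_fun_C0[of w], of "f w"] c] scale[of "char_fun w" "f w"]
    by (simp add: \<tau>_char)
qed (simp add: set_fun_def \<tau>_0)

lemma \<tau>_set_fun: "finite V \<Longrightarrow> \<tau> (set_fun V) = of_real (sum t V)"
  using \<tau>_restrict[of V "\<lambda>v. 1"] by simp

lemma sum_t_le: "finite V \<Longrightarrow> sum t V \<le> 1"
proof -
  assume V: "finite V"
  have "cmod (\<tau> (set_fun V)) \<le> cnorm C0_alg (set_fun V :: 'v \<Rightarrow> complex)" by (intro bound finsupp_C0) (simp add: V)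
  also have "\<dots> \<le> 1" by (rule C0_norm_le) (simp add: set_fun_def)
  finally have "\<bar>sum t V\<bar> \<le> 1" unfolding \<tau>_set_fun[OF V] norm_of_real .
  thus "sum t V \<le> 1" by linarith
qed

lemma \<tau>_cutoff_le:
  assumes "a \<in> carrier C0_alg"
  shows "cmod (\<tau> a - \<tau> (cutoff n a)) \<le> inverse (real (Suc n))"
proof -
  have k: "cutoff n a \<in> carrier C0_alg" using assms by (intro finsupp_C0) simp
  have "cmod (\<tau> (\<lambda>v. a v - cutoff n a v)) \<le> cnorm C0_alg (\<lambda>v. a v - cutoff n a v)"
    by (intro bound C0_closed assms k)
  also have "\<dots> \<le> inverse (real (Suc n))"
    using cutoff_le[of n a] by (intro C0_norm_le) (simp add: norm_minus_commute del: of_nat_Suc)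
  finally show ?thesis using diff[OF assms k] by simp
qed

lemma \<tau>_finsupp:
  assumes "finite V" "{v. f v \<noteq> 0} \<subseteq> V"
  shows "\<tau> f = (\<Sum>v\<in>V. f v * of_real (t v))"
proof -
  have "(\<lambda>v. set_fun V v * f v) = f" using assms(2) by (intro ext) (auto simp: set_fun_def)
  thus ?thesis using \<tau>_restrict[OF assms(1), of f] by simp
qed

text \<open>Positivity is given on squares only. The pointwise square root again vanishes at
  infinity, as it reaches \<epsilon> exactly where \<open>b\<close> reaches the square of
  \<epsilon>.\<close>

lemma \<tau>_nonneg:
  assumes b: "b \<in> carrier C0_alg" "\<And>v. b v \<in> \<real>\<^sub>\<ge>\<^sub>0"
  shows "0 \<le> Re (\<tau> b)"
proof -
  let ?a = "\<lambda>v. complex_of_real (sqrt (Re (b v)))"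
  have r: "0 \<le> Re (b v)" "b v = of_real (Re (b v))" for v
    using b(2)[of v] by (auto simp: complex_nonneg_Reals_iff complex_eq_iff)
  have "?a \<in> carrier C0_alg" unfolding C0_carrier
  proof (intro allI impI)
    fix \<epsilon> :: real assume e: "\<epsilon> > 0"
    have "{v. \<epsilon> \<le> cmod (?a v)} \<subseteq> {v. \<epsilon>\<^sup>2 \<le> cmod (b v)}"
    proof
      fix v assume "v \<in> {v. \<epsilon> \<le> cmod (?a v)}"
      hence "\<epsilon>\<^sup>2 \<le> (sqrt (Re (b v)))\<^sup>2" using e r(1)[of v] by (intro power_mono) auto
      thus "v \<in> {v. \<epsilon>\<^sup>2 \<le> cmod (b v)}"
        using r(1)[of v] complex_Re_le_cmod[of "b v"] by simp
    qed
    moreover have "finite {v. \<epsilon>\<^sup>2 \<le> cmod (b v)}" using b(1) e by (simp add: C0_carrier)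
    ultimately show "finite {v. \<epsilon> \<le> cmod (?a v)}" by (rule finite_subset)
  qed
  moreover have "(\<lambda>v. cnj (?a v) * ?a v) = b" using r by (auto simp flip: of_real_mult)
  ultimately show ?thesis using pos[of ?a] by (simp add: complex_nonneg_Reals_iff)
qed

lemma restrict_le:
  assumes "a \<in> carrier C0_alg" "\<And>v. a v \<in> \<real>\<^sub>\<ge>\<^sub>0" "finite V"
  shows "(\<Sum>v\<in>V. Re (a v) * t v) \<le> Re (\<tau> a)"
proof -
  have c: "(\<lambda>v. set_fun V v * a v) \<in> carrier C0_alg"
    using assms(3) by (intro finsupp_C0) (auto simp: finsupp_def set_fun_def)
  have "0 \<le> Re (\<tau> (\<lambda>v. a v - set_fun V v * a v))"
    using assms(2) by (intro \<tau>_nonneg C0_closed(2)[OF assms(1) c]) (auto simp: set_fun_def)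
  thus ?thesis using diff[OF assms(1) c] \<tau>_restrict[OF assms(3), of a] by simp
qed

end

text \<open>A function of norm at most 1 is, up to 1/(n+1), finitely supported, and there its value
  is dominated by the sum of the \<open>t v\<close> over the support. Conversely, indicators of
  finite sets have norm at most 1.\<close>

lemma state_C0_iff:
  "state C0_alg \<tau> \<longleftrightarrow> C0_positive \<tau> \<and> (\<forall>\<epsilon>>0. \<exists>V. finite V \<and> 1 - \<epsilon> < (\<Sum>v\<in>V. Re (\<tau> (char_fun v))))"
proof
  assume st: "state C0_alg \<tau>"
  interpret C0_positive \<tau>
  proof
    show "cmod (\<tau> a) \<le> cnorm C0_alg a" if "a \<in> carrier C0_alg" for a
      by (rule state_bound[OF st _ that]) (simp add: C0_closed C0_norm_scale C0_norm_nonneg)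
  qed (use st in \<open>simp_all add: state_def\<close>)
  have "\<exists>V. finite V \<and> 1 - \<epsilon> < sum t V" if e: "\<epsilon> > 0" for \<epsilon>
  proof -
    obtain a where a: "a \<in> carrier C0_alg" "cnorm C0_alg a \<le> 1" "1 - \<epsilon>/2 < cmod (\<tau> a)"
      by (rule state_approx[OF st half_gt_zero[OF e] finsupp_C0[OF finsupp_closed(6)]]) (auto intro: C0_norm_le)
    obtain n where n: "inverse (real (Suc n)) < \<epsilon>/2" using reals_Archimedean[of "\<epsilon>/2"] e by auto
    let ?V = "{v. cutoff n a v \<noteq> 0}"
    have V: "finite ?V" using cutoff_finsupp[OF a(1), of n] by (simp add: finsupp_def)
    have "cmod (\<tau> a) \<le> cmod (\<tau> (cutoff n a)) + inverse (real (Suc n))"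
      using \<tau>_cutoff_le[OF a(1), of n] norm_triangle_ineq2[of "\<tau> a" "\<tau> (cutoff n a)"] by linarith
    also have "cmod (\<tau> (cutoff n a)) \<le> (\<Sum>v\<in>?V. cmod (cutoff n a v * of_real (t v)))"
      unfolding \<tau>_finsupp[OF V subset_refl] by (rule norm_sum)
    also have "\<dots> \<le> sum t ?V"
    proof (rule sum_mono)
      fix v
      have "cmod (cutoff n a v) \<le> 1" using cutoff_norm_le[of n a v] C0_le_norm[OF a(1), of v] a(2) by linarith
      thus "cmod (cutoff n a v * of_real (t v)) \<le> t v"
        using t_nonneg[of v] by (simp add: norm_mult mult_left_le_one_le)
    qed
    finally have "1 - \<epsilon> < sum t ?V" using a(3) n by linarith
    thus ?thesis using V by blast
  qed
  thus "C0_positive \<tau> \<and> (\<forall>\<epsilon>>0. \<exists>V. finite V \<and> 1 - \<epsilon> < (\<Sum>v\<in>V. Re (\<tau> (char_fun v))))"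
    using C0_positive_axioms by (simp add: t_def)
next
  assume A: "C0_positive \<tau> \<and> (\<forall>\<epsilon>>0. \<exists>V. finite V \<and> 1 - \<epsilon> < (\<Sum>v\<in>V. Re (\<tau> (char_fun v))))"
  then interpret C0_positive \<tau> by blast
  show "state C0_alg \<tau>"
  proof (rule stateI)
    fix \<epsilon> :: real assume "\<epsilon> > 0"
    then obtain V where V: "finite V" "1 - \<epsilon> < sum t V" using A by (auto simp: t_def)
    have "cnorm C0_alg (set_fun V :: 'a \<Rightarrow> complex) \<le> 1" by (rule C0_norm_le) (simp add: set_fun_def)
    moreover have "1 - \<epsilon> < cmod (\<tau> (set_fun V))"
      unfolding \<tau>_set_fun[OF V(1)] norm_of_real using V(2) by linarith
    ultimately show "\<exists>a\<in>carrier C0_alg. cnorm C0_alg a \<le> 1 \<and> 1 - \<epsilon> < cmod (\<tau> a)"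
      using V(1) by (intro bexI[of _ "set_fun V"]) (auto intro: finsupp_C0)
  qed (simp_all add: add scale pos bound)
qed

lemma tracial_state_C0_iff: "tracial_state C0_alg \<tau> \<longleftrightarrow> state C0_alg \<tau>"
  by (simp add: tracial_state_def mult.commute)

lemma abelian_group_C0: "abelian_group C0_alg"
proof (rule abelian_groupI)
  fix x :: "'a \<Rightarrow> complex" assume "x \<in> carrier C0_alg"
  thus "\<exists>y\<in>carrier C0_alg. y \<oplus>\<^bsub>C0_alg\<^esub> x = \<zero>\<^bsub>C0_alg\<^esub>"
    using C0_closed(4)[of x "-1"] by (intro bexI[of _ "\<lambda>v. - 1 * x v"]) auto
qed (use finsupp_C0[OF finsupp_closed(6)] in \<open>auto simp: C0_closed algebra_simps\<close>)

lemma C0_minus: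
  fixes a b :: "'v \<Rightarrow> complex"
  assumes "a \<in> carrier C0_alg" "b \<in> carrier C0_alg"
  shows "a \<ominus>\<^bsub>C0_alg\<^esub> b = (\<lambda>v. a v - b v)"
proof -
  interpret abelian_group "C0_alg :: ('v \<Rightarrow> complex) cstar" by (rule abelian_group_C0)
  have "(\<lambda>v. - b v) \<in> carrier C0_alg" using C0_closed(4)[OF assms(2), of "-1"] by simp
  hence "\<ominus>\<^bsub>C0_alg\<^esub> b = (\<lambda>v. - b v)" using assms by (intro minus_equality) auto
  thus ?thesis by (simp add: a_minus_def)
qed

text \<open>Evaluation at \<open>v\<close> is continuous and vanishes on the span. For (K1) this
  confines a function to the regular vertices.\<close>

lemma C0_closed_cspan_zero:
  fixes a :: "'v \<Rightarrow> complex"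
  assumes "a \<in> closed_cspan C0_alg {char_fun v | v. P v}" "\<not> P v"
  shows "a v = 0"
proof -
  interpret abelian_group "C0_alg :: ('v \<Rightarrow> complex) cstar" by (rule abelian_group_C0)
  have a: "a \<in> carrier C0_alg" using assms(1) by (simp add: closed_cspan_def)
  have z: "b \<in> carrier C0_alg \<and> b v = 0" if "b \<in> cspan C0_alg {char_fun v | v. P v}" for b
  proof -
    obtain D z where D: "finite D" "D \<subseteq> {char_fun v | v. P v}" "b = (\<Oplus>\<^bsub>C0_alg\<^esub>x\<in>D. z x \<cdot>\<^bsub>C0_alg\<^esub> x)"
      using \<open>b \<in> _\<close> by (auto simp: cspan_def)
    have "(\<Oplus>\<^bsub>C0_alg\<^esub>x\<in>D. z x \<cdot>\<^bsub>C0_alg\<^esub> x) \<in> carrier C0_alg \<and> (\<Oplus>\<^bsub>C0_alg\<^esub>x\<in>D. z x \<cdot>\<^bsub>C0_alg\<^esub> x) v = 0"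
      using D(1,2)
    proof (induction D rule: finite_induct)
      case empty
      show ?case using zero_closed by simp
    next
      case (insert x D)
      obtain u where u: "x = char_fun u" "P u" using insert.prems by blast
      have x: "x \<in> carrier C0_alg" "x v = 0" using u assms(2) by (simp, auto simp: char_fun_def)
      have "D \<subseteq> carrier C0_alg" using insert.prems by auto
      hence c: "(\<lambda>x. z x \<cdot>\<^bsub>C0_alg\<^esub> x) \<in> D \<rightarrow> carrier C0_alg" "z x \<cdot>\<^bsub>C0_alg\<^esub> x \<in> carrier C0_alg"
        using C0_closed(4)[OF x(1)] by (auto intro!: C0_closed(4))
      have "(\<Oplus>\<^bsub>C0_alg\<^esub>x\<in>insert x D. z x \<cdot>\<^bsub>C0_alg\<^esub> x)
          = z x \<cdot>\<^bsub>C0_alg\<^esub> x \<oplus>\<^bsub>C0_alg\<^esub> (\<Oplus>\<^bsub>C0_alg\<^esub>x\<in>D. z x \<cdot>\<^bsub>C0_alg\<^esub> x)"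
        by (rule finsum_insert[OF insert(1,2) c(1), OF c(2)])
      thus ?case using insert x c(2) by (auto intro!: C0_closed(1))
    qed
    thus ?thesis using D(3) by simp
  qed
  have "cmod (a v) \<le> 0"
  proof (rule field_le_epsilon)
    fix \<epsilon> :: real assume "\<epsilon> > 0"
    then obtain b where b: "b \<in> cspan C0_alg {char_fun v | v. P v}" "cnorm C0_alg (a \<ominus>\<^bsub>C0_alg\<^esub> b) < \<epsilon>"
      using assms(1) by (auto simp: closed_cspan_def)
    have "cmod (a v - b v) \<le> cnorm C0_alg (\<lambda>v. a v - b v)"
      using z[OF b(1)] a by (intro C0_le_norm[where v = v] C0_closed(2)) auto
    thus "cmod (a v) \<le> 0 + \<epsilon>" using z[OF b(1)] b(2) C0_minus[OF a, of b] by simp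
  qed
  thus ?thesis by simp
qed

lemma char_fun_closed_cspan:
  fixes v :: 'v
  assumes "P v"
  shows "char_fun v \<in> closed_cspan C0_alg {char_fun v | v. P v}"
proof -
  interpret abelian_group "C0_alg :: ('v \<Rightarrow> complex) cstar" by (rule abelian_group_C0)
  have "(\<Oplus>\<^bsub>C0_alg\<^esub>x\<in>{char_fun v}. 1 \<cdot>\<^bsub>C0_alg\<^esub> x) = (char_fun v :: 'v \<Rightarrow> complex)"
  proof -
    have "(\<Oplus>\<^bsub>C0_alg\<^esub>x\<in>{char_fun v}. 1 \<cdot>\<^bsub>C0_alg\<^esub> x)
        = (1 \<cdot>\<^bsub>C0_alg\<^esub> char_fun v) \<oplus>\<^bsub>C0_alg\<^esub> (\<Oplus>\<^bsub>C0_alg\<^esub>x\<in>{}. 1 \<cdot>\<^bsub>C0_alg\<^esub> (x :: 'v \<Rightarrow> complex))"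
      by (rule finsum_insert) auto
    thus ?thesis by simp
  qed
  hence "char_fun v \<in> cspan C0_alg {char_fun v | v. P v}"
    unfolding cspan_def using assms by (intro CollectI exI[of _ "{char_fun v}"] exI[of _ "\<lambda>x. 1"]) auto
  moreover have "cnorm C0_alg (char_fun v \<ominus>\<^bsub>C0_alg\<^esub> char_fun v :: 'v \<Rightarrow> complex) \<le> 0"
    unfolding C0_minus[OF char_fun_C0 char_fun_C0] by (rule C0_norm_le) simp
  ultimately show ?thesis unfolding closed_cspan_def by (auto intro!: bexI[of _ "char_fun v"])
qed

text \<open>The conditions (K1) and (K2) for the values \<open>t\<^sub>v\<close> of a trace at the vertices.\<close>

definition edge_conditions :: "('e \<Rightarrow> 'v) \<Rightarrow> ('e \<Rightarrow> 'v) \<Rightarrow> ('e \<Rightarrow> real) \<Rightarrow> ('v \<Rightarrow> real) \<Rightarrow> bool" where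
  "edge_conditions r s w t \<longleftrightarrow>
     (\<forall>v D. finite D \<and> D \<subseteq> r -` {v} \<longrightarrow> (\<Sum>e\<in>D. w e * t (s e)) \<le> t v) \<and>
     (\<forall>v. finite (r -` {v}) \<and> r -` {v} \<noteq> {} \<longrightarrow> (\<Sum>e\<in>r -` {v}. w e * t (s e)) = t v)"

section \<open>The trace transform in terms of vertex values\<close>

lemma edge_inner_char:
  "edge_inner s (char_fun e) ((left_act r a \<circ> mult_op m) (char_fun e))
     = (\<lambda>v. (a (r e) * of_real (m e)) * char_fun (s e) v)"
proof
  fix v
  let ?f = "\<lambda>e'. cnj (char_fun e e') * ((left_act r a \<circ> mult_op m) (char_fun e)) e'"
  have "infsum ?f (s -` {v}) = infsum ?f (s -` {v} \<inter> {e})"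
    by (rule infsum_cong_neutral) (auto simp: char_fun_def)
  also have "\<dots> = (if e \<in> s -` {v} then ?f e else 0)" by auto
  finally have "infsum ?f (s -` {v}) = (if e \<in> s -` {v} then ?f e else 0)" .
  thus "edge_inner s (char_fun e) ((left_act r a \<circ> mult_op m) (char_fun e)) v
      = (a (r e) * of_real (m e)) * char_fun (s e) v"
    unfolding edge_inner_def by (auto simp: char_fun_def left_act_def mult_op_def)
qed

context C0_positive
begin

context
  fixes r s :: "'e \<Rightarrow> 'v" and c :: "'e \<Rightarrow> real" and \<beta> :: real
begin

abbreviation "u e \<equiv> c e powr - \<beta> * t (s e)"

lemma u_nonneg: "0 \<le> u e"
  by (simp add: t_nonneg)

lemma trace_term: "\<tau> (edge_inner s (char_fun e) ((left_act r a \<circ> mult_op (\<lambda>e. c e powr - \<beta>)) (char_fun e)))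
    = a (r e) * of_real (u e)"
  unfolding edge_inner_char by (simp add: scale \<tau>_char)

lemma trace_transform_sum: "trace_transform r s c \<beta> \<tau> a = (\<Sum>\<^sub>\<infinity>e. a (r e) * of_real (u e))"
  unfolding trace_transform_def trace_of_def trace_term ..

lemma trace_transform_pos_sum: "trace_transform_pos r s c \<beta> \<tau> a = (\<Sum>\<^sub>\<infinity>e. ennreal (Re (a (r e)) * u e))"
  unfolding trace_transform_pos_def trace_pos_def trace_term by simp

text \<open>Both conditions are tested on characteristic functions of single vertices; a finite
  partial sum lies below the infinite one.\<close>

lemma edge_conditions_if_K:
  assumes K1: "cond_K1 r s c \<beta> \<tau>" and K2: "cond_K2 r s c \<beta> \<tau>"
  shows "edge_conditions r s (\<lambda>e. c e powr - \<beta>) t"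
  unfolding edge_conditions_def
proof (intro conjI allI impI; elim conjE)
  fix v D assume D: "finite D" "D \<subseteq> r -` {v}"
  have "ennreal (sum u D) = (\<Sum>e\<in>D. ennreal (u e))" by (rule sum_ennreal[symmetric]) (rule u_nonneg)
  also have "\<dots> = (\<Sum>e\<in>D. ennreal (Re (char_fun v (r e)) * u e))"
  proof (rule sum.cong[OF refl])
    fix e assume "e \<in> D"
    hence "r e = v" using D(2) by blast
    thus "ennreal (u e) = ennreal (Re (char_fun v (r e)) * u e)" by (simp add: char_fun_def)
  qed
  also have "\<dots> \<le> (\<Sum>\<^sub>\<infinity>e. ennreal (Re (char_fun v (r e)) * u e))"
    using D by (subst nonneg_infsum_complete) (auto intro!: SUP_upper)
  also have "\<dots> \<le> ennreal (t v)"
  proof -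
    have "\<forall>u. char_fun v u \<in> \<real>\<^sub>\<ge>\<^sub>0" by (simp add: char_fun_def)
    hence "trace_transform_pos r s c \<beta> \<tau> (char_fun v) \<le> ennreal (Re (\<tau> (char_fun v)))"
      by (rule mp[OF bspec[OF K2[unfolded cond_K2_def] char_fun_C0]])
    thus ?thesis by (simp only: trace_transform_pos_sum t_def)
  qed
  finally show "sum u D \<le> t v" using t_nonneg by (simp add: ennreal_le_iff)
next
  fix v assume v: "finite (r -` {v})" "r -` {v} \<noteq> {}"
  have "char_fun v \<in> closed_cspan C0_alg {char_fun v | v. finite (r -` {v}) \<and> r -` {v} \<noteq> {}}"
    using v by (intro char_fun_closed_cspan) simp
  from bspec[OF K1[unfolded cond_K1_def] this]
  have "(\<Sum>\<^sub>\<infinity>e. char_fun v (r e) * of_real (u e)) = of_real (t v)"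
    by (simp only: trace_transform_sum \<tau>_char)
  also have "(\<Sum>\<^sub>\<infinity>e. char_fun v (r e) * complex_of_real (u e)) = (\<Sum>\<^sub>\<infinity>e\<in>r -` {v}. complex_of_real (u e))"
    by (rule infsum_cong_neutral) (auto simp: char_fun_def)
  also have "\<dots> = of_real (\<Sum>e\<in>r -` {v}. u e)" using v by simp
  finally show "(\<Sum>e\<in>r -` {v}. u e) = t v" by (simp only: of_real_eq_iff)
qed

lemma K_if_edge_conditions:
  assumes E: "edge_conditions r s (\<lambda>e. c e powr - \<beta>) t"
  shows "cond_K1 r s c \<beta> \<tau>" "cond_K2 r s c \<beta> \<tau>"
proof -
  \<comment> \<open>Grouping the edges by their range turns the inequality at each vertex into one
    weighted by \<open>f\<close>.\<close>
  have fin: "(\<Sum>e\<in>D. f (r e) * u e) \<le> (\<Sum>v\<in>r ` D. f v * t v)" if "finite D" "\<And>v. 0 \<le> f v" for D f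
  proof -
    have "(\<Sum>e\<in>D. f (r e) * u e) = (\<Sum>v\<in>r ` D. \<Sum>e\<in>{e\<in>D. r e = v}. f (r e) * u e)"
      using that(1) by (rule sum.image_gen)
    also have "\<dots> = (\<Sum>v\<in>r ` D. f v * (\<Sum>e\<in>{e\<in>D. r e = v}. u e))"
      by (simp add: sum_distrib_left)
    also have "\<dots> \<le> (\<Sum>v\<in>r ` D. f v * t v)"
    proof (intro sum_mono mult_left_mono that(2))
      fix v
      have "finite {e\<in>D. r e = v}" "{e\<in>D. r e = v} \<subseteq> r -` {v}" using that(1) by auto
      thus "(\<Sum>e\<in>{e\<in>D. r e = v}. u e) \<le> t v" using E unfolding edge_conditions_def by blast
    qed
    finally show ?thesis .
  qed
  show K2: "cond_K2 r s c \<beta> \<tau>" unfolding cond_K2_def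
  proof (intro ballI impI)
    fix a :: "'v \<Rightarrow> complex" assume a: "a \<in> carrier C0_alg" "\<forall>v. a v \<in> \<real>\<^sub>\<ge>\<^sub>0"
    hence n: "0 \<le> Re (a v)" for v by (simp add: complex_nonneg_Reals_iff)
    show "trace_transform_pos r s c \<beta> \<tau> a \<le> ennreal (Re (\<tau> a))"
      unfolding trace_transform_pos_sum
    proof (subst nonneg_infsum_complete, simp, rule SUP_least)
      fix D assume "D \<in> {F. finite F \<and> F \<subseteq> (UNIV :: 'e set)}"
      hence D: "finite D" by simp
      have "(\<Sum>e\<in>D. ennreal (Re (a (r e)) * u e)) = ennreal (\<Sum>e\<in>D. Re (a (r e)) * u e)"
        using n u_nonneg by (intro sum_ennreal) simp
      also have "\<dots> \<le> ennreal (Re (\<tau> a))"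
        using fin[OF D, of "\<lambda>v. Re (a v)"] n restrict_le[OF a(1), of "r ` D"] a(2) D by (intro ennreal_leI) fastforce
      finally show "(\<Sum>e\<in>D. ennreal (Re (a (r e)) * u e)) \<le> ennreal (Re (\<tau> a))" .
    qed
  qed
  \<comment> \<open>With f = 1, the edge masses total at most 1; every bounded function on the
    vertices then has an absolutely convergent transform.\<close>
  have ub: "sum u D \<le> 1" if "finite D" for D
    using fin[OF that, of "\<lambda>v. 1"] sum_t_le[of "r ` D"] that by simp
  have us: "u summable_on UNIV"
    by (rule nonneg_bdd_above_summable_on) (use u_nonneg ub in \<open>auto intro!: bdd_aboveI2\<close>)
  have u1: "infsum u UNIV \<le> 1" by (rule infsum_le_finite_sums[OF us]) (simp add: ub)
  have bd: "(\<lambda>e. norm (b (r e) * complex_of_real (u e))) summable_on UNIV \<and> (\<lambda>e. b (r e) * complex_of_real (u e)) summable_on UNIV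
      \<and> cmod (\<Sum>\<^sub>\<infinity>e. b (r e) * complex_of_real (u e)) \<le> K" if "\<And>v. cmod (b v) \<le> K" for b K
  proof -
    have K: "0 \<le> K" using that[of undefined] norm_ge_zero order_trans by blast
    have le: "norm (b (r e) * complex_of_real (u e)) \<le> K * u e" for e
    proof -
      have "norm (b (r e) * complex_of_real (u e)) = cmod (b (r e)) * u e"
        by (simp only: norm_mult[of "b (r e)"] norm_of_real abs_of_nonneg[OF u_nonneg])
      thus ?thesis using that[of "r e"] u_nonneg[of e] by (simp only:) (rule mult_right_mono)
    qed
    have Ks: "(\<lambda>e. K * u e) summable_on UNIV" by (rule summable_on_cmult_right[OF us])
    have s: "(\<lambda>e. norm (b (r e) * complex_of_real (u e))) summable_on UNIV"
      by (rule summable_on_comparison_test[OF Ks le]) simp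
    have "cmod (\<Sum>\<^sub>\<infinity>e. b (r e) * complex_of_real (u e)) \<le> (\<Sum>\<^sub>\<infinity>e. norm (b (r e) * complex_of_real (u e)))"
      by (rule norm_infsum_bound[OF s])
    also have "\<dots> \<le> (\<Sum>\<^sub>\<infinity>e. K * u e)" by (rule infsum_mono[OF s Ks le])
    also have "\<dots> = K * infsum u UNIV" by (rule infsum_cmult_right[OF us])
    also have "\<dots> \<le> K" using u1 K by (simp add: mult_left_le)
    finally show ?thesis using s abs_summable_summable[OF s] by blast
  qed
  show "cond_K1 r s c \<beta> \<tau>" unfolding cond_K1_def
  proof (intro ballI conjI)
    fix a assume a: "a \<in> closed_cspan C0_alg {char_fun v |v. finite (r -` {v}) \<and> r -` {v} \<noteq> {}}"
    hence ac: "a \<in> carrier C0_alg" by (simp add: closed_cspan_def)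
    have "(\<lambda>v. complex_of_real (cmod (a v))) \<in> carrier C0_alg" using ac by (simp add: C0_carrier)
    from mp[OF bspec[OF K2[unfolded cond_K2_def] this]]
    have "trace_transform_pos r s c \<beta> \<tau> (\<lambda>v. of_real (cmod (a v))) \<le> ennreal (Re (\<tau> (\<lambda>v. of_real (cmod (a v)))))"
      by simp
    thus "trace_transform_pos r s c \<beta> \<tau> (\<lambda>v. of_real (cmod (a v))) < \<infinity>"
      by (rule order_le_less_trans) simp
    \<comment> \<open>Both sides are compared with their values at the cutoff, each within 1/(n+1),
      and there they coincide.\<close>
    have "cmod (trace_transform r s c \<beta> \<tau> a - \<tau> a) \<le> 2 * inverse (real (Suc n))" for n
    proof -
      let ?k = "cutoff n a" and ?V = "{v. cutoff n a v \<noteq> 0}"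
      have V: "finite ?V" using cutoff_finsupp[OF ac, of n] by (simp add: finsupp_def)
      \<comment> \<open>The cutoff lives on finitely many regular vertices, so only finitely many
        edges contribute and the equality at each vertex applies.\<close>
      have reg: "finite (r -` {v}) \<and> r -` {v} \<noteq> {}" if "v \<in> ?V" for v
        using C0_closed_cspan_zero[OF a, of v] that by (auto simp: cutoff_def split: if_splits)
      have fV: "finite (r -` ?V)"
      proof -
        have "r -` ?V = (\<Union>v\<in>?V. r -` {v})" by auto
        thus ?thesis using V reg by simp
      qed
      have "(\<Sum>\<^sub>\<infinity>e. ?k (r e) * complex_of_real (u e)) = (\<Sum>e\<in>r -` ?V. ?k (r e) * complex_of_real (u e))"
      proof -
        have "(\<Sum>\<^sub>\<infinity>e. ?k (r e) * complex_of_real (u e)) = (\<Sum>\<^sub>\<infinity>e\<in>r -` ?V. ?k (r e) * complex_of_real (u e))"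
          by (rule infsum_cong_neutral) auto
        thus ?thesis using fV by simp
      qed
      also have "\<dots> = (\<Sum>v\<in>?V. \<Sum>e\<in>{e \<in> r -` ?V. r e = v}. ?k (r e) * complex_of_real (u e))"
        using fV V by (intro sum.group[symmetric]) auto
      also have "\<dots> = (\<Sum>v\<in>?V. ?k v * of_real (t v))"
      proof (intro sum.cong refl)
        fix v assume v: "v \<in> ?V"
        have "{e \<in> r -` ?V. r e = v} = r -` {v}" using v by auto
        hence "(\<Sum>e\<in>{e \<in> r -` ?V. r e = v}. ?k (r e) * complex_of_real (u e)) = (\<Sum>e\<in>r -` {v}. ?k v * complex_of_real (u e))"
          by simp
        also have "\<dots> = ?k v * of_real (\<Sum>e\<in>r -` {v}. u e)" by (simp add: sum_distrib_left)
        also have "(\<Sum>e\<in>r -` {v}. u e) = t v" using E reg[OF v] unfolding edge_conditions_def by blast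
        finally show "(\<Sum>e\<in>{e \<in> r -` ?V. r e = v}. ?k (r e) * complex_of_real (u e)) = ?k v * of_real (t v)" .
      qed
      also have "\<dots> = \<tau> ?k" by (rule \<tau>_finsupp[OF V subset_refl, symmetric])
      finally have k: "(\<Sum>\<^sub>\<infinity>e. ?k (r e) * complex_of_real (u e)) = \<tau> ?k" .
      obtain K where K: "\<And>v. cmod (a v) \<le> K" using C0_bounded[OF ac] by blast
      note kb = bd[of "\<lambda>v. ?k v - a v", OF cutoff_le]
      have "(\<Sum>\<^sub>\<infinity>e. (?k (r e) - a (r e)) * complex_of_real (u e) + a (r e) * complex_of_real (u e))
          = (\<Sum>\<^sub>\<infinity>e. (?k (r e) - a (r e)) * complex_of_real (u e)) + (\<Sum>\<^sub>\<infinity>e. a (r e) * complex_of_real (u e))"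
        by (rule infsum_add[OF conjunct1[OF conjunct2[OF kb]] conjunct1[OF conjunct2[OF bd[where b = a, OF K]]]])
      moreover have "(?k (r e) - a (r e)) * complex_of_real (u e) + a (r e) * complex_of_real (u e)
          = ?k (r e) * complex_of_real (u e)" for e by (simp only: left_diff_distrib diff_add_cancel)
      ultimately have "\<tau> ?k - trace_transform r s c \<beta> \<tau> a
          = (\<Sum>\<^sub>\<infinity>e. (?k (r e) - a (r e)) * complex_of_real (u e))"
        by (simp only: trace_transform_sum k add_diff_cancel_right')
      moreover have "cmod (\<Sum>\<^sub>\<infinity>e. (?k (r e) - a (r e)) * complex_of_real (u e)) \<le> inverse (real (Suc n))"
        by (rule conjunct2[OF conjunct2[OF kb]])
      ultimately have 1: "cmod (\<tau> ?k - trace_transform r s c \<beta> \<tau> a) \<le> inverse (real (Suc n))"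
        by (simp only:)
      have "cmod (trace_transform r s c \<beta> \<tau> a - \<tau> a) \<le> cmod (\<tau> ?k - trace_transform r s c \<beta> \<tau> a) + cmod (\<tau> a - \<tau> ?k)"
        using norm_triangle_ineq4[of "\<tau> ?k - trace_transform r s c \<beta> \<tau> a" "\<tau> ?k - \<tau> a"]
        by (simp add: norm_minus_commute)
      thus ?thesis using 1 \<tau>_cutoff_le[OF ac, of n] by linarith
    qed
    moreover have "(\<lambda>n. 2 * inverse (real (Suc n))) \<longlonglongrightarrow> 0"
      using tendsto_mult_left[OF LIMSEQ_inverse_real_of_nat, of 2] by simp
    ultimately have "cmod (trace_transform r s c \<beta> \<tau> a - \<tau> a) \<le> 0"
      by - (rule LIMSEQ_le_const, assumption, blast)
    thus "trace_transform r s c \<beta> \<tau> a = \<tau> a" by simp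
  qed
qed

end

end

lemma K_iff_edge_conditions:
  assumes "state C0_alg \<tau>"
  shows "cond_K1 r s c \<beta> \<tau> \<and> cond_K2 r s c \<beta> \<tau> \<longleftrightarrow>
    edge_conditions r s (\<lambda>e. c e powr - \<beta>) (\<lambda>v. Re (\<tau> (char_fun v)))"
proof -
  interpret C0_positive \<tau> using assms by (simp add: state_C0_iff)
  show ?thesis using edge_conditions_if_K[of r s c \<beta>] K_if_edge_conditions[of r s c \<beta>] by (auto simp: t_def[abs_def])
qed

section \<open>States on the core\<close>

lemma pth_source: "pth r s \<mu> u \<Longrightarrow> \<mu> \<noteq> [] \<Longrightarrow> u = s (last \<mu>)"
  by (induction \<mu>) auto

lemma pth_iff_nth:
  "\<mu> \<noteq> [] \<Longrightarrow> pth r s \<mu> (s (last \<mu>)) \<longleftrightarrow> (\<forall>i. Suc i < length \<mu> \<longrightarrow> r (\<mu> ! Suc i) = s (\<mu> ! i))"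
proof (induction \<mu> rule: list_nonempty_induct)
  case (cons e \<mu>)
  then obtain f \<mu>' where \<mu>: "\<mu> = f # \<mu>'" by (cases \<mu>) auto
  have "(\<forall>i. Suc i < length (e # \<mu>) \<longrightarrow> r ((e # \<mu>) ! Suc i) = s ((e # \<mu>) ! i)) \<longleftrightarrow>
      (\<forall>i<Suc (length \<mu>'). r ((e # \<mu>) ! Suc i) = s ((e # \<mu>) ! i))" using \<mu> by simp
  also have "\<dots> \<longleftrightarrow> r f = s e \<and> (\<forall>i<length \<mu>'. r (\<mu> ! Suc i) = s (\<mu> ! i))"
    unfolding All_less_Suc2 using \<mu> by simp
  finally show ?case using cons \<mu> by auto
qed simp

lemma act1_degree: "act1 r s v l es = Some es' \<Longrightarrow> int (length es') = int (length es) + letter_degree l"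
  by (cases "(r, s, v, l, es)" rule: act1.cases) (auto simp: letter_degree_def split: if_splits)

lemma act_degree: "act r s v ls es = Some es' \<Longrightarrow> int (length es') = int (length es) + word_degree (Letters ls)"
  by (induction ls arbitrary: es') (auto simp: word_degree_def bind_eq_Some_conv dest!: act1_degree)

lemma word_degree_add: "word_degree (m + m') = word_degree m + word_degree m'"
  by (simp add: word_degree_def plus_monomial_def)

lemma word_degree_adj:
  fixes m :: "('v + 'e) monomial"
  shows "word_degree (adj_mono m) = - word_degree m"
proof -
  have l: "letter_degree (flip_letter l) = - letter_degree l" for l :: "('v + 'e) letter"
    by (auto simp: letter_degree_def split: letter.split sum.split)
  have "sum_list (map letter_degree (rev (map flip_letter ls))) = - sum_list (map letter_degree ls)"
    for ls :: "('v + 'e) letter list"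
    by (induction ls) (auto simp: l)
  thus ?thesis by (simp add: word_degree_def adj_mono_def)
qed

definition path_of :: "'e list \<Rightarrow> 'v \<Rightarrow> ('v, 'e) path" where
  "path_of \<mu> u = (if \<mu> = [] then Vertex u else Edges \<mu>)"

primrec path_edges :: "('v, 'e) path \<Rightarrow> 'e list" where
  "path_edges (Vertex v) = []"
| "path_edges (Edges \<mu>) = \<mu>"

lemma path_of_props:
  assumes "pth r s \<mu> u"
  shows "is_path r s (path_of \<mu> u)" "path_length (path_of \<mu> u) = length \<mu>" "path_source s (path_of \<mu> u) = u"
    "path_weight c (path_of \<mu> u) = prod_list (map c \<mu>)"
  using assms pth_source[OF assms] pth_iff_nth[of \<mu> r s] by (auto simp: path_of_def)

lemma path_of_inject: "path_of \<mu> u = path_of \<nu> u \<longleftrightarrow> \<mu> = \<nu>"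
  by (auto simp: path_of_def)

lemma path_edges_pth:
  assumes "is_path r s p"
  shows "pth r s (path_edges p) (path_source s p)" "path_of (path_edges p) (path_source s p) = p"
  using assms pth_iff_nth[of "path_edges p" r s] by (cases p; auto simp: path_of_def)+

context free_cstar_seminorm
begin

lemma cnorm_le_dist:
  assumes "a \<in> carrier A" "b \<in> carrier A"
  shows "cnorm A b \<le> cnorm A a + cnorm A (a \<ominus>\<^bsub>A\<^esub> b)"
proof -
  have z: "d \<ominus>\<^bsub>A\<^esub> \<zero>\<^bsub>A\<^esub> = d" if "d \<in> carrier A" for d
    using that by (auto elim!: carrierE simp: zero_A diff_cl)
  show ?thesis using dist_triangle[OF assms(2,1) closed(6)] z assms dist_commute[OF assms] by simp
qed

end

context graph_algebra
begin

lemma weq_em: "weq a b \<Longrightarrow> em (mon a) = em (mon b)"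
  by (simp add: weq_def em_eq_iff)

lemma wzero_em: "wzero a \<Longrightarrow> em (mon a) = em 0"
  by (simp add: wzero_def em_eq_iff)

lemma spath_path_of:
  assumes "pth r s \<mu> u"
  shows "spath r s (path_of \<mu> u) = em (mon (if \<mu> = [] then [vg u] else map eg \<mu>))"
proof (cases "\<mu> = []")
  case False
  have "mult_list A (map (edge_isom r s) \<mu>) = em (mon (map eg \<mu>))" using False
  proof (induction \<mu> rule: list_nonempty_induct)
    case (cons e \<mu>)
    then obtain f \<mu>' where "\<mu> = f # \<mu>'" by (cases \<mu>) auto
    thus ?case using cons by (simp add: edge_isom_em em_mult mon_mult)
  qed (simp add: edge_isom_em)
  thus ?thesis using False by (simp add: path_of_def graph_cstar_A)
qed (simp add: path_of_def vertex_proj_em)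

text \<open>The projection p_u in the middle of \<open>sword\<close> lets vertices and nonempty
  paths share one form; for nonempty \<mu> it is absorbed by the last edge, whose source is
  u.\<close>

lemma spath_adj_sword:
  assumes p: "pth r s \<mu> u" "pth r s \<nu> u" and l: "length \<mu> = length \<nu>"
  shows "spath r s (path_of \<mu> u) \<otimes>\<^bsub>A\<^esub> adj A (spath r s (path_of \<nu> u)) = em (mon (sword \<mu> \<nu> u))"
proof (cases "\<mu> = []")
  case True
  hence n: "\<nu> = []" using l by simp
  have "weq [vg u, va u] [vg u, vg u]" using weq_ctx[OF weq_rels(1), of "[vg u]" u "[]"] by simp
  also have "weq \<dots> [vg u]" by (rule weq_rels)
  finally have "weq [vg u, va u] [vg u]" .
  thus ?thesis using True n
    by (simp add: spath_path_of em_adj em_mult mon_mult sword_def weq_em)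
next
  case False
  hence n: "\<nu> \<noteq> []" using l by auto
  obtain \<mu>' e where m: "\<mu> = \<mu>' @ [e]" using False by (cases \<mu> rule: rev_cases) auto
  hence u: "u = s e" using p(1) by (simp add: pth_append)
  have f: "map flip_letter (map eg \<nu>) = (map ea \<nu> :: ('v + 'e) letter list)" by simp
  have "weq (map eg \<mu>' @ [eg e, vg (s e)] @ rev (map ea \<nu>)) (map eg \<mu>' @ [eg e] @ rev (map ea \<nu>))"
    by (rule weq_ctx[OF edge_source_vertex])
  hence "em (mon (map eg \<mu> @ rev (map ea \<nu>))) = em (mon (sword \<mu> \<nu> u))"
    by (simp add: weq_em sword_def m u)
  moreover have "spath r s (path_of \<mu> u) \<otimes>\<^bsub>A\<^esub> adj A (spath r s (path_of \<nu> u))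
      = em (mon (map eg \<mu>) * mon (rev (map flip_letter (map eg \<nu>))))"
    using False n by (simp add: spath_path_of[OF p(1)] spath_path_of[OF p(2)] em_adj em_mult del: map_map)
  ultimately show ?thesis by (simp only: f mon_mult)
qed

lemma degree0_closed:
  "x \<in> degree0 \<Longrightarrow> y \<in> degree0 \<Longrightarrow> x + y \<in> degree0"
  "x \<in> degree0 \<Longrightarrow> y \<in> degree0 \<Longrightarrow> x - y \<in> degree0"
  "x \<in> degree0 \<Longrightarrow> y \<in> degree0 \<Longrightarrow> x * y \<in> degree0"
  "x \<in> degree0 \<Longrightarrow> scale_poly z x \<in> degree0"
  "x \<in> degree0 \<Longrightarrow> adj_poly x \<in> degree0"
proof -
  assume x: "x \<in> degree0"
  show "scale_poly z x \<in> degree0" using x by (auto simp: degree0_def in_keys_iff)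
  have "word_degree m = 0" if "m \<in> Poly_Mapping.keys (adj_poly x)" for m
    using that x word_degree_adj[of m] by (auto simp: degree0_def in_keys_iff)
  thus "adj_poly x \<in> degree0" using x by (simp add: degree0_def)
  assume y: "y \<in> degree0"
  show "x + y \<in> degree0" using x y Poly_Mapping.keys_add[of x y] by (auto simp: degree0_def)
  show "x - y \<in> degree0" using x y keys_diff[of x y] by (auto simp: degree0_def)
  have "word_degree m = 0" if "m \<in> Poly_Mapping.keys (x * y)" for m
    using that keys_mult[of x y] x y by (auto simp: degree0_def word_degree_add)
  thus "x * y \<in> degree0" using x y by (simp add: degree0_def)
qed

lemma degree0_sum: "(\<And>i. i \<in> I \<Longrightarrow> f i \<in> degree0) \<Longrightarrow> sum f I \<in> degree0"
  by (induction I rule: infinite_finite_induct) (auto simp: degree0_closed, simp_all add: degree0_def)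

lemma degree0_mon: "ls \<noteq> [] \<Longrightarrow> word_degree (Letters ls) = 0 \<Longrightarrow> mon ls \<in> degree0"
  by (simp add: degree0_def)

lemma degree0_edge: "mon [eg e, ea e] \<in> degree0"
  by (rule degree0_mon) (simp_all add: word_degree_def letter_degree_def)

lemma degree0_vertex: "mon [vg v] \<in> degree0"
  by (rule degree0_mon) (simp_all add: word_degree_def letter_degree_def)

text \<open>The normal form carries the path \<nu> to \<mu>. As the degree of a word is the change
  of length under its action, degree 0 forces equal lengths.\<close>

lemma core_word:
  assumes "ls \<noteq> []" "word_degree (Letters ls) = 0"
  shows "em (mon ls) = em 0 \<or>
    (\<exists>\<mu> \<nu> u. pth r s \<mu> u \<and> pth r s \<nu> u \<and> length \<mu> = length \<nu> \<and> em (mon ls) = em (mon (sword \<mu> \<nu> u)))"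
  using word_reduction[OF assms(1)]
proof (elim disjE exE conjE)
  assume "wzero ls"
  thus ?thesis using wzero_em by blast
next
  fix \<mu> \<nu> u
  assume p: "pth r s \<mu> u" "pth r s \<nu> u" "weq ls (sword \<mu> \<nu> u)"
    and a: "\<forall>v es es'. pth r s es v \<longrightarrow> act r s v ls es = Some es' \<longleftrightarrow> shift r s \<mu> \<nu> u v es es'"
  have "shift r s \<mu> \<nu> u u \<nu> \<mu>" by (auto simp: shift_def intro!: exI[of _ "[]"])
  hence "act r s u ls \<nu> = Some \<mu>" using a p(2) by blast
  from act_degree[OF this] have "length \<mu> = length \<nu>" using assms(2) by simp
  thus ?thesis using p weq_em by blast
qed

section \<open>Sums of vertex projections as an approximate unit\<close>

lemma vpoly_set_fun:
  assumes "finite V"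
  shows "vpoly (set_fun V) = (\<Sum>v\<in>V. mon [vg v])"
proof -
  have "vpoly (set_fun V) = (\<Sum>v\<in>V. scale_poly (set_fun V v) (mon [vg v]))"
    using assms by (intro vpoly_superset) (auto simp: set_fun_def)
  also have "\<dots> = (\<Sum>v\<in>V. mon [vg v])" by (rule sum.cong) (auto simp: set_fun_def scale_simps)
  finally show ?thesis .
qed

lemma vpoly_unit_sword:
  assumes "pth r s \<mu> u" "finite V" "rng r \<mu> u \<in> V"
  shows "gs (vpoly (set_fun V) * mon (sword \<mu> \<nu> u) - mon (sword \<mu> \<nu> u)) = 0"
proof -
  let ?w = "sword \<mu> \<nu> u :: ('v + 'e) letter list"
  have ne: "?w \<noteq> []" by (simp add: sword_def)
  let ?f = "\<lambda>v. mon (vg v # ?w) - (if v = rng r \<mu> u then mon ?w else 0)"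
  have "vpoly (set_fun V) * mon ?w - mon ?w = (\<Sum>v\<in>V. ?f v)"
    using assms(2,3) by (simp add: vpoly_set_fun sum_distrib_right mon_mult sum_subtractf)
  moreover have "gs (?f v) = 0" for v
    using red1_weq[OF assms(1), of "vg v" \<nu>] ne by (auto simp: weq_def wzero_def split: if_splits)
  ultimately show ?thesis using ne by (auto intro!: q_sum_0)
qed

lemma q_add_0:
  assumes "x \<in> free_star_algebra" "y \<in> free_star_algebra" "gs x = 0" "gs y = 0"
  shows "gs (x + y) = 0"
  using q_add[of x y] q_nonneg[of "x + y"] assms by simp

text \<open>Up to the seminorm the unit is exact, not approximate: the nonzero words of
  \<open>x\<close> have normal forms with finitely many range vertices, and \<open>V0\<close>
  collects these.\<close>

lemma vpoly_unit:
  assumes "x \<in> free_star_algebra"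
  shows "\<exists>V0. finite V0 \<and> (\<forall>V. finite V \<longrightarrow> V0 \<subseteq> V \<longrightarrow> gs (vpoly (set_fun V) * x - x) = 0)"
  using assms
proof (induction x rule: free_star_algebra_induct)
  case zero
  show ?case by (intro exI[of _ "{}"]) simp
next
  case (mon ls z)
  have "\<exists>V0. finite V0 \<and> (\<forall>V. finite V \<longrightarrow> V0 \<subseteq> V \<longrightarrow> gs (vpoly (set_fun V) * mon ls - mon ls) = 0)"
    using word_reduction[OF mon]
  proof (elim disjE exE conjE)
    assume "wzero ls"
    hence z: "gs (mon ls) = 0" by (simp add: wzero_def)
    have "gs (vpoly (set_fun V) * mon ls - mon ls) = 0" for V
    proof -
      have "vpoly (set_fun V) * mon ls - mon ls = (vpoly (set_fun V) * mon ls) + (- mon ls)" by simp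
      moreover have "gs (vpoly (set_fun V) * mon ls) = 0" using q_ideal_mult(1)[OF _ z] mon by simp
      moreover have "gs (- mon ls) = 0" using q_minus[of "mon ls"] z mon by simp
      ultimately show ?thesis
        using q_add[of "vpoly (set_fun V) * mon ls" "- mon ls"] q_nonneg[of "vpoly (set_fun V) * mon ls - mon ls"] mon
        by (simp add: F0_closed)
    qed
    thus ?thesis by blast
  next
    fix \<mu> \<nu> u assume p: "pth r s \<mu> u" "weq ls (sword \<mu> \<nu> u)"
    let ?w = "sword \<mu> \<nu> u :: ('v + 'e) letter list"
    have ne: "?w \<noteq> []" by (simp add: sword_def)
    have q0: "gs (mon ls - mon ?w) = 0" using p(2) by (simp add: weq_def)
    have "gs (vpoly (set_fun V) * mon ls - mon ls) = 0" if V: "finite V" "{rng r \<mu> u} \<subseteq> V" for V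
    proof -
      have "gs (vpoly (set_fun V) * (mon ls - mon ?w)) = 0" using mon ne q0 by (intro q_ideal_mult(1)) auto
      hence 1: "gs (vpoly (set_fun V) * mon ls - vpoly (set_fun V) * mon ?w) = 0" by (simp add: right_diff_distrib)
      have 2: "gs (vpoly (set_fun V) * mon ?w - mon ?w) = 0" using V p(1) by (intro vpoly_unit_sword) auto
      have 3: "gs (mon ?w - mon ls) = 0" using q0 q_diff_commute[of "mon ls" "mon ?w"] mon ne by simp
      show ?thesis
        by (rule q_eq_trans[OF _ _ _ q_eq_trans[OF _ _ _ 1 2] 3]) (use mon ne in auto)
    qed
    thus ?thesis by (intro exI[of _ "{rng r \<mu> u}"]) simp
  qed
  then obtain V0 where V0: "finite V0" "\<And>V. finite V \<Longrightarrow> V0 \<subseteq> V \<Longrightarrow> gs (vpoly (set_fun V) * mon ls - mon ls) = 0" by blast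
  have "gs (vpoly (set_fun V) * scale_poly z (mon ls) - scale_poly z (mon ls)) = 0" if "finite V" "V0 \<subseteq> V" for V
    using V0(2)[OF that] mon by (simp add: q_scale scale_diff flip: scale_poly_right)
  thus ?case using V0(1) by blast
next
  case (add x y)
  then obtain V0 V1 where V: "finite V0" "\<And>V. finite V \<Longrightarrow> V0 \<subseteq> V \<Longrightarrow> gs (vpoly (set_fun V) * x - x) = 0"
    "finite V1" "\<And>V. finite V \<Longrightarrow> V1 \<subseteq> V \<Longrightarrow> gs (vpoly (set_fun V) * y - y) = 0" by blast
  have "gs (vpoly (set_fun V) * (x + y) - (x + y)) = 0" if W: "finite V" "V0 \<union> V1 \<subseteq> V" for V
  proof -
    have "vpoly (set_fun V) * (x + y) - (x + y) = (vpoly (set_fun V) * x - x) + (vpoly (set_fun V) * y - y)"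
      by (simp add: ring_distribs)
    moreover have "gs ((vpoly (set_fun V) * x - x) + (vpoly (set_fun V) * y - y)) = 0"
      using V(2)[OF W(1)] V(4)[OF W(1)] W(2) add by (intro q_add_0) auto
    ultimately show ?thesis by (simp only:)
  qed
  thus ?case using V(1,3) by (intro exI[of _ "V0 \<union> V1"]) blast
qed

lemma A_state_hyps:
  "a \<in> core \<Longrightarrow> z \<cdot>\<^bsub>gauge_core r s\<^esub> a \<in> core \<and>
    cnorm (gauge_core r s) (z \<cdot>\<^bsub>gauge_core r s\<^esub> a) = cmod z * cnorm (gauge_core r s) a \<and>
    0 \<le> cnorm (gauge_core r s) a"
  using core_A[of a] by (auto simp: core_closed cnorm_nonneg norm_scale elim!: carrierE)

end

section \<open>Positive contractive functionals on the core\<close>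

locale core_positive = graph_algebra r s
  for r s :: "'e \<Rightarrow> 'v" +
  fixes \<omega> :: "('v, 'e) gelem \<Rightarrow> complex"
  assumes add: "a \<in> core \<Longrightarrow> b \<in> core \<Longrightarrow> \<omega> (a \<oplus>\<^bsub>A\<^esub> b) = \<omega> a + \<omega> b"
    and scale: "a \<in> core \<Longrightarrow> \<omega> (z \<cdot>\<^bsub>A\<^esub> a) = z * \<omega> a"
    and pos: "a \<in> core \<Longrightarrow> \<omega> (adj A a \<otimes>\<^bsub>A\<^esub> a) \<in> \<real>\<^sub>\<ge>\<^sub>0"
    and bound: "a \<in> core \<Longrightarrow> cmod (\<omega> a) \<le> cnorm A a"
begin

lemma \<omega>_add: "x \<in> degree0 \<Longrightarrow> y \<in> degree0 \<Longrightarrow> \<omega> (em (x + y)) = \<omega> (em x) + \<omega> (em y)"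
  using add[OF em_core em_core, of x y] by (simp add: em_add degree0_free)

lemma \<omega>_scale: "x \<in> degree0 \<Longrightarrow> \<omega> (em (scale_poly z x)) = z * \<omega> (em x)"
  using scale[OF em_core, of x z] by (simp add: em_scale degree0_free)

lemma \<omega>_0: "\<omega> (em 0) = 0"
proof -
  have "scale_poly 0 0 = (0 :: ('v + 'e) star_poly)" by (rule poly_mapping_eqI) simp
  thus ?thesis using \<omega>_scale[of 0 0] by (simp add: degree0_def)
qed

lemma \<omega>_diff: "x \<in> degree0 \<Longrightarrow> y \<in> degree0 \<Longrightarrow> \<omega> (em (x - y)) = \<omega> (em x) - \<omega> (em y)"
  using \<omega>_add[of x "scale_poly (-1) y"] \<omega>_scale[of y "-1"] by (simp add: degree0_closed scale_poly_uminus1[symmetric])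
    (simp add: scale_poly_uminus1)

lemma \<omega>_sum: "(\<And>i. i \<in> I \<Longrightarrow> f i \<in> degree0) \<Longrightarrow> \<omega> (em (sum f I)) = (\<Sum>i\<in>I. \<omega> (em (f i)))"
  by (induction I rule: infinite_finite_induct) (auto simp: \<omega>_0 \<omega>_add degree0_sum)

lemma \<omega>_lin:
  assumes "x \<in> degree0"
  shows "\<omega> (em x) = lin (\<lambda>m. \<omega> (em (mon (letters m)))) x"
proof -
  have m: "mon (letters m) \<in> degree0" if "m \<in> Poly_Mapping.keys x" for m
    using assms that by (auto simp: degree0_def free_star_algebra_def lookup_single when_def in_keys_iff split: if_splits)
  have "\<omega> (em x) = \<omega> (em (\<Sum>m\<in>Poly_Mapping.keys x. scale_poly (Poly_Mapping.lookup x m) (mon (letters m))))"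
    using star_poly_decomp[of x] by simp
  also have "\<dots> = (\<Sum>m\<in>Poly_Mapping.keys x. Poly_Mapping.lookup x m * \<omega> (em (mon (letters m))))"
    using m by (simp add: \<omega>_sum \<omega>_scale degree0_closed del: monomial.collapse)
  finally show ?thesis by (simp add: lin_def)
qed

lemma \<omega>_minus:
  assumes "a \<in> core" "b \<in> core"
  shows "\<omega> (a \<ominus>\<^bsub>A\<^esub> b) = \<omega> a - \<omega> b"
  using assms add[OF assms(1) core_closed(4)[OF assms(2), of "-1"]] scale[OF assms(2), of "-1"]
  by (simp add: diff_scale core_A)

lemma \<omega>_pos: "x \<in> degree0 \<Longrightarrow> \<omega> (em (adj_poly x * x)) \<in> \<real>\<^sub>\<ge>\<^sub>0"
  using pos[OF em_core, of x] by (simp add: em_adj em_mult degree0_free)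

lemma \<omega>_cauchy_schwarz:
  assumes x: "x \<in> degree0" and y: "y \<in> degree0"
  shows "(cmod (\<omega> (em (adj_poly x * y))))\<^sup>2 \<le> Re (\<omega> (em (adj_poly x * x))) * Re (\<omega> (em (adj_poly y * y)))"
proof -
  let ?i = "\<lambda>x y. \<omega> (em (adj_poly x * y))"
  note D = degree0_closed
  have e: "?i (x + scale_poly z y) (x + scale_poly z y) = ?i x x + z * ?i x y + cnj z * ?i y x + cnj z * (z * ?i y y)" for z
  proof -
    have "adj_poly (x + scale_poly z y) * (x + scale_poly z y)
      = (adj_poly x * x + scale_poly z (adj_poly x * y)) + (scale_poly (cnj z) (adj_poly y * x)
        + scale_poly (cnj z) (scale_poly z (adj_poly y * y)))"
      by (simp add: adj_poly_add adj_scale ring_distribs scale_mult_scale)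
        (simp add: scale_poly_left scale_poly_right, simp add: scale_simps flip: scale_poly_left scale_poly_right)
    thus ?thesis using x y by (simp add: \<omega>_add \<omega>_scale D)
  qed
  have re: "?i (x + scale_poly z y) (x + scale_poly z y) \<in> \<real>\<^sub>\<ge>\<^sub>0" for z
    using x y by (intro \<omega>_pos D)
  have rx: "?i x x \<in> \<real>\<^sub>\<ge>\<^sub>0" "?i y y \<in> \<real>\<^sub>\<ge>\<^sub>0" using x y by (simp_all add: \<omega>_pos)
  \<comment> \<open>Hermitian symmetry is derived: the form is real at x + z y, and z = 1 and z = i
    give the imaginary and the real part.\<close>
  have "Im (?i x y) = - Im (?i y x)"
    using re[of 1] rx unfolding e by (simp add: complex_nonneg_Reals_iff)
  moreover have "Re (?i x y) = Re (?i y x)"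
    using re[of \<i>] rx unfolding e by (simp add: complex_nonneg_Reals_iff)
  ultimately have h: "?i y x = cnj (?i x y)" by (simp add: complex_eq_iff)
  show ?thesis
  proof (rule discriminant_bound)
    show "0 \<le> Re (?i y y)" using rx by (simp add: complex_nonneg_Reals_iff)
    fix z
    have "cnj z * (z * ?i y y) = of_real ((cmod z)\<^sup>2 * Re (?i y y))"
    proof -
      have "?i y y = of_real (Re (?i y y))" using rx by (simp add: complex_nonneg_Reals_iff complex_eq_iff)
      thus ?thesis by (metis complex_norm_square mult.assoc mult.commute of_real_mult)
    qed
    moreover have "0 \<le> Re (?i (x + scale_poly z y) (x + scale_poly z y))"
      using re[of z] by (simp add: complex_nonneg_Reals_iff)
    moreover have "Re (cnj z * ?i y x) = Re (z * ?i x y)" by (simp add: h)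
    ultimately show "0 \<le> Re (?i x x) + 2 * Re (z * ?i x y) + (cmod z)\<^sup>2 * Re (?i y y)"
      unfolding e by simp
  qed
qed

lemma restr_C0: "a \<in> carrier C0_alg \<Longrightarrow> restr_C0 r s \<omega> a = \<omega> (emb a)"
  by (simp add: restr_C0_def C0_embed_emb)

lemma restr_C0_positive: "C0_positive (restr_C0 r s \<omega>)"
proof
  note h = emb_star_hom[unfolded star_hom_def]
  show "restr_C0 r s \<omega> (\<lambda>v. a v + b v) = restr_C0 r s \<omega> a + restr_C0 r s \<omega> b"
    if "a \<in> carrier C0_alg" "b \<in> carrier C0_alg" for a b
    using that h add[OF emb_core emb_core, of a b] by (simp add: restr_C0 C0_closed)
  show "restr_C0 r s \<omega> (\<lambda>v. z * a v) = z * restr_C0 r s \<omega> a" if "a \<in> carrier C0_alg" for a z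
    using that h scale[OF emb_core, of a z] by (simp add: restr_C0 C0_closed)
  show "restr_C0 r s \<omega> (\<lambda>v. cnj (a v) * a v) \<in> \<real>\<^sub>\<ge>\<^sub>0" if "a \<in> carrier C0_alg" for a
    using that h pos[OF emb_core, of a] C0_closed(3)[OF C0_closed(5)[OF that] that] C0_closed(5)[OF that]
    by (simp add: restr_C0)
  show "cmod (restr_C0 r s \<omega> a) \<le> cnorm C0_alg a" if "a \<in> carrier C0_alg" for a
    using that h bound[OF emb_core, of a] by (auto simp: restr_C0 intro: order_trans)
qed

sublocale C0: C0_positive "restr_C0 r s \<omega>"
  by (rule restr_C0_positive)

lemma \<omega>_vertex: "\<omega> (em (mon [vg v])) = of_real (C0.t v)"
  using C0.\<tau>_char[of v] restr_C0[OF char_fun_C0] by (simp add: emb_char vertex_proj_em)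

lemma \<omega>_vpoly: "finite V \<Longrightarrow> \<omega> (em (vpoly (set_fun V))) = of_real (sum C0.t V)"
  using C0.\<tau>_set_fun[of V] restr_C0[OF finsupp_C0[OF set_fun_finsupp]] by (simp add: emb_finsupp)

lemma \<omega>_eq: "x \<in> degree0 \<Longrightarrow> y \<in> degree0 \<Longrightarrow> gs (x - y) = 0 \<Longrightarrow> \<omega> (em x) = \<omega> (em y)"
  using em_eq_iff[of x y] by (simp add: degree0_free)

text \<open>Cauchy-Schwarz against a finite sum p of vertex projections with p x = x up to the
  seminorm, where \<omega>(p) is at most T. Hence vertex sums bounded away from 1 keep the norm of
  \<omega> below 1.\<close>

lemma \<omega>_le_sqrt:
  assumes T: "\<And>V. finite V \<Longrightarrow> sum C0.t V \<le> T" and x: "x \<in> degree0"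
  shows "cmod (\<omega> (em x)) \<le> sqrt T * gs x"
proof -
  obtain V where V: "finite V" "gs (vpoly (set_fun V) * x - x) = 0"
    using vpoly_unit[OF degree0_free[OF x]] by blast
  let ?p = "vpoly (set_fun V)"
  have fs: "set_fun V \<in> finsupp" using V by simp
  have cn: "(\<lambda>v. cnj (set_fun V v)) = set_fun V" "(\<lambda>v. set_fun V v * set_fun V v) = set_fun V"
    by (auto simp: set_fun_def)
  have a: "gs (adj_poly ?p - ?p) = 0" using vpoly_adj[OF fs] by (simp add: cn)
  have m: "gs (?p * ?p - ?p) = 0" using vpoly_mult[OF fs fs] by (simp add: cn)
  note D = vpoly_degree0 x degree0_closed
  have ax: "gs (adj_poly ?p * y - ?p * y) = 0" if "y \<in> degree0" for y
    using q_ideal_mult(2)[OF _ a degree0_free[OF that]] by (simp add: left_diff_distrib)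
  have T0: "0 \<le> T" using T[of "{}"] by simp
  have 1: "\<omega> (em (adj_poly ?p * x)) = \<omega> (em x)"
    using \<omega>_eq[OF _ _ ax[OF x]] \<omega>_eq[OF _ _ V(2)] D by simp
  have 2: "\<omega> (em (adj_poly ?p * ?p)) = of_real (sum C0.t V)"
    using \<omega>_eq[OF _ _ ax[OF vpoly_degree0]] \<omega>_eq[OF _ _ m] D by (simp add: \<omega>_vpoly[OF V(1)])
  have "Re (\<omega> (em (adj_poly x * x))) \<le> cmod (\<omega> (em (adj_poly x * x)))" by (rule complex_Re_le_cmod)
  also have "\<dots> \<le> gs (adj_poly x * x)" using bound[OF em_core] D by (simp add: em_norm[OF degree0_free, symmetric])
  also have "\<dots> = (gs x)\<^sup>2" using x by (simp add: q_cstar degree0_free)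
  finally have 3: "Re (\<omega> (em (adj_poly x * x))) \<le> (gs x)\<^sup>2" .
  have "(cmod (\<omega> (em x)))\<^sup>2 \<le> sum C0.t V * Re (\<omega> (em (adj_poly x * x)))"
    using \<omega>_cauchy_schwarz[OF vpoly_degree0[of "set_fun V"] x] by (simp only: 1 2 Re_complex_of_real)
  also have "\<dots> \<le> T * (gs x)\<^sup>2"
    using T[OF V(1)] 3 T0 \<omega>_pos[OF x] by (intro mult_mono) (auto simp: complex_nonneg_Reals_iff)
  also have "\<dots> = (sqrt T * gs x)\<^sup>2" using T0 by (simp add: power_mult_distrib)
  finally show ?thesis by (rule power2_le_imp_le) (use T0 q_nonneg[OF degree0_free[OF x]] in simp)
qed

lemma state_core_iff: 
  "state (gauge_core r s) \<omega> \<longleftrightarrow> (\<forall>\<epsilon>>0. \<exists>V. finite V \<and> 1 - \<epsilon> < sum C0.t V)"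
proof
  assume st: "state (gauge_core r s) \<omega>"
  show "\<forall>\<epsilon>>0. \<exists>V. finite V \<and> 1 - \<epsilon> < sum C0.t V"
  proof (rule ccontr)
    assume "\<not> ?thesis"
    then obtain \<epsilon> where e: "\<epsilon> > 0" "\<And>V. finite V \<Longrightarrow> sum C0.t V \<le> 1 - \<epsilon>" by (auto simp: not_less)
    define T where "T = 1 - \<epsilon>"
    have T: "0 \<le> T" "T < 1" using e(1) e(2)[of "{}"] by (auto simp: T_def)
    \<comment> \<open>A third of the gap: the estimate ends at \<open>2 * \<eta> + sqrt T\<close>,
      which equals \<open>1 - \<eta>\<close> and contradicts the choice of \<open>a\<close>.\<close>
    define \<eta> where "\<eta> = (1 - sqrt T) / 3"
    have sT: "sqrt T < 1" "0 \<le> sqrt T" using T by auto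
    hence \<eta>: "\<eta> > 0" by (simp add: \<eta>_def)
    have z: "em 0 \<in> core" "cnorm (gauge_core r s) (em 0) \<le> 1"
      using em_core[of 0] by (simp_all add: degree0_def em_norm)
    obtain a where a: "a \<in> core" "cnorm A a \<le> 1" "1 - \<eta> < cmod (\<omega> a)"
      using state_approx[OF st \<eta> z] by auto
    obtain x where x: "x \<in> degree0" "cnorm A (a \<ominus>\<^bsub>A\<^esub> em x) < \<eta>" using core_approx[OF a(1) \<eta>] .
    have "\<omega> a = \<omega> (a \<ominus>\<^bsub>A\<^esub> em x) + \<omega> (em x)" using \<omega>_minus[OF a(1) em_core[OF x(1)]] by simp
    hence "cmod (\<omega> a) \<le> cmod (\<omega> (a \<ominus>\<^bsub>A\<^esub> em x)) + cmod (\<omega> (em x))" by (metis norm_triangle_ineq)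
    also have "cmod (\<omega> (a \<ominus>\<^bsub>A\<^esub> em x)) \<le> \<eta>"
      using bound[OF core_closed(3)[OF a(1) em_core[OF x(1)]]] x(2) by simp
    also have "cmod (\<omega> (em x)) \<le> sqrt T * gs x"
      using e(2) by (intro \<omega>_le_sqrt x(1)) (simp add: T_def)
    also have "gs x \<le> 1 + \<eta>"
      using cnorm_le_dist[OF core_A[OF a(1)] em_carrier[OF degree0_free[OF x(1)]]] a(2) x
      by (simp add: em_norm degree0_free)
    finally have "cmod (\<omega> a) \<le> \<eta> + sqrt T * (1 + \<eta>)" using sT by (simp add: mult_left_mono)
    also have "\<dots> \<le> 2 * \<eta> + sqrt T" using sT \<eta> by (simp add: algebra_simps mult_left_le_one_le)
    finally show False using a(3) by (simp add: \<eta>_def field_simps)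
  qed
next
  assume ap: "\<forall>\<epsilon>>0. \<exists>V. finite V \<and> 1 - \<epsilon> < sum C0.t V"
  show "state (gauge_core r s) \<omega>"
  proof (rule stateI)
    fix \<epsilon> :: real assume "\<epsilon> > 0"
    then obtain V where V: "finite V" "1 - \<epsilon> < sum C0.t V" using ap by blast
    have "gs (vpoly (set_fun V)) \<le> 1" using V(1) by (intro vpoly_norm_le) (auto simp: set_fun_def)
    moreover have "1 - \<epsilon> < cmod (\<omega> (em (vpoly (set_fun V))))"
      unfolding \<omega>_vpoly[OF V(1)] norm_of_real using V(2) by linarith
    ultimately show "\<exists>a\<in>core. cnorm (gauge_core r s) a \<le> 1 \<and> 1 - \<epsilon> < cmod (\<omega> a)"
      by (intro bexI[of _ "em (vpoly (set_fun V))"]) (auto simp: em_norm intro: em_core vpoly_degree0)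
  qed (simp_all add: add scale pos bound)
qed

end

context graph_algebra
begin

lemma core_positive_if_state:
  assumes "state (gauge_core r s) \<omega>"
  shows "core_positive r s \<omega>"
proof
  show "cmod (\<omega> a) \<le> cnorm A a" if "a \<in> core" for a
    using state_bound[OF assms A_state_hyps that] by simp
qed (use assms in \<open>simp_all add: state_def\<close>)

end

section \<open>The correspondence\<close>

lemma prod_list_powr:
  fixes c :: "'e \<Rightarrow> real"
  assumes "\<And>e. 0 < c e"
  shows "prod_list (map (\<lambda>e. c e powr b) \<mu>) = prod_list (map c \<mu>) powr b"
proof (induction \<mu>)
  case (Cons e \<mu>)
  have "0 \<le> prod_list (map c \<mu>)" by (induction \<mu>) (auto simp: less_imp_le[OF assms])
  thus ?case using Cons assms[of e] by (simp add: powr_mult less_imp_le)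
qed simp

context graph_algebra
begin

lemma scaling_state_sword:
  assumes "scaling_state r s c \<beta> \<omega>" "pth r s \<mu> u" "pth r s \<nu> u" "length \<mu> = length \<nu>"
  shows "\<omega> (em (mon (sword \<mu> \<nu> u))) =
    (if \<mu> = \<nu> then of_real (prod_list (map c \<mu>) powr - \<beta>) * \<omega> (em (mon [vg u])) else 0)"
proof -
  have "is_path r s (path_of \<mu> u) \<and> is_path r s (path_of \<nu> u) \<and>
      path_length (path_of \<mu> u) = path_length (path_of \<nu> u) \<and>
      path_source s (path_of \<mu> u) = path_source s (path_of \<nu> u)"
    using assms by (simp add: path_of_props)
  hence "\<omega> (spath r s (path_of \<mu> u) \<otimes>\<^bsub>A\<^esub> adj A (spath r s (path_of \<nu> u))) =
      (if path_of \<mu> u = path_of \<nu> u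
       then of_real (path_weight c (path_of \<mu> u) powr - \<beta>) * \<omega> (vertex_proj r s (path_source s (path_of \<mu> u)))
       else 0)"
    using assms(1) unfolding scaling_state_def graph_cstar_A by blast
  thus ?thesis
    unfolding spath_adj_sword[OF assms(2-4)] path_of_inject path_of_props(3,4)[OF assms(2)] vertex_proj_em .
qed

lemma scaling_stateI:
  assumes st: "state (gauge_core r s) \<omega>"
    and sw: "\<And>\<mu> \<nu> u. pth r s \<mu> u \<Longrightarrow> pth r s \<nu> u \<Longrightarrow> length \<mu> = length \<nu> \<Longrightarrow>
      \<omega> (em (mon (sword \<mu> \<nu> u))) =
        (if \<mu> = \<nu> then of_real (prod_list (map c \<mu>) powr - \<beta>) * \<omega> (em (mon [vg u])) else 0)"
  shows "scaling_state r s c \<beta> \<omega>"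
  unfolding scaling_state_def graph_cstar_A
proof (intro conjI st allI impI; elim conjE)
  fix p p' :: "('v, 'e) path"
  assume p: "is_path r s p" "is_path r s p'" "path_length p = path_length p'" "path_source s p = path_source s p'"
  define \<mu> \<nu> u where "\<mu> = path_edges p" "\<nu> = path_edges p'" "u = path_source s p"
  note d = this
  have m: "pth r s \<mu> u" "path_of \<mu> u = p" "pth r s \<nu> u" "path_of \<nu> u = p'"
    using path_edges_pth[OF p(1)] path_edges_pth[OF p(2)] p(4) by (simp_all add: d)
  have l: "length \<mu> = length \<nu>"
    using p(3) path_of_props(2)[OF m(1)] path_of_props(2)[OF m(3)] m by simp
  have "spath r s p \<otimes>\<^bsub>A\<^esub> adj A (spath r s p') = em (mon (sword \<mu> \<nu> u))"
    using spath_adj_sword[OF m(1,3) l] by (simp add: m)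
  moreover have "p = p' \<longleftrightarrow> \<mu> = \<nu>" using path_of_inject[of \<mu> u \<nu>] by (simp add: m)
  moreover have "path_weight c p = prod_list (map c \<mu>)" using path_of_props(4)[OF m(1), of c] by (simp add: m)
  ultimately show "\<omega> (spath r s p \<otimes>\<^bsub>A\<^esub> adj A (spath r s p')) =
      (if p = p' then of_real (path_weight c p powr - \<beta>) * \<omega> (vertex_proj r s (path_source s p)) else 0)"
    by (simp only: sw[OF m(1,3) l] vertex_proj_em flip: d(3))
qed

text \<open>The element p_v minus the range projections of the edges in D is itself a projection, so
  it has the form x^* x and positive functionals are nonnegative on it. This yields the vertex form
  of (K2).\<close>

lemma defect_projection:
  assumes D: "finite D" "D \<subseteq> r -` {v}"
  defines "x \<equiv> mon [vg v] - (\<Sum>e\<in>D. mon [eg e, ea e])"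
  shows "gs (adj_poly x * x - x) = 0" "x \<in> degree0"
proof -
  let ?m = "\<lambda>e. mon [eg e, ea e] :: ('v + 'e) star_poly" and ?F = free_star_algebra
  let ?S = "\<Sum>e\<in>D. ?m e"
  show "x \<in> degree0" unfolding x_def
    by (intro degree0_closed(2) degree0_sum degree0_edge degree0_vertex)
  have "adj_poly ?S = ?S"
  proof -
    have "adj_poly (sum f D) = (\<Sum>e\<in>D. adj_poly (f e))" for f :: "'e \<Rightarrow> ('v + 'e) star_poly"
      by (induction D rule: infinite_finite_induct) (simp_all add: adj_poly_add)
    thus ?thesis by simp
  qed
  hence "adj_poly x = mon [va v] - ?S" by (simp add: x_def adj_poly_diff)
  \<comment> \<open>Idempotence splits into four null terms: p_v is idempotent, it absorbs the sum
    on either side since the edges of D have range v, and the sum is idempotent by orthogonality of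
    ranges.\<close>
  hence "adj_poly x * x - x = (mon [va v] * mon [vg v] - mon [vg v]) - (mon [va v] * ?S - ?S)
      - (?S * mon [vg v] - ?S) + (?S * ?S - ?S)"
    by (simp only: x_def) (simp add: algebra_simps)
  moreover have "gs (mon [va v] * mon [vg v] - mon [vg v]) = 0"
    using weq_trans[OF weq_ctx[OF weq_rels(1), of "[]" v "[vg v]", simplified] weq_rels(2)]
    by (simp add: weq_def mon_mult)
  moreover have "gs (mon [va v] * ?S - ?S) = 0"
  proof -
    have "mon [va v] * ?S - ?S = (\<Sum>e\<in>D. mon [va v, eg e, ea e] - ?m e)"
      by (simp add: sum_distrib_left mon_mult sum_subtractf)
    moreover have "gs (mon [va v, eg e, ea e] - ?m e) = 0" if "e \<in> D" for e
    proof -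
      have v: "r e = v" using that D by auto
      have "weq [va v, eg e, ea e] [vg v, eg e, ea e]"
        using weq_ctx[OF weq_rels(1), of "[]" v "[eg e, ea e]"] by simp
      also have "weq \<dots> [eg e, ea e]" using weq_ctx[OF range_edge, of "[]" e "[ea e]"] v by simp
      finally show ?thesis by (simp add: weq_def)
    qed
    ultimately show ?thesis by (auto intro!: q_sum_0)
  qed
  moreover have "gs (?S * mon [vg v] - ?S) = 0"
  proof -
    have "?S * mon [vg v] - ?S = (\<Sum>e\<in>D. mon [eg e, ea e, vg v] - ?m e)"
      by (simp add: sum_distrib_right mon_mult sum_subtractf)
    moreover have "gs (mon [eg e, ea e, vg v] - ?m e) = 0" if "e \<in> D" for e
      using weq_rels(5)[of e] that D by (auto simp: weq_def)
    ultimately show ?thesis by (auto intro!: q_sum_0)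
  qed
  moreover have "gs (?S * ?S - ?S) = 0"
  proof -
    have "?S * ?S - ?S = (\<Sum>e\<in>D. \<Sum>f\<in>D. mon [eg e, ea e, eg f, ea f] - (if e = f then ?m e else 0))"
      using D(1) by (simp add: sum_product mon_mult sum_subtractf)
    moreover have "gs (mon [eg e, ea e, eg f, ea f] - (if e = f then ?m e else 0)) = 0" for e f
      using wzero_rels(2)[of e f] rels[OF edge_idem] by (auto simp: wzero_def)
    ultimately show ?thesis by (auto intro!: q_sum_0 sum_free)
  qed
  moreover have F: "?S \<in> ?F" by (rule sum_free) simp
  moreover have "gs (a - b) = 0" if "a \<in> ?F" "b \<in> ?F" "gs a = 0" "gs b = 0" for a b
    using q_add_0[of a "- b"] that q_minus[of b] by simp
  ultimately show "gs (adj_poly x * x - x) = 0"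
    by (simp only:) (intro q_add_0; simp add: F)
qed

theorem scaling_state_restr:
  assumes sc: "scaling_state r s c \<beta> \<omega>" and c: "\<And>e. 0 < c e"
  shows "state C0_alg (restr_C0 r s \<omega>)"
    "edge_conditions r s (\<lambda>e. c e powr - \<beta>) (\<lambda>v. Re (restr_C0 r s \<omega> (char_fun v)))"
proof -
  have st: "state (gauge_core r s) \<omega>" using sc by (simp add: scaling_state_def)
  interpret core_positive r s \<omega> by (rule core_positive_if_state[OF st])
  show "state C0_alg (restr_C0 r s \<omega>)"
    using state_core_iff st restr_C0_positive by (simp add: state_C0_iff C0.t_def)
  have e: "\<omega> (em (mon [eg e, ea e])) = of_real (c e powr - \<beta> * C0.t (s e))" for e
  proof -
    have "weq (sword [e] [e] (s e)) [eg e, ea e]"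
      using weq_ctx[OF edge_source_vertex, of "[]" e "[ea e]"] by (simp add: sword_def)
    hence "\<omega> (em (mon [eg e, ea e])) = \<omega> (em (mon (sword [e] [e] (s e))))" by (simp add: weq_em)
    also have "\<dots> = of_real (c e powr - \<beta>) * \<omega> (em (mon [vg (s e)]))"
      using scaling_state_sword[OF sc, of "[e]" "s e" "[e]"] by simp
    finally show ?thesis by (simp add: \<omega>_vertex)
  qed
  have s: "\<omega> (em (\<Sum>e\<in>D. mon [eg e, ea e])) = of_real (\<Sum>e\<in>D. c e powr - \<beta> * C0.t (s e))" for D
    by (simp add: \<omega>_sum degree0_edge e)
  show "edge_conditions r s (\<lambda>e. c e powr - \<beta>) (\<lambda>v. Re (restr_C0 r s \<omega> (char_fun v)))"
    unfolding edge_conditions_def C0.t_def[symmetric]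
  proof (intro conjI allI impI; elim conjE)
    fix v D assume D: "finite D" "D \<subseteq> r -` {v}"
    let ?x = "mon [vg v] - (\<Sum>e\<in>D. mon [eg e, ea e])"
    note x = defect_projection[OF D]
    have "\<omega> (em ?x) = of_real (C0.t v - (\<Sum>e\<in>D. c e powr - \<beta> * C0.t (s e)))"
      by (simp add: \<omega>_diff degree0_vertex degree0_sum degree0_edge \<omega>_vertex s del: of_real_mult)
    moreover have "\<omega> (em ?x) \<in> \<real>\<^sub>\<ge>\<^sub>0"
      using \<omega>_pos[OF x(2)] \<omega>_eq[OF degree0_closed(3)[OF degree0_closed(5)[OF x(2)] x(2)] x(2) x(1)] by simp
    ultimately have "0 \<le> C0.t v - (\<Sum>e\<in>D. c e powr - \<beta> * C0.t (s e))"
      by (simp only: nonneg_Reals_of_real_iff)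
    thus "(\<Sum>e\<in>D. c e powr - \<beta> * C0.t (s e)) \<le> C0.t v" by linarith
  next
    fix v assume v: "finite (r -` {v})" "r -` {v} \<noteq> {}"
    have "\<omega> (em (mon [vg v])) = \<omega> (em (\<Sum>e\<in>r -` {v}. mon [eg e, ea e]))"
      by (intro \<omega>_eq degree0_vertex degree0_sum degree0_edge rels vertex_sum v)
    thus "(\<Sum>e\<in>r -` {v}. c e powr - \<beta> * C0.t (s e)) = C0.t v"
      unfolding \<omega>_vertex s of_real_eq_iff ..
  qed
qed

theorem scaling_state_unique:
  assumes sc: "scaling_state r s c \<beta> \<omega>" "scaling_state r s c \<beta> \<omega>'"
    and eq: "\<And>a. a \<in> carrier C0_alg \<Longrightarrow> restr_C0 r s \<omega> a = restr_C0 r s \<omega>' a"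
    and a: "a \<in> core"
  shows "\<omega> a = \<omega>' a"
proof -
  interpret o: core_positive r s \<omega>
    by (rule core_positive_if_state) (use sc in \<open>simp add: scaling_state_def\<close>)
  interpret o': core_positive r s \<omega>'
    by (rule core_positive_if_state) (use sc in \<open>simp add: scaling_state_def\<close>)
  have v: "\<omega> (em (mon [vg u])) = \<omega>' (em (mon [vg u]))" for u
    unfolding o.\<omega>_vertex o'.\<omega>_vertex o.C0.t_def o'.C0.t_def by (simp add: eq)
  have w: "\<omega> (em (mon ls)) = \<omega>' (em (mon ls))" if "ls \<noteq> []" "word_degree (Letters ls) = 0" for ls
    using core_word[OF that] scaling_state_sword[OF sc(1)] scaling_state_sword[OF sc(2)] v
    by (auto simp: o.\<omega>_0 o'.\<omega>_0)
  have x: "\<omega> (em x) = \<omega>' (em x)" if "x \<in> degree0" for x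
    unfolding o.\<omega>_lin[OF that] o'.\<omega>_lin[OF that]
  proof (rule lin_cong)
    fix m assume m: "m \<in> Poly_Mapping.keys x"
    have "letters m \<noteq> []"
      using that m by (cases m) (auto simp: degree0_def free_star_algebra_def in_keys_iff zero_monomial_def)
    thus "\<omega> (em (mon (letters m))) = \<omega>' (em (mon (letters m)))"
      using that m by (intro w) (simp_all add: degree0_def)
  qed
  have "cmod (\<omega> a - \<omega>' a) \<le> 0"
  proof (rule field_le_epsilon)
    fix \<epsilon> :: real assume "\<epsilon> > 0"
    then obtain y where y: "y \<in> degree0" "cnorm A (a \<ominus>\<^bsub>A\<^esub> em y) < \<epsilon>/2" using core_approx[OF a, of "\<epsilon>/2"] by auto
    note d = core_closed(3)[OF a em_core[OF y(1)]]
    have "\<omega> a - \<omega>' a = \<omega> (a \<ominus>\<^bsub>A\<^esub> em y) - \<omega>' (a \<ominus>\<^bsub>A\<^esub> em y)"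
      using o.\<omega>_minus[OF a em_core[OF y(1)]] o'.\<omega>_minus[OF a em_core[OF y(1)]] x[OF y(1)] by simp
    hence "cmod (\<omega> a - \<omega>' a) \<le> cmod (\<omega> (a \<ominus>\<^bsub>A\<^esub> em y)) + cmod (\<omega>' (a \<ominus>\<^bsub>A\<^esub> em y))"
      by (simp add: norm_triangle_ineq4)
    also have "\<dots> \<le> 0 + \<epsilon>" using o.bound[OF d] o'.bound[OF d] y(2) by linarith
    finally show "cmod (\<omega> a - \<omega>' a) \<le> 0 + \<epsilon>" .
  qed
  thus ?thesis by simp
qed

section \<open>Existence by continuous extension\<close>

definition extend :: "(('v + 'e) monomial \<Rightarrow> complex) \<Rightarrow> ('v, 'e) gelem \<Rightarrow> complex" where
  "extend f a = lim (\<lambda>n. lin f (cauchy_rep a n))"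

text \<open>Domination by the universal seminorm makes the values along Cauchy sequences converge,
  with a limit independent of the sequence that \<open>cauchy_rep\<close> picks.\<close>

lemma extend_tendsto:
  assumes f: "\<forall>x\<in>free_star_algebra. cmod (lin f x) \<le> gs x" and X: "X \<in> C"
  shows "(\<lambda>n. lin f (X n)) \<longlonglongrightarrow> extend f (cl X)"
proof -
  have conv: "convergent (\<lambda>n. lin f (X n))" if X: "X \<in> C" for X
  proof (rule Cauchy_convergent, rule CauchyI)
    fix e :: real assume "e > 0"
    then obtain N where N: "\<forall>m\<ge>N. \<forall>n\<ge>N. gs (X m - X n) < e" using CD[OF X] by blast
    have "norm (lin f (X m) - lin f (X n)) \<le> gs (X m - X n)" for m n
      using f C_F0[OF X] by (simp flip: lin_diff)
    thus "\<exists>M. \<forall>m\<ge>M. \<forall>n\<ge>M. norm (lin f (X m) - lin f (X n)) < e"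
      using N order_le_less_trans by blast
  qed
  note e = rep_cl[OF X]
  have "(\<lambda>n. lin f (X n) - lin f (cauchy_rep (cl X) n)) \<longlonglongrightarrow> 0"
  proof (rule tendsto_norm_zero_cancel, rule tendsto_sandwich[OF _ _ tendsto_const eqv_lim[OF e]])
    show "\<forall>\<^sub>F n in sequentially. norm (lin f (X n) - lin f (cauchy_rep (cl X) n)) \<le> gs (X n - cauchy_rep (cl X) n)"
      using f C_F0[OF X] C_F0[OF eqvC(2)[OF e]]
      by (intro always_eventually) (simp flip: lin_diff)
  qed simp
  moreover have "(\<lambda>n. lin f (cauchy_rep (cl X) n)) \<longlonglongrightarrow> extend f (cl X)"
    using conv[OF eqvC(2)[OF e]] by (simp add: extend_def convergent_LIMSEQ_iff)
  ultimately show ?thesis using tendsto_add by fastforce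
qed

lemma extend_core_positive:
  assumes f: "\<forall>x\<in>free_star_algebra. cmod (lin f x) \<le> gs x"
    and p: "\<And>x. lin f (adj_poly x * x) \<in> \<real>\<^sub>\<ge>\<^sub>0"
  shows "core_positive r s (extend f)"
proof
  note T = extend_tendsto[OF f]
  fix a b assume "a \<in> core" "b \<in> core"
  then obtain X Y where X: "X \<in> C" "a = cl X" "Y \<in> C" "b = cl Y" using core_A by (metis carrierE)
  show "extend f (a \<oplus>\<^bsub>A\<^esub> b) = extend f a + extend f b"
    using LIMSEQ_unique[OF T[OF C_add[OF X(1,3)]]] tendsto_add[OF T[OF X(1)] T[OF X(3)]] X
    by (simp add: add_cl lin_add)
next
  note T = extend_tendsto[OF f]
  fix a z assume "a \<in> core"
  then obtain X where X: "X \<in> C" "a = cl X" using core_A by (metis carrierE)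
  show "extend f (z \<cdot>\<^bsub>A\<^esub> a) = z * extend f a"
    using LIMSEQ_unique[OF T[OF C_scale[OF X(1)]]] tendsto_mult_left[OF T[OF X(1)], of z] X
    by (simp add: scale_cl lin_scale)
next
  note T = extend_tendsto[OF f]
  fix a assume "a \<in> core"
  then obtain X where X: "X \<in> C" "a = cl X" using core_A by (metis carrierE)
  have "(\<lambda>n. lin f (adj_poly (X n) * X n)) \<longlonglongrightarrow> extend f (adj A a \<otimes>\<^bsub>A\<^esub> a)"
    using T[OF C_mult[OF C_adj[OF X(1)] X(1)]] X by (simp add: adj_cl mult_cl C_adj)
  thus "extend f (adj A a \<otimes>\<^bsub>A\<^esub> a) \<in> \<real>\<^sub>\<ge>\<^sub>0"
    by (rule closed_sequentially[OF closed_nonneg_Reals_complex p])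
  show "cmod (extend f a) \<le> cnorm A a"
    using LIMSEQ_le[OF tendsto_norm[OF T[OF X(1)]] norm_cl[OF X(1)]] f C_F0[OF X(1)] X(2) by blast
qed

theorem scaling_state_exists:
  assumes st: "state C0_alg \<tau>" and c: "\<And>e. 0 < c e"
    and E: "edge_conditions r s (\<lambda>e. c e powr - \<beta>) (\<lambda>v. Re (\<tau> (char_fun v)))"
  shows "\<exists>\<omega>. scaling_state r s c \<beta> \<omega> \<and> (\<forall>a\<in>carrier C0_alg. restr_C0 r s \<omega> a = \<tau> a)"
proof -
  interpret T: C0_positive \<tau> using st by (simp add: state_C0_iff)
  interpret W: edge_weights r s "\<lambda>e. c e powr - \<beta>" T.t
  proof
    show "(\<Sum>e\<in>D. c e powr - \<beta> * T.t (s e)) \<le> T.t v" if "finite D" "D \<subseteq> r -` {v}" for D v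
      using E that unfolding edge_conditions_def T.t_def by blast
    show "(\<Sum>e\<in>r -` {v}. c e powr - \<beta> * T.t (s e)) = T.t v" if "finite (r -` {v})" "r -` {v} \<noteq> {}" for v
      using E that unfolding edge_conditions_def T.t_def by blast
  qed (simp_all add: T.t_nonneg T.sum_t_le)
  let ?\<omega> = "extend W.phi"
  have f: "\<forall>x\<in>free_star_algebra. cmod (lin W.phi x) \<le> gs x" using W.phi_le_graph_seminorm by blast
  interpret core_positive r s ?\<omega> by (rule extend_core_positive[OF f W.phi_pos])
  have em: "?\<omega> (em x) = lin W.phi x" if "x \<in> free_star_algebra" for x
    using LIMSEQ_unique[OF extend_tendsto[OF f C_const[OF that]] tendsto_const] by (simp add: em_def)
  have vp: "W.phi (Letters [vg v]) = of_real (T.t v)" for v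
    using W.phi_sword(1)[of "[]" v] by (simp add: sword_def W.wt_def)
  have restr: "restr_C0 r s ?\<omega> a = \<tau> a" if a: "a \<in> carrier C0_alg" for a
  proof -
    have "lin W.phi (C0_seq a n) = \<tau> (cutoff n a)" for n
    proof -
      have "finite {v. cutoff n a v \<noteq> 0}" using cutoff_finsupp[OF a, of n] by (simp add: finsupp_def)
      from T.\<tau>_finsupp[OF this subset_refl] show ?thesis
        by (simp add: C0_seq_def vpoly_def lin_sum lin_scale vp)
    qed
    hence 1: "(\<lambda>n. \<tau> (cutoff n a)) \<longlonglongrightarrow> ?\<omega> (emb a)"
      using extend_tendsto[OF f C0_seq_C[OF a]] by (simp add: emb_def)
    have "(\<lambda>n. \<tau> a - \<tau> (cutoff n a)) \<longlonglongrightarrow> 0"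
    proof (rule tendsto_norm_zero_cancel, rule tendsto_sandwich[OF _ _ tendsto_const LIMSEQ_inverse_real_of_nat])
      show "\<forall>\<^sub>F n in sequentially. norm (\<tau> a - \<tau> (cutoff n a)) \<le> inverse (real (Suc n))"
        using T.\<tau>_cutoff_le[OF a] by (intro always_eventually) blast
    qed simp
    from tendsto_diff[OF tendsto_const this, of "\<tau> a"] have "(\<lambda>n. \<tau> (cutoff n a)) \<longlonglongrightarrow> \<tau> a" by simp
    from LIMSEQ_unique[OF 1 this] show ?thesis using a by (simp add: restr_C0)
  qed
  \<comment> \<open>The norm of the extension is not computed directly: its vertex values are those
    of \<tau>, whose finite sums come arbitrarily close to 1.\<close>
  have "state (gauge_core r s) ?\<omega>"
    unfolding state_core_iff C0.t_def using st by (simp add: state_C0_iff restr)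
  hence "scaling_state r s c \<beta> ?\<omega>"
  proof (rule scaling_stateI)
    fix \<mu> \<nu> u assume p: "pth r s \<mu> u" "pth r s \<nu> u" "length \<mu> = length \<nu>"
    have "sword \<mu> \<nu> u \<noteq> []" by (simp add: sword_def)
    thus "?\<omega> (em (mon (sword \<mu> \<nu> u))) =
        (if \<mu> = \<nu> then of_real (prod_list (map c \<mu>) powr - \<beta>) * ?\<omega> (em (mon [vg u])) else 0)"
      using W.phi_sword[OF p(1)]
      by (cases "\<mu> = \<nu>") (simp_all add: em vp W.wt_def prod_list_powr[OF c])
  qed
  thus ?thesis using restr by blast
qed

theorem scaling_state_convex:
  assumes I: "finite I" "\<And>i. i \<in> I \<Longrightarrow> 0 \<le> (t i :: real)" "sum t I = 1"
    and sc: "\<And>i. i \<in> I \<Longrightarrow> scaling_state r s c \<beta> (\<omega> i)"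
  shows "scaling_state r s c \<beta> (\<lambda>x. \<Sum>i\<in>I. of_real (t i) * \<omega> i x)"
proof -
  let ?o = "\<lambda>x. \<Sum>i\<in>I. of_real (t i) * \<omega> i x"
  have st: "state (gauge_core r s) (\<omega> i)" if "i \<in> I" for i
    using sc[OF that] by (simp add: scaling_state_def)
  have cp: "core_positive r s (\<omega> i)" if "i \<in> I" for i
    by (rule core_positive_if_state[OF st[OF that]])
  interpret o: core_positive r s ?o
  proof
    fix a b assume ab: "a \<in> core" "b \<in> core"
    show "?o (a \<oplus>\<^bsub>A\<^esub> b) = ?o a + ?o b"
      using ab by (simp add: core_positive.add[OF cp] ring_distribs sum.distrib)
  next
    fix a z assume a: "a \<in> core"
    show "?o (z \<cdot>\<^bsub>A\<^esub> a) = z * ?o a"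
      using a by (simp add: core_positive.scale[OF cp] sum_distrib_left mult_ac)
  next
    fix a assume a: "a \<in> core"
    show "?o (adj A a \<otimes>\<^bsub>A\<^esub> a) \<in> \<real>\<^sub>\<ge>\<^sub>0"
      using a I by (intro nonneg_Reals_sum nonneg_Reals_mult_I core_positive.pos[OF cp]) auto
    have "cmod (?o a) \<le> (\<Sum>i\<in>I. t i * cnorm A a)"
    proof (rule order_trans[OF norm_sum], rule sum_mono)
      fix i assume i: "i \<in> I"
      have "cmod (of_real (t i) * \<omega> i a) = t i * cmod (\<omega> i a)"
        using I(2)[OF i] by (simp add: Real_Vector_Spaces.norm_mult)
      also have "\<dots> \<le> t i * cnorm A a"
        by (intro mult_left_mono core_positive.bound[OF cp[OF i] a] I(2)[OF i])
      finally show "cmod (of_real (t i) * \<omega> i a) \<le> t i * cnorm A a" .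
    qed
    thus "cmod (?o a) \<le> cnorm A a" by (simp add: I(3) flip: sum_distrib_right)
  qed
  have "state (gauge_core r s) ?o"
    unfolding o.state_core_iff
  proof (intro allI impI)
    fix \<epsilon> :: real assume e: "\<epsilon> > 0"
    let ?t = "\<lambda>i v. Re (restr_C0 r s (\<omega> i) (char_fun v))"
    \<comment> \<open>The vertex sums only grow with V, so the union of the sets found for each i
      serves all of them; half of \<epsilon> leaves room for the strict inequality lost in
      averaging.\<close>
    have "\<exists>V. finite V \<and> 1 - \<epsilon>/2 < sum (?t i) V" if "i \<in> I" for i
      using core_positive.state_core_iff[OF cp[OF that], THEN iffD1, OF st[OF that], rule_format, OF half_gt_zero[OF e]]
      by (simp add: C0_positive.t_def[OF core_positive.restr_C0_positive[OF cp[OF that]]])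
    then obtain V where V: "\<And>i. i \<in> I \<Longrightarrow> finite (V i) \<and> 1 - \<epsilon>/2 < sum (?t i) (V i)" by metis
    let ?V = "\<Union>i\<in>I. V i"
    have fin: "finite ?V" using I(1) V by blast
    have "1 - \<epsilon>/2 \<le> sum (?t i) ?V" if "i \<in> I" for i
    proof -
      have "0 \<le> ?t i v" for v
        using C0_positive.t_nonneg[OF core_positive.restr_C0_positive[OF cp[OF that]], of v]
        by (simp add: C0_positive.t_def[OF core_positive.restr_C0_positive[OF cp[OF that]]])
      hence "sum (?t i) (V i) \<le> sum (?t i) ?V" using that fin by (intro sum_mono2) auto
      thus ?thesis using V[OF that] by simp
    qed
    hence "(\<Sum>i\<in>I. t i * (1 - \<epsilon>/2)) \<le> (\<Sum>i\<in>I. t i * sum (?t i) ?V)"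
      using I(2) by (intro sum_mono mult_left_mono)
    also have "(\<Sum>i\<in>I. t i * (1 - \<epsilon>/2)) = 1 - \<epsilon>/2" by (simp add: I(3) flip: sum_distrib_right)
    also have "(\<Sum>i\<in>I. t i * sum (?t i) ?V) = sum o.C0.t ?V"
    proof -
      have "o.C0.t v = (\<Sum>i\<in>I. t i * ?t i v)" for v
        by (simp add: o.C0.t_def restr_C0_def)
      thus ?thesis unfolding sum_distrib_left by (simp add: sum.swap[of _ I])
    qed
    finally show "\<exists>V. finite V \<and> 1 - \<epsilon> < sum o.C0.t V" using fin e by (intro exI[of _ ?V]) auto
  qed
  thus ?thesis
  proof (rule scaling_stateI)
    fix \<mu> \<nu> u assume p: "pth r s \<mu> u" "pth r s \<nu> u" "length \<mu> = length \<nu>"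
    show "?o (em (mon (sword \<mu> \<nu> u))) =
        (if \<mu> = \<nu> then of_real (prod_list (map c \<mu>) powr - \<beta>) * ?o (em (mon [vg u])) else 0)"
      using scaling_state_sword[OF sc p] by (auto simp: sum_distrib_left mult_ac)
  qed
qed

end

text \<open>Functionals are total functions, and the restriction of a convex combination agrees with
  the combination of the traces only on the carrier; this transfers the state property across that
  difference.\<close>

lemma state_C0_cong:
  fixes \<tau> \<tau>' :: "('v \<Rightarrow> complex) \<Rightarrow> complex"
  assumes "\<And>a. a \<in> carrier C0_alg \<Longrightarrow> \<tau> a = \<tau>' a" "state C0_alg \<tau>"
  shows "state C0_alg \<tau>'"
proof -
  interpret C0_positive \<tau> using assms(2) by (simp add: state_C0_iff)
  have "C0_positive \<tau>'"
  proof
    fix a b :: "'v \<Rightarrow> complex" assume "a \<in> carrier C0_alg" "b \<in> carrier C0_alg"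
    thus "\<tau>' (\<lambda>v. a v + b v) = \<tau>' a + \<tau>' b" using add by (simp add: C0_closed flip: assms(1))
  next
    fix a :: "'v \<Rightarrow> complex" and z assume a: "a \<in> carrier C0_alg"
    thus "\<tau>' (\<lambda>v. z * a v) = z * \<tau>' a" using scale by (simp add: C0_closed flip: assms(1))
    show "\<tau>' (\<lambda>v. cnj (a v) * a v) \<in> \<real>\<^sub>\<ge>\<^sub>0"
      using pos[OF a] a assms(1)[OF C0_closed(3)[OF C0_closed(5)[OF a] a]] by simp
    show "cmod (\<tau>' a) \<le> cnorm C0_alg a" using bound[OF a] assms(1)[OF a] by simp
  qed
  thus ?thesis using assms(2) by (simp add: state_C0_iff assms(1))
qed

theorem theorem3p10:
  fixes r s :: "'e \<Rightarrow> 'v" and c :: "'e \<Rightarrow> real" and \<beta> k :: real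
  assumes "\<beta> > 0" and "k > 0" and "\<And>e. c e > 0" and "\<And>e. c e > k"
  shows
    "(\<forall>\<omega>. scaling_state r s c \<beta> \<omega> \<longrightarrow>
        tracial_state C0_alg (restr_C0 r s \<omega>) \<and>
        cond_K1 r s c \<beta> (restr_C0 r s \<omega>) \<and> cond_K2 r s c \<beta> (restr_C0 r s \<omega>)) \<and>
     (\<forall>\<tau>. tracial_state C0_alg \<tau> \<and> cond_K1 r s c \<beta> \<tau> \<and> cond_K2 r s c \<beta> \<tau> \<longrightarrow>
        (\<exists>\<omega>. scaling_state r s c \<beta> \<omega> \<and> (\<forall>a\<in>carrier C0_alg. restr_C0 r s \<omega> a = \<tau> a) \<and>
          (\<forall>\<omega>'. scaling_state r s c \<beta> \<omega>' \<and> (\<forall>a\<in>carrier C0_alg. restr_C0 r s \<omega>' a = \<tau> a) \<longrightarrow>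
             (\<forall>x\<in>carrier (gauge_core r s). \<omega>' x = \<omega> x)))) \<and>
     (\<forall>(I :: nat set) t \<tau> \<omega>.
        finite I \<and> (\<forall>i\<in>I. (0::real) \<le> t i) \<and> sum t I = 1 \<and>
        (\<forall>i\<in>I. tracial_state C0_alg (\<tau> i) \<and> cond_K1 r s c \<beta> (\<tau> i) \<and> cond_K2 r s c \<beta> (\<tau> i) \<and>
           scaling_state r s c \<beta> (\<omega> i) \<and> (\<forall>a\<in>carrier C0_alg. restr_C0 r s (\<omega> i) a = \<tau> i a)) \<longrightarrow>
        tracial_state C0_alg (\<lambda>a. \<Sum>i\<in>I. of_real (t i) * \<tau> i a) \<and>
        cond_K1 r s c \<beta> (\<lambda>a. \<Sum>i\<in>I. of_real (t i) * \<tau> i a) \<and>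
        cond_K2 r s c \<beta> (\<lambda>a. \<Sum>i\<in>I. of_real (t i) * \<tau> i a) \<and>
        scaling_state r s c \<beta> (\<lambda>x. \<Sum>i\<in>I. of_real (t i) * \<omega> i x) \<and>
        (\<forall>a\<in>carrier C0_alg. restr_C0 r s (\<lambda>x. \<Sum>i\<in>I. of_real (t i) * \<omega> i x) a
                         = (\<Sum>i\<in>I. of_real (t i) * \<tau> i a)))"
proof -
  interpret graph_algebra r s .
  have part1: "tracial_state C0_alg (restr_C0 r s \<omega>) \<and>
      cond_K1 r s c \<beta> (restr_C0 r s \<omega>) \<and> cond_K2 r s c \<beta> (restr_C0 r s \<omega>)"
    if "scaling_state r s c \<beta> \<omega>" for \<omega>
    using scaling_state_restr[OF that assms(3)]
      K_iff_edge_conditions[OF scaling_state_restr(1)[OF that assms(3)], of r s c \<beta>]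
    by (simp add: tracial_state_C0_iff)
  have part2: "\<exists>\<omega>. scaling_state r s c \<beta> \<omega> \<and> (\<forall>a\<in>carrier C0_alg. restr_C0 r s \<omega> a = \<tau> a) \<and>
      (\<forall>\<omega>'. scaling_state r s c \<beta> \<omega>' \<and> (\<forall>a\<in>carrier C0_alg. restr_C0 r s \<omega>' a = \<tau> a) \<longrightarrow>
         (\<forall>x\<in>core. \<omega>' x = \<omega> x))"
    if \<tau>: "tracial_state C0_alg \<tau>" "cond_K1 r s c \<beta> \<tau>" "cond_K2 r s c \<beta> \<tau>" for \<tau>
  proof -
    have st: "state C0_alg \<tau>" using \<tau>(1) by (simp add: tracial_state_C0_iff)
    have "edge_conditions r s (\<lambda>e. c e powr - \<beta>) (\<lambda>v. Re (\<tau> (char_fun v)))"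
      using K_iff_edge_conditions[OF st, of r s c \<beta>] \<tau>(2,3) by simp
    from scaling_state_exists[OF st assms(3) this] obtain \<omega> where
      \<omega>: "scaling_state r s c \<beta> \<omega>" "\<And>a. a \<in> carrier C0_alg \<Longrightarrow> restr_C0 r s \<omega> a = \<tau> a" by blast
    have "\<omega>' x = \<omega> x"
      if "scaling_state r s c \<beta> \<omega>'" "\<And>a. a \<in> carrier C0_alg \<Longrightarrow> restr_C0 r s \<omega>' a = \<tau> a" "x \<in> core" for \<omega>' x
      by (rule scaling_state_unique[OF that(1) \<omega>(1) _ that(3)]) (simp add: \<omega>(2) that(2))
    thus ?thesis using \<omega> by blast
  qed
  have part3: "tracial_state C0_alg (\<lambda>a. \<Sum>i\<in>I. of_real (t i) * \<tau> i a) \<and>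
      cond_K1 r s c \<beta> (\<lambda>a. \<Sum>i\<in>I. of_real (t i) * \<tau> i a) \<and>
      cond_K2 r s c \<beta> (\<lambda>a. \<Sum>i\<in>I. of_real (t i) * \<tau> i a) \<and>
      scaling_state r s c \<beta> (\<lambda>x. \<Sum>i\<in>I. of_real (t i) * \<omega> i x) \<and>
      (\<forall>a\<in>carrier C0_alg. restr_C0 r s (\<lambda>x. \<Sum>i\<in>I. of_real (t i) * \<omega> i x) a
         = (\<Sum>i\<in>I. of_real (t i) * \<tau> i a))"
    if I: "finite I" "\<And>i. i \<in> I \<Longrightarrow> (0::real) \<le> t i" "sum t I = 1"
      and sc: "\<And>i. i \<in> I \<Longrightarrow> scaling_state r s c \<beta> (\<omega> i)"
      and re: "\<And>i a. i \<in> I \<Longrightarrow> a \<in> carrier C0_alg \<Longrightarrow> restr_C0 r s (\<omega> i) a = \<tau> i a"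
    for I :: "nat set" and t \<tau> \<omega>
  proof -
    let ?o = "\<lambda>x. \<Sum>i\<in>I. of_real (t i) * \<omega> i x" and ?\<tau> = "\<lambda>a. \<Sum>i\<in>I. of_real (t i) * \<tau> i a"
    have o: "scaling_state r s c \<beta> ?o" by (rule scaling_state_convex[OF I sc])
    have eq: "restr_C0 r s ?o a = ?\<tau> a" if "a \<in> carrier C0_alg" for a
      using re that by (simp add: restr_C0_def)
    have st: "state C0_alg ?\<tau>"
      by (rule state_C0_cong[OF eq scaling_state_restr(1)[OF o assms(3)]])
    have "edge_conditions r s (\<lambda>e. c e powr - \<beta>) (\<lambda>v. Re (?\<tau> (char_fun v)))"
      using scaling_state_restr(2)[OF o assms(3)] by (simp only: eq[OF char_fun_C0])
    thus ?thesis using K_iff_edge_conditions[OF st, of r s c \<beta>] st o eq by (simp add: tracial_state_C0_iff)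
  qed
  show ?thesis
  proof (rule conjI[OF _ conjI]; intro allI)
    fix \<omega>
    show "scaling_state r s c \<beta> \<omega> \<longrightarrow> tracial_state C0_alg (restr_C0 r s \<omega>) \<and>
        cond_K1 r s c \<beta> (restr_C0 r s \<omega>) \<and> cond_K2 r s c \<beta> (restr_C0 r s \<omega>)"
      by (rule impI) (rule part1)
  next
    fix \<tau> :: "('v \<Rightarrow> complex) \<Rightarrow> complex"
    show "tracial_state C0_alg \<tau> \<and> cond_K1 r s c \<beta> \<tau> \<and> cond_K2 r s c \<beta> \<tau> \<longrightarrow>
        (\<exists>\<omega>. scaling_state r s c \<beta> \<omega> \<and> (\<forall>a\<in>carrier C0_alg. restr_C0 r s \<omega> a = \<tau> a) \<and>
          (\<forall>\<omega>'. scaling_state r s c \<beta> \<omega>' \<and> (\<forall>a\<in>carrier C0_alg. restr_C0 r s \<omega>' a = \<tau> a) \<longrightarrow>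
             (\<forall>x\<in>core. \<omega>' x = \<omega> x)))"
      by (rule impI, elim conjE, rule part2)
  qed (rule impI, elim conjE, rule part3; simp)
qed

end
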